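(* Let $\tau\in(0,1)$. Then $Q_{S_\tau}(\varphi)\in C_0(\mathbb{R}^{2d})$ for some $\varphi\in L^2(\mathbb{R}^d)$ such that $V_\varphi\varphi$ has no zeros; hence (1) $W_\tau(\psi)=Q_{S_\tau}(\psi)\in C_0(\mathbb{R}^{2d})$ for any $\psi\in L^2(\mathbb{R}^d)$. (2) $W_\tau^f=f\star S_{1-\tau}$ is a compact operator on $L^2(\mathbb{R}^d)$ for any $f\in L^1(\mathbb{R}^{2d})$.
   Context: For $\tau\in(0,1)$, $S_\tau$ is the bounded operator on $L^2(\mathbb{R}^d)$ given by $S_\tau\psi(t)=\frac{1}{(1-\tau)^d}\psi\left(\frac{\tau}{\tau-1}t\right)$. For $z=(x,\omega)\in\mathbb{R}^{2d}$, $(\pi(z)\psi)(t)=e^{2\pi i\omega\cdot t}\psi(t-x)$, $V_\phi\psi(z)=\langle\psi,\pi(z)\phi\rangle_{L^2}$, and $\alpha_z(R)=\pi(z)R\pi(z)^*$ for a bounded operator $R$ on $L^2(\mathbb{R}^d)$. For such $R$, $Q_R(\psi)(z)=\langle\alpha_z(R)\psi,\psi\rangle_{L^2}$, and for $f\in L^1(\mathbb{R}^{2d})$, $f\star R=\int_{\mathbb{R}^{2d}}f(z)\alpha_z(R)\,dz$ (weak integral). The $\tau$-Wigner distribution of $\psi\in L^2(\mathbb{R}^d)$ is $W_\tau(\psi)(x,\omega)=\int_{\mathbb{R}^d}e^{-2\pi i t\cdot\omega}\psi(x+\tau t)\overline{\psi(x-(1-\tau)t)}\,dt$. The $\tau$-Weyl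 quantization $W_\tau^f$ of $f\in L^1(\mathbb{R}^{2d})$ is the operator determined by $\langle W_\tau^f\psi,\psi\rangle_{L^2}=\int_{\mathbb{R}^{2d}}f(z)\overline{W_\tau(\psi)(z)}\,dz$ for $\psi\in\mathscr{S}(\mathbb{R}^d)$. *)

theory Defs
  imports "HOL-Analysis.Analysis"
begin

section \<open>The Hilbert space of square-integrable functions\<close>

definition sq_integrable :: "('a::euclidean_space \<Rightarrow> complex) \<Rightarrow> bool" where
  "sq_integrable g \<longleftrightarrow>
     g \<in> borel_measurable lborel \<and> integrable lborel (\<lambda>t. (cmod (g t))\<^sup>2)"

definition L2_rel :: "('a::euclidean_space \<Rightarrow> complex) \<Rightarrow> ('a \<Rightarrow> complex) \<Rightarrow> bool" where
  "L2_rel g h \<longleftrightarrow> sq_integrable g \<and> sq_integrable h \<and> (AE t in lborel. g t = h t)"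

lemma sq_integrable_zero: "sq_integrable (\<lambda>_. 0)"
  by (simp add: sq_integrable_def)

lemma L2_rel_refl: "sq_integrable g \<Longrightarrow> L2_rel g g"
  by (simp add: L2_rel_def)

text \<open>\<open>abs_L2 g\<close> is the class of a square-integrable function \<open>g\<close>; \<open>rep_L2 \<psi>\<close> is some
  square-integrable representative of \<open>\<psi>\<close>.\<close>

quotient_type (overloaded) 'a L2 = "'a::euclidean_space \<Rightarrow> complex" / partial: L2_rel
proof (rule part_equivpI)
  show "\<exists>g. L2_rel g (g :: 'a \<Rightarrow> complex)"
    using sq_integrable_zero L2_rel_refl by blast
  show "symp L2_rel" by (auto simp: symp_def L2_rel_def)
  show "transp L2_rel" by (force simp: transp_def L2_rel_def)
qed

lemma sq_integrable_rep_L2: "sq_integrable (rep_L2 \<psi>)"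
  using Quotient3_rep_reflp[OF Quotient3_L2] by (auto simp: L2_rel_def)

lemma AE_rep_abs_L2: "sq_integrable g \<Longrightarrow> AE t in lborel. rep_L2 (abs_L2 g) t = g t"
  using rep_abs_rsp_left[OF Quotient3_L2, of g g] by (auto simp: L2_rel_def)

lemma abs_L2_cong:
  "sq_integrable g \<Longrightarrow> sq_integrable h \<Longrightarrow> AE t in lborel. g t = h t \<Longrightarrow> abs_L2 g = abs_L2 h"
  using Quotient3_rel_abs[OF Quotient3_L2] by (auto simp: L2_rel_def)

lemma integrable_mult_cnj:
  assumes "sq_integrable g" "sq_integrable h"
  shows "integrable lborel (\<lambda>t. g t * cnj (h t))"
proof (rule Bochner_Integration.integrable_bound)
  show "integrable lborel (\<lambda>t. (cmod (g t))\<^sup>2 + (cmod (h t))\<^sup>2)"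
    using assms by (auto simp: sq_integrable_def)
  have [measurable]: "g \<in> borel_measurable lborel" "h \<in> borel_measurable lborel"
    using assms by (auto simp: sq_integrable_def)
  show "(\<lambda>t. g t * cnj (h t)) \<in> borel_measurable lborel"
    by (intro borel_measurable_times borel_measurable_continuous_on[of cnj]) (auto intro: continuous_intros)
  have "cmod a * cmod b \<le> (cmod a)\<^sup>2 + (cmod b)\<^sup>2" for a b
    using sum_squares_bound[of "cmod a" "cmod b"] mult_nonneg_nonneg[of "cmod a" "cmod b"]
    by (simp del: mult_nonneg_nonneg zero_le_mult_iff)
  then show "AE t in lborel. norm (g t * cnj (h t)) \<le> norm ((cmod (g t))\<^sup>2 + (cmod (h t))\<^sup>2)"
    by (auto simp: norm_mult)
qed

lemma sq_integrable_add:
  assumes "sq_integrable g" "sq_integrable h"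
  shows "sq_integrable (\<lambda>t. g t + h t)"
  unfolding sq_integrable_def
proof
  have [measurable]: "g \<in> borel_measurable lborel" "h \<in> borel_measurable lborel"
    using assms by (auto simp: sq_integrable_def)
  show "(\<lambda>t. g t + h t) \<in> borel_measurable lborel" by measurable
  show "integrable lborel (\<lambda>t. (cmod (g t + h t))\<^sup>2)"
  proof (rule Bochner_Integration.integrable_bound)
    show "integrable lborel (\<lambda>t. 2 * (cmod (g t))\<^sup>2 + 2 * (cmod (h t))\<^sup>2)"
      using assms by (auto simp: sq_integrable_def)
    have "(cmod (a + b))\<^sup>2 \<le> 2 * (cmod a)\<^sup>2 + 2 * (cmod b)\<^sup>2" for a b
    proof -
      have "(cmod (a + b))\<^sup>2 \<le> (cmod a + cmod b)\<^sup>2"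
        by (intro power_mono norm_triangle_ineq) auto
      also have "\<dots> \<le> 2 * (cmod a)\<^sup>2 + 2 * (cmod b)\<^sup>2"
        using sum_squares_bound[of "cmod a" "cmod b"] by (simp add: power2_sum)
      finally show ?thesis .
    qed
    then show "AE t in lborel. norm ((cmod (g t + h t))\<^sup>2)
        \<le> norm (2 * (cmod (g t))\<^sup>2 + 2 * (cmod (h t))\<^sup>2)"
      by auto
  qed measurable
qed

lemma sq_integrable_cmult:
  assumes "sq_integrable g"
  shows "sq_integrable (\<lambda>t. c * g t)"
  using assms by (auto simp: sq_integrable_def norm_mult power_mult_distrib)

instantiation L2 :: (euclidean_space) real_vector
begin

lift_definition zero_L2 :: "'a L2" is "\<lambda>_. 0"
  by (simp add: L2_rel_def sq_integrable_zero)

lift_definition plus_L2 :: "'a L2 \<Rightarrow> 'a L2 \<Rightarrow> 'a L2" is "\<lambda>g h t. g t + h t"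
  by (auto simp: L2_rel_def sq_integrable_add)

lift_definition uminus_L2 :: "'a L2 \<Rightarrow> 'a L2" is "\<lambda>g t. - g t"
  using sq_integrable_cmult[of _ "-1"] by (auto simp: L2_rel_def)

lift_definition scaleR_L2 :: "real \<Rightarrow> 'a L2 \<Rightarrow> 'a L2" is "\<lambda>r g t. complex_of_real r * g t"
  by (auto simp: L2_rel_def sq_integrable_cmult)

definition minus_L2 :: "'a L2 \<Rightarrow> 'a L2 \<Rightarrow> 'a L2" where
  "minus_L2 \<phi> \<psi> = \<phi> + - \<psi>"

instance
proof
  fix \<phi> \<psi> \<xi> :: "'a L2" and r s :: real
  show "\<phi> + \<psi> + \<xi> = \<phi> + (\<psi> + \<xi>)"
    by transfer (auto simp: L2_rel_def add.assoc intro!: sq_integrable_add)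
  show "\<phi> + \<psi> = \<psi> + \<phi>"
    by transfer (auto simp: L2_rel_def add.commute intro!: sq_integrable_add)
  show "0 + \<phi> = \<phi>"
    by transfer (auto simp: L2_rel_def)
  show "- \<phi> + \<phi> = 0"
    by transfer (auto simp: L2_rel_def sq_integrable_zero)
  show "\<phi> - \<psi> = \<phi> + - \<psi>"
    by (fact minus_L2_def)
  show "r *\<^sub>R (\<phi> + \<psi>) = r *\<^sub>R \<phi> + r *\<^sub>R \<psi>"
    by transfer (auto simp: L2_rel_def distrib_left intro!: sq_integrable_add sq_integrable_cmult)
  show "(r + s) *\<^sub>R \<phi> = r *\<^sub>R \<phi> + s *\<^sub>R \<phi>"
    by transfer (auto simp: L2_rel_def distrib_right intro!: sq_integrable_add sq_integrable_cmult)
  show "r *\<^sub>R s *\<^sub>R \<phi> = (r * s) *\<^sub>R \<phi>"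
    by transfer (auto simp: L2_rel_def mult.assoc intro!: sq_integrable_cmult)
  show "1 *\<^sub>R \<phi> = \<phi>"
    by transfer (auto simp: L2_rel_def)
qed

end

lift_definition scaleC_L2 :: "complex \<Rightarrow> 'a::euclidean_space L2 \<Rightarrow> 'a L2" is "\<lambda>c g t. c * g t"
  by (auto simp: L2_rel_def sq_integrable_cmult)

text \<open>Linear in the first argument, conjugate-linear in the second.\<close>

lift_definition cinner :: "'a::euclidean_space L2 \<Rightarrow> 'a L2 \<Rightarrow> complex"
  is "\<lambda>g h. \<integral>t. g t * cnj (h t) \<partial>lborel"
proof -
  fix g g' h h' :: "'a \<Rightarrow> complex"
  assume g: "L2_rel g g'" and h: "L2_rel h h'"
  have "AE t in lborel. g t * cnj (h t) = g' t * cnj (h' t)"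
    using g h by (auto simp: L2_rel_def)
  then show "(\<integral>t. g t * cnj (h t) \<partial>lborel) = (\<integral>t. g' t * cnj (h' t) \<partial>lborel)"
    using integrable_mult_cnj[of g h] integrable_mult_cnj[of g' h'] g h
    by (intro integral_cong_AE) (auto simp: L2_rel_def)
qed

lemma cinner_add_left: "cinner (\<phi> + \<psi>) \<xi> = cinner \<phi> \<xi> + cinner \<psi> \<xi>"
  by transfer (simp add: L2_rel_def distrib_right integrable_mult_cnj)

lemma cinner_scaleC_left: "cinner (scaleC_L2 c \<phi>) \<psi> = c * cinner \<phi> \<psi>"
  by transfer (simp add: mult.assoc)

lemma scaleR_eq_scaleC_L2: "r *\<^sub>R \<phi> = scaleC_L2 (complex_of_real r) \<phi>"
  by transfer (auto simp: L2_rel_def sq_integrable_cmult)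

lemma cinner_commute: "cinner \<phi> \<psi> = cnj (cinner \<psi> \<phi>)"
proof transfer
  fix g h :: "'a \<Rightarrow> complex"
  show "(\<integral>t. g t * cnj (h t) \<partial>lborel) = cnj (\<integral>t. h t * cnj (g t) \<partial>lborel)"
    by (simp add: mult.commute flip: Bochner_Integration.integral_cnj)
qed

lemma cinner_self: "cinner (abs_L2 g) (abs_L2 g) = complex_of_real (\<integral>t. (cmod (g t))\<^sup>2 \<partial>lborel)"
  if "sq_integrable g"
proof -
  have "cinner (abs_L2 g) (abs_L2 g) = (\<integral>t. g t * cnj (g t) \<partial>lborel)"
    using that by (simp add: cinner.abs_eq L2_rel_refl)
  then show ?thesis
    by (simp add: complex_norm_square[symmetric] flip: of_real_power)
qed

instantiation L2 :: (euclidean_space) real_inner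
begin

definition inner_L2 :: "'a L2 \<Rightarrow> 'a L2 \<Rightarrow> real" where
  "inner_L2 \<phi> \<psi> = Re (cinner \<phi> \<psi>)"

definition norm_L2 :: "'a L2 \<Rightarrow> real" where
  "norm_L2 \<phi> = sqrt (inner \<phi> \<phi>)"

definition dist_L2 :: "'a L2 \<Rightarrow> 'a L2 \<Rightarrow> real" where
  "dist_L2 \<phi> \<psi> = norm (\<phi> - \<psi>)"

definition sgn_L2 :: "'a L2 \<Rightarrow> 'a L2" where
  "sgn_L2 \<phi> = inverse (norm \<phi>) *\<^sub>R \<phi>"

definition uniformity_L2 :: "('a L2 \<times> 'a L2) filter" where
  "uniformity_L2 = (INF e\<in>{0<..}. principal {(\<phi>, \<psi>). dist \<phi> \<psi> < e})"

definition open_L2 :: "'a L2 set \<Rightarrow> bool" where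
  "open_L2 U \<longleftrightarrow> (\<forall>\<phi>\<in>U. eventually (\<lambda>(\<phi>', \<psi>). \<phi>' = \<phi> \<longrightarrow> \<psi> \<in> U) uniformity)"

instance
proof
  fix \<phi> \<psi> \<xi> :: "'a L2" and r :: real and U :: "'a L2 set"
  show "dist \<phi> \<psi> = norm (\<phi> - \<psi>)" by (fact dist_L2_def)
  show "sgn \<phi> = \<phi> /\<^sub>R norm \<phi>" by (fact sgn_L2_def)
  show "(uniformity :: ('a L2 \<times> 'a L2) filter) = (INF e\<in>{0<..}. principal {(\<phi>, \<psi>). dist \<phi> \<psi> < e})"
    by (fact uniformity_L2_def)
  show "open U = (\<forall>\<phi>\<in>U. \<forall>\<^sub>F (\<phi>', \<psi>) in uniformity. \<phi>' = \<phi> \<longrightarrow> \<psi> \<in> U)"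
    by (fact open_L2_def)
  show "norm \<phi> = sqrt (inner \<phi> \<phi>)" by (fact norm_L2_def)
  show "inner \<phi> \<psi> = inner \<psi> \<phi>"
    unfolding inner_L2_def by (subst cinner_commute) simp
  show "inner (\<phi> + \<psi>) \<xi> = inner \<phi> \<xi> + inner \<psi> \<xi>"
    by (simp add: inner_L2_def cinner_add_left)
  show "inner (r *\<^sub>R \<phi>) \<psi> = r * inner \<phi> \<psi>"
    by (simp add: inner_L2_def scaleR_eq_scaleC_L2 cinner_scaleC_left)
  obtain g where g: "sq_integrable g" "\<phi> = abs_L2 g"
    using sq_integrable_rep_L2 Quotient3_abs_rep[OF Quotient3_L2] by metis
  have eq: "inner \<phi> \<phi> = (\<integral>t. (cmod (g t))\<^sup>2 \<partial>lborel)"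
    using cinner_self[OF g(1)] by (simp add: inner_L2_def g(2))
  show "0 \<le> inner \<phi> \<phi>"
    unfolding eq by simp
  have "inner \<phi> \<phi> = 0 \<longleftrightarrow> (AE t in lborel. g t = 0)"
    unfolding eq using g(1)
    by (subst integral_nonneg_eq_0_iff_AE) (auto simp: sq_integrable_def)
  also have "\<dots> \<longleftrightarrow> \<phi> = 0"
    using g(1) sq_integrable_zero Quotient3_rel[OF Quotient3_L2, of g "\<lambda>_. 0"]
    by (auto simp: g(2) zero_L2_def L2_rel_def)
  finally show "inner \<phi> \<phi> = 0 \<longleftrightarrow> \<phi> = 0" .
qed

end

section \<open>Operators\<close>

definition bounded_clinear :: "('a::euclidean_space L2 \<Rightarrow> 'a L2) \<Rightarrow> bool" where
  "bounded_clinear T \<longleftrightarrow>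
     bounded_linear T \<and> (\<forall>c \<psi>. T (scaleC_L2 c \<psi>) = scaleC_L2 c (T \<psi>))"

definition compact_operator :: "('a::euclidean_space L2 \<Rightarrow> 'a L2) \<Rightarrow> bool" where
  "compact_operator T \<longleftrightarrow> bounded_clinear T \<and> compact (closure (T ` cball 0 1))"

definition cadjoint :: "('a::euclidean_space L2 \<Rightarrow> 'a L2) \<Rightarrow> 'a L2 \<Rightarrow> 'a L2" where
  "cadjoint T = (THE T'. \<forall>\<phi> \<psi>. cinner (T \<phi>) \<psi> = cinner \<phi> (T' \<psi>))"

lemma
  fixes x :: "'a::euclidean_space"
  assumes c: "c \<noteq> 0"
  shows AE_lborel_affine: "AE t in lborel. P t \<Longrightarrow> AE t in lborel. P (x + c *\<^sub>R t)"
    and sq_integrable_affine: "sq_integrable g \<Longrightarrow> sq_integrable (\<lambda>t. g (x + c *\<^sub>R t))"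
proof -
  let ?D = "distr lborel borel (\<lambda>t. x + c *\<^sub>R t)"
  have D: "lborel = density ?D (\<lambda>_. ennreal (\<bar>c\<bar> ^ DIM('a)))"
    using lborel_affine[OF c, of x] by (simp add: ennreal_power)
  have pos: "\<bar>c\<bar> ^ DIM('a) > 0" using c by simp
  {
    assume "AE t in lborel. P t"
    then have "AE t in ?D. P t"
      using pos by (subst (asm) D) (simp add: AE_density)
    then obtain N where N: "N \<in> null_sets ?D" "{t. \<not> P t} \<subseteq> N"
      by (auto simp: eventually_ae_filter)
    moreover have "(\<lambda>t. x + c *\<^sub>R t) -` N \<inter> space borel \<in> sets borel"
      using N(1) by (intro measurable_sets[where A = borel]) auto
    ultimately have "(\<lambda>t. x + c *\<^sub>R t) -` N \<in> null_sets lborel"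
      by (auto simp: null_sets_def emeasure_distr)
    then show "AE t in lborel. P (x + c *\<^sub>R t)"
      using N(2) by (auto intro!: AE_I'[where N = "(\<lambda>t. x + c *\<^sub>R t) -` N"])
  }
  {
    assume g: "sq_integrable g"
    then have [measurable]: "g \<in> borel_measurable borel"
      by (simp add: sq_integrable_def)
    have "integrable ?D (\<lambda>t. (cmod (g t))\<^sup>2)"
      using g pos unfolding sq_integrable_def
      by (subst (asm) (2) D) (subst (asm) integrable_density, auto)
    then show "sq_integrable (\<lambda>t. g (x + c *\<^sub>R t))"
      unfolding sq_integrable_def by (subst (asm) integrable_distr_eq) auto
  }
qed

section \<open>Time-frequency shifts and operator convolutions\<close>

text \<open>A point of phase space is a pair \<open>z = (x, \<omega>)\<close>.\<close>

lift_definition tf_shift :: "'a::euclidean_space \<times> 'a \<Rightarrow> 'a L2 \<Rightarrow> 'a L2"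
  is "\<lambda>(x, \<omega>) g t. cis (2 * pi * (\<omega> \<bullet> t)) * g (t - x)"
proof -
  fix z :: "'a \<times> 'a" and g h :: "'a \<Rightarrow> complex"
  assume gh: "L2_rel g h"
  obtain x \<omega> where z: "z = (x, \<omega>)" by force
  have sq: "sq_integrable (\<lambda>t. cis (2 * pi * (\<omega> \<bullet> t)) * k (t - x))"
    if "sq_integrable k" for k :: "'a \<Rightarrow> complex"
  proof -
    have k: "sq_integrable (\<lambda>t. k (t - x))"
      using sq_integrable_affine[OF _ that, of 1 "-x"] by simp
    then have [measurable]: "(\<lambda>t. k (t - x)) \<in> borel_measurable borel"
      by (simp add: sq_integrable_def)
    have [measurable]: "(\<lambda>t. cis (2 * pi * (\<omega> \<bullet> t))) \<in> borel_measurable borel"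
      by (intro borel_measurable_continuous_onI continuous_intros)
    show ?thesis using k by (simp add: sq_integrable_def norm_mult)
  qed
  have "AE t in lborel. g (t - x) = h (t - x)"
    using AE_lborel_affine[of 1 "\<lambda>t. g t = h t" "-x"] gh by (simp add: L2_rel_def)
  then show "L2_rel ((\<lambda>(x, \<omega>) g t. cis (2 * pi * (\<omega> \<bullet> t)) * g (t - x)) z g)
      ((\<lambda>(x, \<omega>) g t. cis (2 * pi * (\<omega> \<bullet> t)) * g (t - x)) z h)"
    using gh by (auto simp: z L2_rel_def intro!: sq)
qed

definition STFT :: "'a::euclidean_space L2 \<Rightarrow> 'a L2 \<Rightarrow> 'a \<times> 'a \<Rightarrow> complex" where
  "STFT \<phi> \<psi> z = cinner \<psi> (tf_shift z \<phi>)"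

definition op_shift ::
    "'a::euclidean_space \<times> 'a \<Rightarrow> ('a L2 \<Rightarrow> 'a L2) \<Rightarrow> 'a L2 \<Rightarrow> 'a L2" where
  "op_shift z R = tf_shift z \<circ> R \<circ> cadjoint (tf_shift z)"

definition Q_distr :: "('a::euclidean_space L2 \<Rightarrow> 'a L2) \<Rightarrow> 'a L2 \<Rightarrow> 'a \<times> 'a \<Rightarrow> complex" where
  "Q_distr R \<psi> z = cinner (op_shift z R \<psi>) \<psi>"

definition is_op_conv ::
    "('a::euclidean_space \<times> 'a \<Rightarrow> complex) \<Rightarrow> ('a L2 \<Rightarrow> 'a L2) \<Rightarrow> ('a L2 \<Rightarrow> 'a L2) \<Rightarrow> bool" where
  "is_op_conv f R B \<longleftrightarrow> bounded_clinear B \<and>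
     (\<forall>\<phi> \<psi>. cinner (B \<phi>) \<psi> = (\<integral>z. f z * cinner (op_shift z R \<phi>) \<psi> \<partial>lborel))"

definition op_conv ::
    "('a::euclidean_space \<times> 'a \<Rightarrow> complex) \<Rightarrow> ('a L2 \<Rightarrow> 'a L2) \<Rightarrow> 'a L2 \<Rightarrow> 'a L2" where
  "op_conv f R = (THE B. is_op_conv f R B)"

section \<open>The \<open>\<tau>\<close>-Wigner distribution and the \<open>\<tau>\<close>-Weyl quantization\<close>

definition S_op :: "real \<Rightarrow> 'a::euclidean_space L2 \<Rightarrow> 'a L2" where
  "S_op \<tau> \<psi> = abs_L2 (\<lambda>t. complex_of_real (1 / (1 - \<tau>) ^ DIM('a)) *
     rep_L2 \<psi> ((\<tau> / (\<tau> - 1)) *\<^sub>R t))"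

definition wigner :: "real \<Rightarrow> 'a::euclidean_space L2 \<Rightarrow> 'a \<times> 'a \<Rightarrow> complex" where
  "wigner \<tau> \<psi> = (\<lambda>(x, \<omega>). \<integral>t. cis (- 2 * pi * (t \<bullet> \<omega>)) *
     rep_L2 \<psi> (x + \<tau> *\<^sub>R t) * cnj (rep_L2 \<psi> (x - (1 - \<tau>) *\<^sub>R t)) \<partial>lborel)"

text \<open>For \<open>0 < \<tau> < 1\<close> neither definition depends on the representative chosen by \<open>rep_L2\<close>:\<close>

lemma S_op_abs_L2:
  fixes g :: "'a::euclidean_space \<Rightarrow> complex"
  assumes \<tau>: "0 < \<tau>" "\<tau> < 1" and g: "sq_integrable g"
  shows "S_op \<tau> (abs_L2 g) =
    abs_L2 (\<lambda>t. complex_of_real (1 / (1 - \<tau>) ^ DIM('a)) * g ((\<tau> / (\<tau> - 1)) *\<^sub>R t))"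
proof -
  have c: "\<tau> / (\<tau> - 1) \<noteq> 0" using \<tau> by simp
  have "sq_integrable (\<lambda>t. rep_L2 (abs_L2 g) (0 + (\<tau> / (\<tau> - 1)) *\<^sub>R t))"
    by (intro sq_integrable_affine c sq_integrable_rep_L2)
  then show ?thesis
    unfolding S_op_def
    using sq_integrable_affine[OF c g, of 0]
      AE_lborel_affine[OF c AE_rep_abs_L2[OF g], of 0]
    by (intro abs_L2_cong sq_integrable_cmult) auto
qed

lemma wigner_abs_L2:
  fixes g :: "'a::euclidean_space \<Rightarrow> complex"
  assumes \<tau>: "0 < \<tau>" "\<tau> < 1" and g: "sq_integrable g"
  shows "wigner \<tau> (abs_L2 g) (x, \<omega>) =
    (\<integral>t. cis (- 2 * pi * (t \<bullet> \<omega>)) * g (x + \<tau> *\<^sub>R t) * cnj (g (x - (1 - \<tau>) *\<^sub>R t)) \<partial>lborel)"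
proof -
  define h where "h = rep_L2 (abs_L2 g)"
  have c: "\<tau> \<noteq> 0" "- (1 - \<tau>) \<noteq> 0" using \<tau> by auto
  have h: "sq_integrable h" unfolding h_def by (rule sq_integrable_rep_L2)
  have AE: "AE t in lborel. h t = g t" unfolding h_def by (rule AE_rep_abs_L2[OF g])
  have meas: "(\<lambda>t. cis (- 2 * pi * (t \<bullet> \<omega>)) * k (x + \<tau> *\<^sub>R t) * cnj (k (x - (1 - \<tau>) *\<^sub>R t)))
      \<in> borel_measurable lborel" if "sq_integrable k" for k
  proof -
    have [measurable]: "k \<in> borel_measurable borel" "cnj \<in> borel_measurable borel"
      "(\<lambda>t. cis (- 2 * pi * (t \<bullet> \<omega>))) \<in> borel_measurable borel"
      using that
      by (auto simp: sq_integrable_def intro!: borel_measurable_continuous_onI continuous_intros)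
    show ?thesis by measurable
  qed
  have "AE t in lborel. h (x + \<tau> *\<^sub>R t) = g (x + \<tau> *\<^sub>R t)"
    using AE_lborel_affine[OF c(1) AE] .
  moreover have "AE t in lborel. h (x - (1 - \<tau>) *\<^sub>R t) = g (x - (1 - \<tau>) *\<^sub>R t)"
    using AE_lborel_affine[OF c(2) AE, of x] by (simp add: algebra_simps)
  ultimately show ?thesis
    unfolding wigner_def h_def[symmetric] prod.case
    by (intro integral_cong_AE meas h g) auto
qed

fun iter_partial :: "'a::euclidean_space list \<Rightarrow> ('a \<Rightarrow> complex) \<Rightarrow> 'a \<Rightarrow> complex" where
  "iter_partial [] g = g"
| "iter_partial (b # bs) g = (\<lambda>t. frechet_derivative (iter_partial bs g) (at t) b)"

text \<open>Differentiability of all iterated partial derivatives is the same as smoothness.\<close>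

definition schwartz :: "('a::euclidean_space \<Rightarrow> complex) \<Rightarrow> bool" where
  "schwartz g \<longleftrightarrow> (\<forall>bs. set bs \<subseteq> Basis \<longrightarrow>
     (\<forall>t. iter_partial bs g differentiable (at t)) \<and>
     (\<forall>N::nat. bounded (range (\<lambda>t. norm t ^ N *\<^sub>R iter_partial bs g t))))"

definition is_weyl_quant ::
    "real \<Rightarrow> ('a::euclidean_space \<times> 'a \<Rightarrow> complex) \<Rightarrow> ('a L2 \<Rightarrow> 'a L2) \<Rightarrow> bool" where
  "is_weyl_quant \<tau> f A \<longleftrightarrow> bounded_clinear A \<and>
     (\<forall>g. schwartz g \<longrightarrow> cinner (A (abs_L2 g)) (abs_L2 g) =
        (\<integral>z. f z * cnj (wigner \<tau> (abs_L2 g) z) \<partial>lborel))"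

definition weyl_quant ::
    "real \<Rightarrow> ('a::euclidean_space \<times> 'a \<Rightarrow> complex) \<Rightarrow> 'a L2 \<Rightarrow> 'a L2" where
  "weyl_quant \<tau> f = (THE A. is_weyl_quant \<tau> f A)"

definition C0 :: "('b::real_normed_vector \<Rightarrow> complex) set" where
  "C0 = {F. continuous_on UNIV F \<and> (F \<longlongrightarrow> 0) at_infinity}"

end

theory Submission
  imports Defs "HOL-Probability.Characteristic_Functions"
begin

text \<open>
  Write \<open>A\<^sub>z = \<alpha>\<^sub>z(S\<^sub>s)\<close>. Unfolding the definitions and substituting \<open>u = x - (1 - s) t\<close> for the
  variable of integration gives, for every \<open>0 < s < 1\<close>, the formula
  \<open>\<langle>A\<^sub>z \<phi>, \<psi>\<rangle> = \<integral> e^(-2 \<pi> i t \<cdot> \<omega>) \<phi>(x + s t) cnj (\<psi>(x - (1 - s) t)) dt\<close> with \<open>z = (x, \<omega>)\<close>: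
  the cross-Wigner distribution \<open>cwig\<close> (lemma \<open>cwig_abs_L2\<close>). Its diagonal is the identity
  \<open>W\<^sub>\<tau>(\<psi>) = Q(\<psi>)\<close> for \<open>S\<^sub>\<tau>\<close>, and replacing \<open>t\<close> by \<open>-t\<close> shows that conjugation exchanges \<open>s\<close> with
  \<open>1 - s\<close>. Hence the weak integral \<open>f \<star> S\<^sub>1\<^sub>-\<^sub>\<tau>\<close> has the quadratic form that defines the Weyl
  quantization of \<open>f\<close>.

  By Cauchy--Schwarz, \<open>cwig\<close> is bounded by a constant times \<open>\<parallel>\<phi>\<parallel> \<parallel>\<psi>\<parallel>\<close>. It vanishes at infinity
  for two reasons (\<open>cwig_C0\<close>). In \<open>x\<close>: the point \<open>x\<close> is a convex combination of \<open>x + s t\<close> and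
  \<open>x - (1 - s) t\<close>, so for \<open>\<phi>\<close> and \<open>\<psi>\<close> of bounded support the integrand is zero once \<open>|x|\<close> is large,
  and such functions are dense. In \<open>\<omega>\<close>: moving \<open>t\<close> by half a period of the exponential changes the sign
  and translates \<open>\<phi>\<close> and \<open>\<psi>\<close> by a distance of order \<open>1 / |\<omega>|\<close>, and translations are strongly continuous.
  This is the proof of the Riemann--Lebesgue lemma by translation, and it is uniform in \<open>x\<close>.

  For compactness, call a sesquilinear form compact if a compact operator represents it. Compact
  forms are closed under linear combinations and, because \<open>L\<^sup>2\<close> is complete, under limits that are uniform on
  bounded sets (\<open>compact_form_limit\<close>). Two approximations then give everything. First, square-integrable kernels
  are limits of combinations of indicators of boxes, whose operators have rank one
  (\<open>compact_form_Hilbert_Schmidt\<close>). Secondly, the form of an integrable symbol \<open>f\<close> depends continuously on the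
  \<open>L\<^sup>1\<close> norm of \<open>f\<close>, so \<open>f\<close> may be taken to be the indicator of a box \<open>Q \<times> P\<close>. Then the form is
  \<open>\<integral>\<^sub>Q \<integral> F(t) \<phi>(x + s t) cnj (\<psi>(x - (1 - s) t)) dt dx\<close> with \<open>F\<close> the Fourier transform of the indicator
  of \<open>P\<close>. Cutting \<open>F\<close> off at \<open>|t| = R\<close> leaves a bounded kernel of bounded support, and the error is at most
  \<open>sup {|F(t)| : |t| \<ge> R}\<close> times a constant, which is small by Riemann--Lebesgue (\<open>compact_form_box\<close>).

  The quantization is unique because a bounded operator is determined by its quadratic form on a
  dense complex subspace. For the existence of the window, a Gaussian has a Gaussian, hence zero-free, short-time
  Fourier transform.
\<close>

section \<open>Functions with integrable powers, built from boxes\<close>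

definition Lp :: "nat \<Rightarrow> ('b::euclidean_space \<Rightarrow> complex) \<Rightarrow> bool" where
  "Lp p f \<longleftrightarrow> f \<in> borel_measurable borel \<and> integrable lborel (\<lambda>x. cmod (f x) ^ p)"

lemma Lp_measurable: "Lp p f \<Longrightarrow> f \<in> borel_measurable borel"
  and Lp_integrable: "Lp p f \<Longrightarrow> integrable lborel (\<lambda>x. cmod (f x) ^ p)"
  by (simp_all add: Lp_def)

lemma sq_integrable_iff_Lp: "sq_integrable f \<longleftrightarrow> Lp 2 f"
  by (simp add: sq_integrable_def Lp_def)

lemma integrable_iff_Lp: "integrable lborel f \<longleftrightarrow> Lp 1 f"
  by (auto simp: Lp_def integrable_iff_bounded)

lemma power_sum_le:
  fixes u v :: real
  assumes "0 \<le> u" "0 \<le> v"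
  shows "(u + v) ^ p \<le> 2 ^ p * (u ^ p + v ^ p)"
proof -
  have "(u + v) ^ p \<le> (2 * max u v) ^ p"
    using assms by (intro power_mono) auto
  also have "\<dots> \<le> 2 ^ p * (u ^ p + v ^ p)"
    using assms by (auto simp: power_mult_distrib max_def)
  finally show ?thesis .
qed

lemma Lp_bound:
  assumes w: "integrable lborel w" and f: "f \<in> borel_measurable borel"
    and le: "\<And>x. cmod (f x) ^ p \<le> w x"
  shows "Lp p f"
  unfolding Lp_def
proof
  show "integrable lborel (\<lambda>x. cmod (f x) ^ p)"
  proof (rule Bochner_Integration.integrable_bound[OF w])
    show "(\<lambda>x. cmod (f x) ^ p) \<in> borel_measurable lborel" using f by measurable
    have "norm (cmod (f x) ^ p) \<le> norm (w x)" for x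
      using le[of x] by (simp add: abs_of_nonneg)
    then show "AE x in lborel. norm (cmod (f x) ^ p) \<le> norm (w x)"
      by auto
  qed
qed (fact f)

lemma Lp_add:
  assumes f: "Lp p f" and g: "Lp p g"
  shows "Lp p (\<lambda>x. f x + g x)"
proof (rule Lp_bound)
  show "integrable lborel (\<lambda>x. 2 ^ p * (cmod (f x) ^ p + cmod (g x) ^ p))"
    using f g by (intro integrable_mult_right Bochner_Integration.integrable_add) (auto simp: Lp_def)
  show "(\<lambda>x. f x + g x) \<in> borel_measurable borel"
    using f g by (intro borel_measurable_add) (auto simp: Lp_def)
  fix x
  have "cmod (f x + g x) ^ p \<le> (cmod (f x) + cmod (g x)) ^ p"
    by (intro power_mono norm_triangle_ineq) auto
  then show "cmod (f x + g x) ^ p \<le> 2 ^ p * (cmod (f x) ^ p + cmod (g x) ^ p)"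
    using power_sum_le[of "cmod (f x)" "cmod (g x)" p] by simp
qed

lemma Lp_cmult: "Lp p f \<Longrightarrow> Lp p (\<lambda>x. c * f x)"
  by (auto simp: Lp_def norm_mult power_mult_distrib)

lemma Lp_indicator_bounded:
  assumes A: "A \<in> sets borel" "bounded A" and p: "p > 0"
  shows "Lp p (indicator A :: _ \<Rightarrow> complex)"
proof (rule Lp_bound[where w="indicator A"])
  show "integrable lborel (indicator A :: _ \<Rightarrow> real)"
    using A emeasure_bounded_finite[OF A(2)] by (simp add: integrable_indicator_iff)
qed (use A p in \<open>auto simp: indicator_def zero_power\<close>)

lemma Lp_sum:
  assumes "finite I" "p > 0" "\<And>i. i \<in> I \<Longrightarrow> Lp p (f i)"
  shows "Lp p (\<lambda>x. \<Sum>i\<in>I. f i x)"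
  using assms(1,3)
proof (induction I rule: finite_induct)
  case empty
  then show ?case using \<open>p > 0\<close> by (simp add: Lp_def zero_power)
qed (auto intro: Lp_add)

text \<open>Dominated convergence, in the form in which it yields convergence in the \<open>p\<close>-th mean.\<close>

lemma Lp_dominated_convergence:
  assumes s: "\<And>n. s n \<in> borel_measurable borel" and f: "f \<in> borel_measurable borel"
    and lim: "\<And>x. (\<lambda>n. s n x) \<longlonglongrightarrow> f x"
    and w: "Lp p w" and dom: "\<And>n x. cmod (s n x) \<le> cmod (w x)" and p: "p > 0"
  shows "Lp p (s n)" "Lp p f" "(\<lambda>n. \<integral>x. cmod (s n x - f x) ^ p \<partial>lborel) \<longlonglongrightarrow> 0"
proof -
  have fw: "cmod (f x) \<le> cmod (w x)" for x
    using LIMSEQ_le_const2[OF tendsto_norm[OF lim]] dom by blast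
  show "Lp p (s n)"
    using dom by (intro Lp_bound[OF Lp_integrable[OF w] s] power_mono) auto
  show "Lp p f"
    using fw by (intro Lp_bound[OF Lp_integrable[OF w] f] power_mono) auto
  have "(\<lambda>n. \<integral>x. cmod (s n x - f x) ^ p \<partial>lborel) \<longlonglongrightarrow> (\<integral>x. 0 \<partial>(lborel :: 'a measure))"
  proof (rule integral_dominated_convergence[where w="\<lambda>x. 2 ^ p * cmod (w x) ^ p"])
    show "AE x in lborel. (\<lambda>n. cmod (s n x - f x) ^ p) \<longlonglongrightarrow> 0"
      using p lim by (intro always_eventually allI)
        (auto intro!: tendsto_eq_intros simp: LIM_zero tendsto_norm_zero)
    show "integrable lborel (\<lambda>x. 2 ^ p * cmod (w x) ^ p)"
      using w by (simp add: Lp_def)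
    fix n
    have "cmod (s n x - f x) ^ p \<le> (2 * cmod (w x)) ^ p" for x
      using norm_triangle_ineq4[of "s n x" "f x"] fw[of x] dom[of n x]
      by (intro power_mono) auto
    then show "AE x in lborel. norm (cmod (s n x - f x) ^ p) \<le> 2 ^ p * cmod (w x) ^ p"
      by (auto simp: power_mult_distrib)
  qed (use s f in measurable)
  then show "(\<lambda>n. \<integral>x. cmod (s n x - f x) ^ p \<partial>lborel) \<longlonglongrightarrow> 0" by simp
qed

text \<open>The approximation principle behind all density arguments below: with \<open>p = 2\<close> it produces dense
  subspaces of \<open>L\<^sup>2\<close> and Hilbert--Schmidt operators, with \<open>p = 1\<close> it reduces integrable symbols to boxes.
  Boxes generate the Borel sets and are closed under intersection, so the property passes to
  indicators of all Borel sets inside a fixed box; working inside a box keeps complements integrable. Simple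
  functions cut off to a large box then approximate the general function.\<close>

lemma Lp_box_induct [consumes 2, case_names box add cmult lim]:
  fixes f :: "'b::euclidean_space \<Rightarrow> complex"
  assumes p: "p > 0" and f: "Lp p f"
    and box: "\<And>a b. P (indicator (box a b))"
    and add: "\<And>f g. Lp p f \<Longrightarrow> Lp p g \<Longrightarrow> P f \<Longrightarrow> P g \<Longrightarrow> P (\<lambda>x. f x + g x)"
    and cmult: "\<And>f c. Lp p f \<Longrightarrow> P f \<Longrightarrow> P (\<lambda>x. c * f x)"
    and lim: "\<And>s f. (\<And>n. Lp p (s n)) \<Longrightarrow> (\<And>n. P (s n)) \<Longrightarrow> Lp p f \<Longrightarrow>
       (\<lambda>n. \<integral>x. cmod (s n x - f x) ^ p \<partial>lborel) \<longlonglongrightarrow> 0 \<Longrightarrow> P f"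
  shows "P f"
proof -
  have Lpbox: "Lp p (indicator (A \<inter> box a b) :: 'b \<Rightarrow> complex)" if "A \<in> sets borel" for A a b
    using that p by (intro Lp_indicator_bounded) (auto intro: bounded_subset[OF bounded_box])
  have P0: "P (\<lambda>x. 0)" using box[of 0 0] by (simp add: indicator_def[abs_def])
  have Psum: "P (\<lambda>x. \<Sum>i\<in>I. g i x)"
    if "finite I" "\<And>i. i \<in> I \<Longrightarrow> Lp p (g i)" "\<And>i. i \<in> I \<Longrightarrow> P (g i)"
    for I :: "'i set" and g
    using that
  proof (induction I rule: finite_induct)
    case empty
    then show ?case using P0 by simp
  next
    case (insert i I)
    then show ?case by (auto intro!: add Lp_sum p)
  qed
  have ind: "P (indicator (A \<inter> box l u))" if A: "A \<in> sets borel" for A l u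
  proof -
    have "Int_stable (range (\<lambda>(a, b). box a b :: 'b set))"
      by (auto simp: Int_stable_def box_Int_box)
    moreover have "range (\<lambda>(a, b). box a b :: 'b set) \<subseteq> Pow UNIV" by simp
    moreover have "A \<in> sigma_sets UNIV (range (\<lambda>(a, b). box a b :: 'b set))"
      using A by (simp add: borel_eq_box)
    ultimately show ?thesis
    proof (induction rule: sigma_sets_induct_disjoint)
      case (basic A)
      then obtain a b where "A = box a b" by auto
      then show ?case using box by (simp add: box_Int_box)
    next
      case empty
      then show ?case using P0 by (simp add: indicator_def[abs_def])
    next
      case (compl A)
      have [measurable]: "A \<in> sets borel" using compl by (simp add: borel_eq_box)
      have "P (\<lambda>x. indicator (UNIV \<inter> box l u) x + (-1) * indicator (A \<inter> box l u) x)"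
        using box[of l u] compl by (intro add cmult Lp_cmult Lpbox) auto
      also have "(\<lambda>x. indicator (UNIV \<inter> box l u) x + (-1) * indicator (A \<inter> box l u) x) =
          (indicator ((UNIV - A) \<inter> box l u) :: 'b \<Rightarrow> complex)"
        by (auto simp: indicator_def)
      finally show ?case .
    next
      case (union A)
      have A: "A i \<in> sets borel" for i using union(2) by (auto simp: borel_eq_box)
      \<comment> \<open>since the sets are disjoint, the partial sums are indicators of the partial unions\<close>
      let ?s = "\<lambda>n x. \<Sum>i<n. indicator (A i \<inter> box l u) x :: complex"
      have sums: "?s n x = (if x \<in> (\<Union>i<n. A i) \<inter> box l u then 1 else 0)" for n x
      proof (cases "x \<in> (\<Union>i<n. A i) \<inter> box l u")
        case True
        then obtain i where i: "i < n" "x \<in> A i" "x \<in> box l u" by auto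
        have "indicator (A j \<inter> box l u) x = (if j = i then 1 else 0 :: complex)" for j
          using i union(1) by (auto simp: disjoint_family_on_def indicator_def)
        then show ?thesis using i True by simp
      qed (auto simp: indicator_def intro!: sum.neutral)
      have lims: "(\<lambda>n. ?s n x) \<longlonglongrightarrow> indicator ((\<Union>i. A i) \<inter> box l u) x" for x
      proof (cases "x \<in> (\<Union>i. A i) \<inter> box l u")
        case True
        then obtain i where i: "x \<in> A i" by auto
        have "\<forall>\<^sub>F n in sequentially. ?s n x = indicator ((\<Union>i. A i) \<inter> box l u) x"
          using eventually_gt_at_top[of i] by eventually_elim (use i True in \<open>auto simp: sums\<close>)
        then show ?thesis by (rule tendsto_eventually)
      next
        case False
        then show ?thesis by (auto simp: sums)
      qed
      note dct = Lp_dominated_convergence[where s="?s" and f="indicator ((\<Union>i. A i) \<inter> box l u)"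
        and w="indicator (UNIV \<inter> box l u)" and p=p, OF _ _ lims _ _ p]
      have m: "?s n \<in> borel_measurable borel" for n
        using A by (intro borel_measurable_sum borel_measurable_indicator) auto
      have mU: "(indicator ((\<Union>i. A i) \<inter> box l u) :: 'b \<Rightarrow> complex) \<in> borel_measurable borel"
        using A by (intro borel_measurable_indicator) auto
      have d: "cmod (?s n x) \<le> cmod (indicator (UNIV \<inter> box l u) x)" for n x
        unfolding sums by (auto simp: indicator_def)
      have "P (?s n)" for n
        by (rule Psum) (simp_all add: A Lpbox union(3))
      then show ?case
        using dct[OF m mU Lpbox d] by (auto intro: lim[of ?s])
    qed
  qed
  obtain F where F: "\<And>i. simple_function borel (F i)" "\<And>x. (\<lambda>i. F i x) \<longlonglongrightarrow> f x"
      "\<And>i x. cmod (F i x) \<le> 2 * cmod (f x)"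
    using borel_measurable_implies_sequence_metric[OF Lp_measurable[OF f], of 0] by auto
  define Q where "Q i = (box (-(real i *\<^sub>R One)) (real i *\<^sub>R One) :: 'b set)" for i :: nat
  \<comment> \<open>the cut-off makes the level sets bounded\<close>
  let ?s = "\<lambda>i x. F i x * indicator (Q i) x"
  have QF: "P (?s i)" for i
  proof -
    have fin: "finite (range (F i))" using F(1)[of i] by (simp add: simple_function_def)
    have sets: "F i -` {y} \<in> sets borel" for y
      using F(1)[of i] borel_measurable_simple_function by (metis simple_functionD(2) space_borel inf_top_right)
    have eq: "?s i = (\<lambda>x. \<Sum>y\<in>range (F i). y * indicator (F i -` {y} \<inter> Q i) x)"
    proof
      fix x
      have "(\<Sum>y\<in>range (F i). y * indicator (F i -` {y} \<inter> Q i) x) =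
          (\<Sum>y\<in>range (F i). if y = F i x then F i x * indicator (Q i) x else 0)"
        by (intro sum.cong) (auto simp: indicator_def)
      then show "?s i x = (\<Sum>y\<in>range (F i). y * indicator (F i -` {y} \<inter> Q i) x)"
        using fin by simp
    qed
    show ?thesis
      unfolding eq using fin sets unfolding Q_def
      by (intro Psum Lp_cmult Lpbox cmult ind) auto
  qed
  have m: "?s i \<in> borel_measurable borel" for i
    using borel_measurable_simple_function[OF F(1)] unfolding Q_def
    by (intro borel_measurable_times borel_measurable_indicator) auto
  have lims: "(\<lambda>i. ?s i x) \<longlonglongrightarrow> f x" for x
  proof -
    obtain n :: nat where n: "norm x < n" using reals_Archimedean2 by blast
    have "\<forall>\<^sub>F i in sequentially. F i x = ?s i x"
      using eventually_ge_at_top[of n]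
    proof eventually_elim
      case (elim i)
      have "\<bar>x \<bullet> b\<bar> < real i" if "b \<in> Basis" for b
        using Basis_le_norm[OF that, of x] n elim by linarith
      then have "x \<in> Q i" unfolding Q_def by (auto simp: mem_box abs_less_iff minus_less_iff)
      then show ?case by simp
    qed
    then show ?thesis using Lim_transform_eventually[OF F(2)] by simp
  qed
  have d: "cmod (?s i x) \<le> cmod (2 * f x)" for i x
    using F(3)[of i x] by (auto simp: indicator_def norm_mult)
  have Lp2: "Lp p (\<lambda>x. 2 * f x)" using Lp_cmult[OF f] .
  note dct = Lp_dominated_convergence[OF m Lp_measurable[OF f] lims Lp2 d p]
  show "P f"
    using dct(1) QF f dct(3) by (rule lim)
qed

section \<open>The Hilbert space and its completeness\<close>

text \<open>Equations between classes are proved below on representatives, which this rule supplies.\<close>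

lemma L2_cases [cases type: L2]:
  obtains g where "sq_integrable g" "\<phi> = abs_L2 g"
  using sq_integrable_rep_L2 Quotient3_abs_rep[OF Quotient3_L2] by metis

lemma abs_rep_L2 [simp]: "abs_L2 (rep_L2 \<phi>) = \<phi>"
  by (rule Quotient3_abs_rep[OF Quotient3_L2])

lemma cinner_abs_L2:
  "sq_integrable g \<Longrightarrow> sq_integrable h \<Longrightarrow> cinner (abs_L2 g) (abs_L2 h) = (\<integral>t. g t * cnj (h t) \<partial>lborel)"
  by (simp add: cinner.abs_eq L2_rel_refl)

lemma plus_abs_L2:
  "sq_integrable g \<Longrightarrow> sq_integrable h \<Longrightarrow> abs_L2 g + abs_L2 h = abs_L2 (\<lambda>t. g t + h t)"
  by (simp add: plus_L2.abs_eq L2_rel_refl)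

lemma scaleC_abs_L2: "sq_integrable g \<Longrightarrow> scaleC_L2 c (abs_L2 g) = abs_L2 (\<lambda>t. c * g t)"
  by (simp add: scaleC_L2.abs_eq L2_rel_refl)

lemma sq_integrable_diff:
  assumes "sq_integrable g" "sq_integrable h"
  shows "sq_integrable (\<lambda>t. g t - h t)"
  using sq_integrable_add[OF assms(1) sq_integrable_cmult[OF assms(2), of "-1"]] by simp

lemma minus_abs_L2:
  assumes "sq_integrable g" "sq_integrable h"
  shows "abs_L2 g - abs_L2 h = abs_L2 (\<lambda>t. g t - h t)"
  using assms sq_integrable_cmult[OF assms(2), of "-1"]
  by (simp add: minus_L2_def uminus_L2.abs_eq L2_rel_refl plus_abs_L2)

lemma norm_abs_L2:
  assumes "sq_integrable g"
  shows "(norm (abs_L2 g))\<^sup>2 = (\<integral>t. (cmod (g t))\<^sup>2 \<partial>lborel)"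
  using cinner_self[OF assms] by (simp add: power2_norm_eq_inner inner_L2_def)

lemma cinner_self_norm: "cinner \<phi> \<phi> = complex_of_real ((norm \<phi>)\<^sup>2)"
  by (cases \<phi>) (simp add: cinner_self norm_abs_L2)

lemma cinner_scaleC_right: "cinner \<phi> (scaleC_L2 c \<psi>) = cnj c * cinner \<phi> \<psi>"
  by (subst (1 2) cinner_commute) (simp add: cinner_scaleC_left)

lemma cinner_add_right: "cinner \<phi> (\<psi> + \<xi>) = cinner \<phi> \<psi> + cinner \<phi> \<xi>"
  by (subst (1 2 3) cinner_commute) (simp add: cinner_add_left)

lemma uminus_eq_scaleC: "- \<phi> = scaleC_L2 (-1) \<phi>"
  using scaleR_eq_scaleC_L2[of "-1" \<phi>] by simp

lemma cinner_diff_left: "cinner (\<phi> - \<psi>) \<xi> = cinner \<phi> \<xi> - cinner \<psi> \<xi>"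
  by (simp add: minus_L2_def cinner_add_left uminus_eq_scaleC cinner_scaleC_left)

lemma cinner_diff_right: "cinner \<phi> (\<psi> - \<xi>) = cinner \<phi> \<psi> - cinner \<phi> \<xi>"
  by (simp add: minus_L2_def cinner_add_right uminus_eq_scaleC cinner_scaleC_right)

lemma norm_scaleC: "norm (scaleC_L2 c \<phi>) = cmod c * norm \<phi>"
proof -
  have "complex_of_real ((norm (scaleC_L2 c \<phi>))\<^sup>2) = complex_of_real ((cmod c * norm \<phi>)\<^sup>2)"
    using cinner_scaleC_left[of c \<phi> "scaleC_L2 c \<phi>"]
    by (simp only: cinner_scaleC_right cinner_self_norm power_mult_distrib of_real_mult
        complex_norm_square mult.assoc)
  then show ?thesis by (simp only: of_real_eq_iff) (simp add: power2_eq_iff_nonneg)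
qed

lemma cinner_bound: "cmod (cinner \<phi> \<psi>) \<le> norm \<phi> * norm \<psi>"
proof -
  \<comment> \<open>a phase that makes the complex inner product real and nonnegative, so that the real inequality applies\<close>
  define c where "c = cnj (sgn (cinner \<phi> \<psi>))"
  have c: "cmod c \<le> 1" by (simp add: c_def norm_sgn)
  have "c * cinner \<phi> \<psi> = complex_of_real (cmod (cinner \<phi> \<psi>))"
  proof (cases "cinner \<phi> \<psi> = 0")
    case False
    have "c * cinner \<phi> \<psi> = cnj (cinner \<phi> \<psi>) * cinner \<phi> \<psi> / cmod (cinner \<phi> \<psi>)"
      by (simp add: c_def sgn_eq)
    also have "\<dots> = complex_of_real (cmod (cinner \<phi> \<psi>))"
      using False by (simp add: mult.commute[of "cnj _"] complex_norm_square[symmetric] power2_eq_square)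
    finally show ?thesis .
  qed simp
  then have "cmod (cinner \<phi> \<psi>) = inner (scaleC_L2 c \<phi>) \<psi>"
    by (simp add: inner_L2_def cinner_scaleC_left)
  also have "\<dots> \<le> norm (scaleC_L2 c \<phi>) * norm \<psi>" by (rule norm_cauchy_schwarz)
  also have "\<dots> \<le> norm \<phi> * norm \<psi>"
    using c by (intro mult_right_mono) (auto simp: norm_scaleC mult_left_le_one_le)
  finally show ?thesis .
qed

text \<open>Norm estimates for vectors that are known only through their inner products: test with
  \<open>\<psi> = \<phi>\<close>.\<close>

lemma norm_le_cinner:
  assumes "K \<ge> 0" "\<And>\<psi>. cmod (cinner \<phi> \<psi>) \<le> K * norm \<psi>"
  shows "norm \<phi> \<le> K"
proof (cases "norm \<phi> = 0")
  case False
  have "norm \<phi> * norm \<phi> \<le> K * norm \<phi>"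
    using assms(2)[of \<phi>] by (simp add: cinner_self_norm power2_eq_square norm_mult)
  then show ?thesis using False by simp
qed (use assms in auto)

lemma L2_eqI:
  assumes "\<And>\<psi>. cinner \<phi> \<psi> = cinner \<phi>' \<psi>"
  shows "\<phi> = \<phi>'"
  using norm_le_cinner[of 0 "\<phi> - \<phi>'"] assms by (simp add: cinner_diff_left)

lemma bounded_bilinear_cinner: "bounded_bilinear cinner"
proof
  fix a a' b b' :: "'a L2" and r :: real
  show "cinner (a + a') b = cinner a b + cinner a' b" by (rule cinner_add_left)
  show "cinner a (b + b') = cinner a b + cinner a b'" by (rule cinner_add_right)
  show "cinner (r *\<^sub>R a) b = r *\<^sub>R cinner a b"
    by (simp add: scaleR_eq_scaleC_L2 cinner_scaleC_left scaleR_conv_of_real)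
  show "cinner a (r *\<^sub>R b) = r *\<^sub>R cinner a b"
    by (simp add: scaleR_eq_scaleC_L2 cinner_scaleC_right scaleR_conv_of_real)
  show "\<exists>K. \<forall>a b :: 'a L2. norm (cinner a b) \<le> norm a * norm b * K"
    by (rule exI[of _ 1]) (simp add: cinner_bound)
qed

lemmas tendsto_cinner = bounded_bilinear.tendsto[OF bounded_bilinear_cinner]
lemmas continuous_on_cinner = bounded_bilinear.continuous_on[OF bounded_bilinear_cinner]

lemma bounded_bilinear_scaleC: "bounded_bilinear (scaleC_L2 :: complex \<Rightarrow> 'a::euclidean_space L2 \<Rightarrow> _)"
proof
  fix c d :: complex and x y :: "'a L2" and r :: real
  show "scaleC_L2 (c + d) x = scaleC_L2 c x + scaleC_L2 d x"
    by (rule L2_eqI) (simp add: cinner_scaleC_left cinner_add_left distrib_right)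
  show "scaleC_L2 c (x + y) = scaleC_L2 c x + scaleC_L2 c y"
    by (rule L2_eqI) (simp add: cinner_scaleC_left cinner_add_left distrib_left)
  show "scaleC_L2 (r *\<^sub>R c) x = r *\<^sub>R scaleC_L2 c x"
    by (rule L2_eqI) (simp add: cinner_scaleC_left scaleR_eq_scaleC_L2 scaleR_conv_of_real)
  show "scaleC_L2 c (r *\<^sub>R x) = r *\<^sub>R scaleC_L2 c x"
    by (rule L2_eqI) (simp add: cinner_scaleC_left scaleR_eq_scaleC_L2)
  show "\<exists>K. \<forall>c (x :: 'a L2). norm (scaleC_L2 c x) \<le> norm c * norm x * K"
    by (rule exI[of _ 1]) (simp add: norm_scaleC)
qed

lemmas tendsto_scaleC = bounded_bilinear.tendsto[OF bounded_bilinear_scaleC]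

text \<open>The Riesz--Fischer theorem. Along indices at which the increments have norm at most
  \<open>2\<^sup>-\<^sup>n\<close>, the weighted sum of the squared increments \<open>2\<^sup>n |g\<^sub>n\<^sub>+\<^sub>1 - g\<^sub>n|\<^sup>2\<close> has finite integral.
  Almost everywhere the increments are therefore dominated by a geometric sequence, so the functions converge,
  and Fatou's lemma identifies the pointwise limit as the limit in norm.\<close>

instance L2 :: (euclidean_space) complete_space
proof
  fix X :: "nat \<Rightarrow> 'a L2"
  assume X: "Cauchy X"
  have "\<exists>N. \<forall>m\<ge>N. \<forall>k\<ge>N. dist (X m) (X k) < (1/2) ^ n" for n
    using X by (intro metric_CauchyD) auto
  then obtain N where N: "\<And>n m k. N n \<le> m \<Longrightarrow> N n \<le> k \<Longrightarrow> dist (X m) (X k) < (1/2) ^ n"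
    by metis
  \<comment> \<open>the sum makes the chosen indices increasing and at least \<open>N n\<close> from \<open>n\<close> on\<close>
  define r where "r n = (\<Sum>i\<le>n. N i)" for n
  have rN: "N n \<le> r m" if "n \<le> m" for n m
    unfolding r_def using that by (intro member_le_sum) auto
  define g where "g n = rep_L2 (X (r n))" for n
  have sq: "sq_integrable (g n)" for n unfolding g_def by (rule sq_integrable_rep_L2)
  have [measurable]: "g n \<in> borel_measurable borel" for n
    using sq by (simp add: sq_integrable_def)
  have absg: "abs_L2 (g n) = X (r n)" for n unfolding g_def by simp
  have intd: "(\<integral>\<^sup>+t. ennreal ((cmod (g m t - g n t))\<^sup>2) \<partial>lborel) \<le> ennreal ((1/4) ^ n)"
    if "n \<le> m" for n m
  proof -
    have "(\<integral>t. (cmod (g m t - g n t))\<^sup>2 \<partial>lborel) = (dist (X (r m)) (X (r n)))\<^sup>2"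
      using norm_abs_L2[OF sq_integrable_diff[OF sq sq], of m n]
      by (simp add: dist_norm minus_abs_L2 sq flip: absg)
    also have "\<dots> \<le> ((1/2) ^ n)\<^sup>2"
      using N[of n "r m" "r n"] rN that by (intro power_mono) (auto intro: less_imp_le)
    also have "\<dots> = (1/4) ^ n"
      by (simp add: power_even_eq[symmetric] power_mult power2_eq_square power_mult_distrib[symmetric])
    finally show ?thesis
      using sq_integrable_diff[OF sq sq, of m n]
      by (subst nn_integral_eq_integral) (auto simp: sq_integrable_def)
  qed
  have AE_conv: "AE t in lborel. convergent (\<lambda>n. g n t)"
  proof -
    let ?d = "\<lambda>n t. ennreal (2 ^ n * (cmod (g (Suc n) t - g n t))\<^sup>2)"
    have "(\<integral>\<^sup>+t. (\<Sum>n. ?d n t) \<partial>lborel) = (\<Sum>n. \<integral>\<^sup>+t. ?d n t \<partial>lborel)"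
      by (intro nn_integral_suminf) measurable
    also have "\<dots> \<le> (\<Sum>n. ennreal ((1/2) ^ n))"
    proof (intro suminf_le summableI)
      fix n
      have "(\<integral>\<^sup>+t. ?d n t \<partial>lborel) = ennreal (2 ^ n) * (\<integral>\<^sup>+t. ennreal ((cmod (g (Suc n) t - g n t))\<^sup>2) \<partial>lborel)"
        by (subst nn_integral_cmult[symmetric]) (auto simp: ennreal_mult'')
      also have "\<dots> \<le> ennreal (2 ^ n) * ennreal ((1/4) ^ n)"
        by (intro mult_left_mono intd) auto
      also have "\<dots> = ennreal ((1/2) ^ n)"
        by (simp add: ennreal_mult''[symmetric] power_mult_distrib[symmetric])
      finally show "(\<integral>\<^sup>+t. ?d n t \<partial>lborel) \<le> ennreal ((1/2) ^ n)" .
    qed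
    also have "\<dots> = ennreal (\<Sum>n. (1/2) ^ n)"
      by (intro suminf_ennreal2 summable_geometric) auto
    also have "\<dots> < \<infinity>" by simp
    finally have "AE t in lborel. (\<Sum>n. ?d n t) \<noteq> \<infinity>"
      by (intro nn_integral_PInf_AE) auto
    then show ?thesis
    proof eventually_elim
      case (elim t)
      define C where "C = enn2real (\<Sum>n. ?d n t)"
      have "(\<Sum>n. ?d n t) < top" using elim by (simp only: less_top infinity_ennreal_def)
      then have C: "C \<ge> 0" "(\<Sum>n. ?d n t) = ennreal C"
        unfolding C_def by (simp_all only: ennreal_enn2real enn2real_nonneg)
      have "cmod (g (Suc n) t - g n t) \<le> sqrt C * (sqrt (1/2)) ^ n" for n
      proof -
        have "sum (\<lambda>n. ?d n t) {n} \<le> (\<Sum>n. ?d n t)"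
          by (rule sum_le_suminf) (simp_all only: summableI finite.intros zero_le)
        then have "?d n t \<le> ennreal C"
          unfolding C(2) by simp
        then have "2 ^ n * (cmod (g (Suc n) t - g n t))\<^sup>2 \<le> C"
          by (subst (asm) ennreal_le_iff[OF C(1)])
        then have "(cmod (g (Suc n) t - g n t))\<^sup>2 \<le> C * (1/2) ^ n"
          by (simp add: field_simps power_one_over)
        then have "cmod (g (Suc n) t - g n t) \<le> sqrt (C * (1/2) ^ n)"
          by (rule real_le_rsqrt)
        then show ?thesis by (simp add: real_sqrt_mult real_sqrt_power)
      qed
      moreover have "summable (\<lambda>n. sqrt C * (sqrt (1/2)) ^ n)"
        by (intro summable_mult summable_geometric) (simp add: real_sqrt_lt_1_iff)
      ultimately have "summable (\<lambda>n. g (Suc n) t - g n t)"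
        by (intro summable_comparison_test[OF _ \<open>summable _\<close>]) auto
      then have "convergent (\<lambda>n. \<Sum>i<n. g (Suc i) t - g i t)"
        by (simp only: summable_iff_convergent)
      then have "convergent (\<lambda>n. g n t - g 0 t)"
        by (simp only: sum_lessThan_telescope[of "\<lambda>i. g i t"])
      then show "convergent (\<lambda>n. g n t)"
        using convergent_add[OF _ convergent_const[of "g 0 t"]] by fastforce
    qed
  qed
  define G where "G t = lim (\<lambda>n. g n t)" for t
  have Gm[measurable]: "G \<in> borel_measurable borel"
    unfolding G_def by (intro borel_measurable_lim_metric) simp
  have AE_G: "AE t in lborel. (\<lambda>n. g n t) \<longlonglongrightarrow> G t"
    using AE_conv by eventually_elim (simp add: G_def convergent_LIMSEQ_iff)
  have GN: "(\<integral>\<^sup>+t. ennreal ((cmod (G t - g n t))\<^sup>2) \<partial>lborel) \<le> ennreal ((1/4) ^ n)" for n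
  proof -
    have "(\<integral>\<^sup>+t. ennreal ((cmod (G t - g n t))\<^sup>2) \<partial>lborel)
        = (\<integral>\<^sup>+t. liminf (\<lambda>m. ennreal ((cmod (g m t - g n t))\<^sup>2)) \<partial>lborel)"
    proof (intro nn_integral_cong_AE)
      show "AE t in lborel. ennreal ((cmod (G t - g n t))\<^sup>2) = liminf (\<lambda>m. ennreal ((cmod (g m t - g n t))\<^sup>2))"
        using AE_G
      proof eventually_elim
        case (elim t)
        have "(\<lambda>m. ennreal ((cmod (g m t - g n t))\<^sup>2)) \<longlonglongrightarrow> ennreal ((cmod (G t - g n t))\<^sup>2)"
          by (intro tendsto_intros elim)
        then show ?case
          by (intro lim_imp_Liminf[symmetric] trivial_limit_sequentially)
      qed
    qed
    also have "\<dots> \<le> liminf (\<lambda>m. \<integral>\<^sup>+t. ennreal ((cmod (g m t - g n t))\<^sup>2) \<partial>lborel)"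
      by (intro nn_integral_liminf) measurable
    also have "\<dots> \<le> liminf (\<lambda>m. ennreal ((1/4) ^ n))"
      using intd by (intro Liminf_mono eventually_sequentiallyI[of n])
    finally show ?thesis by (simp add: Liminf_const)
  qed
  have sqd: "sq_integrable (\<lambda>t. G t - g n t)" for n
    unfolding sq_integrable_def
  proof
    show "integrable lborel (\<lambda>t. (cmod (G t - g n t))\<^sup>2)"
      using GN[of n] by (intro integrableI_bounded) (auto simp: le_less_trans)
  qed measurable
  have sqG: "sq_integrable G" using sq_integrable_add[OF sqd[of 0] sq[of 0]] by simp
  have dG: "dist (X (r n)) (abs_L2 G) \<le> (1/2) ^ n" for n
  proof -
    have "(dist (X (r n)) (abs_L2 G))\<^sup>2 = (\<integral>t. (cmod (G t - g n t))\<^sup>2 \<partial>lborel)"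
      using norm_abs_L2[OF sqd, of n] norm_minus_commute[of "abs_L2 G" "abs_L2 (g n)"]
      by (simp add: dist_norm minus_abs_L2 sq sqG flip: absg)
    also have "ennreal \<dots> \<le> ennreal ((1/4) ^ n)"
      using GN[of n] sqd[of n]
      by (subst nn_integral_eq_integral[symmetric]) (auto simp: sq_integrable_def)
    also have "(1/4 :: real) ^ n = ((1/2) ^ n)\<^sup>2"
      by (simp add: power_even_eq[symmetric] power_mult power2_eq_square power_mult_distrib[symmetric])
    finally show ?thesis by (simp add: power2_le_iff_abs_le)
  qed
  have "X \<longlonglongrightarrow> abs_L2 G"
  proof (rule metric_LIMSEQ_I)
    fix e :: real assume "e > 0"
    then obtain n where n: "(1/2) ^ n < e / 2"
      using real_arch_pow_inv[of "e/2" "1/2"] by auto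
    show "\<exists>no. \<forall>m\<ge>no. dist (X m) (abs_L2 G) < e"
    proof (intro exI allI impI)
      fix m assume "m \<ge> N n"
      then show "dist (X m) (abs_L2 G) < e"
        using N[of n m "r n"] dG[of n] rN[of n n] dist_triangle[of "X m" "abs_L2 G" "X (r n)"] n by auto
    qed
  qed
  then show "convergent X" by (rule convergentI)
qed

lemma L2_Lp_limit:
  assumes s: "\<And>n. Lp 2 (s n)" and f: "Lp 2 f"
    and lim: "(\<lambda>n. \<integral>x. cmod (s n x - f x) ^ 2 \<partial>lborel) \<longlonglongrightarrow> 0"
  shows "(\<lambda>n. abs_L2 (s n)) \<longlonglongrightarrow> abs_L2 f"
proof -
  have sq: "sq_integrable (s n)" "sq_integrable f" for n using s f by (simp_all add: sq_integrable_iff_Lp)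
  have "(\<lambda>n. (norm (abs_L2 (s n) - abs_L2 f))\<^sup>2) \<longlonglongrightarrow> 0"
    using lim by (simp add: minus_abs_L2 sq norm_abs_L2 sq_integrable_diff)
  then have "(\<lambda>n. norm (abs_L2 (s n) - abs_L2 f)) \<longlonglongrightarrow> 0"
    using tendsto_real_sqrt by fastforce
  then show ?thesis by (simp add: tendsto_iff dist_norm)
qed

section \<open>Smooth functions of bounded support are dense\<close>

text \<open>The standard smooth functions that vanish to infinite order at \<open>0\<close>. The exponent \<open>k\<close> is a parameter
  so that derivatives stay within the family.\<close>

definition flat :: "nat \<Rightarrow> real \<Rightarrow> real \<Rightarrow> real" where
  "flat k c x = (if x > 0 then exp (- c / x) / x ^ k else 0)"

text \<open>One term of the exponential series bounds \<open>exp (c / x)\<close> from below. The resulting linear bound gives at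
  once continuity at \<open>0\<close> and, applied to \<open>k + 1\<close>, a zero derivative there.\<close>

lemma flat_le:
  assumes "c > 0" "x > 0"
  shows "flat k c x \<le> fact (Suc k) / c ^ Suc k * x"
proof -
  have "(c / x) ^ Suc k / fact (Suc k) \<le> exp (c / x)"
  proof -
    have "sum (\<lambda>n. (c / x) ^ n /\<^sub>R fact n) {Suc k} \<le> (\<Sum>n. (c / x) ^ n /\<^sub>R fact n)"
      by (rule sum_le_suminf[OF sums_summable[OF exp_converges]]) (use assms in auto)
    also have "\<dots> = exp (c / x)" by (rule sums_unique[OF exp_converges, symmetric])
    finally show ?thesis by (simp add: divide_inverse mult.commute)
  qed
  then have "c ^ Suc k \<le> fact (Suc k) * x * (exp (c / x) * x ^ k)"
    using assms by (simp add: power_divide pos_divide_le_eq mult_ac del: fact_Suc)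
  then have "1 / (exp (c / x) * x ^ k) \<le> fact (Suc k) / c ^ Suc k * x"
    using assms by (simp add: pos_divide_le_eq pos_le_divide_eq del: fact_Suc power_Suc)
  then show ?thesis
    using assms by (simp add: flat_def exp_minus divide_inverse mult_ac del: fact_Suc power_Suc)
qed

lemma flat_nonneg: "0 \<le> flat k c x"
  by (simp add: flat_def)

lemma flat_tendsto_0:
  assumes c: "c > 0"
  shows "((\<lambda>h. flat k c h) \<longlongrightarrow> 0) (at 0)"
proof (rule tendsto_sandwich[where f="\<lambda>_. 0" and h="\<lambda>h. fact (Suc k) / c ^ Suc k * \<bar>h\<bar>"])
  let ?K = "fact (Suc k) / c ^ Suc k :: real"
  show "((\<lambda>h. ?K * \<bar>h\<bar>) \<longlongrightarrow> 0) (at 0)"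
    by (intro tendsto_mult_right_zero tendsto_rabs_zero tendsto_ident_at)
  have "0 \<le> ?K * \<bar>h\<bar>" for h
    by (intro mult_nonneg_nonneg divide_nonneg_pos zero_less_power c) simp_all
  then have "flat k c h \<le> ?K * \<bar>h\<bar>" for h
  proof (cases "h > 0")
    case True
    then show ?thesis using flat_le[OF c True, of k] by (simp only: abs_of_pos)
  next
    case False
    then have "flat k c h = 0" by (simp add: flat_def)
    then show ?thesis using \<open>\<And>h. 0 \<le> ?K * \<bar>h\<bar>\<close>[of h] by (simp only:)
  qed
  then show "\<forall>\<^sub>F h in at 0. flat k c h \<le> ?K * \<bar>h\<bar>" by simp
qed (simp_all add: flat_nonneg del: fact_Suc power_Suc)

lemma flat_has_derivative:
  assumes c: "c > 0"
  shows "(flat k c has_real_derivative c * flat (k + 2) c x - k * flat (k + 1) c x) (at x)"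
proof -
  consider "x > 0" | "x < 0" | "x = 0" by linarith
  then show ?thesis
  proof cases
    case 1
    have "((\<lambda>x. exp (- c / x)) has_real_derivative exp (- c / x) * (c / x\<^sup>2)) (at x)"
      using 1 by (auto intro!: derivative_eq_intros simp: power2_eq_square)
    from DERIV_divide[OF this DERIV_pow[of k]]
    have "((\<lambda>x. exp (- c / x) / x ^ k) has_real_derivative
        (exp (- c / x) * (c / x\<^sup>2) * x ^ k - exp (- c / x) * (real k * x ^ (k - Suc 0))) / (x ^ k * x ^ k)) (at x)"
      using 1 by simp
    also have "(exp (- c / x) * (c / x\<^sup>2) * x ^ k - exp (- c / x) * (real k * x ^ (k - Suc 0))) / (x ^ k * x ^ k) =
        c * flat (k + 2) c x - k * flat (k + 1) c x"
      using 1 by (cases k) (simp_all add: flat_def field_simps power2_eq_square)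
    finally have "((\<lambda>x. exp (- c / x) / x ^ k) has_real_derivative c * flat (k + 2) c x - k * flat (k + 1) c x) (at x)" .
    then show ?thesis
      by (rule has_field_derivative_transform_within_open[OF _ open_greaterThan[of 0]])
        (use 1 in \<open>auto simp: flat_def\<close>)
  next
    case 2
    have "((\<lambda>x. 0) has_real_derivative c * flat (k + 2) c x - k * flat (k + 1) c x) (at x)"
      using 2 by (simp add: flat_def)
    then show ?thesis
      by (rule has_field_derivative_transform_within_open[OF _ open_lessThan[of 0]])
        (use 2 in \<open>auto simp: flat_def\<close>)
  next
    case 3
    have "((\<lambda>h. flat (Suc k) c h) \<longlongrightarrow> 0) (at 0)" by (rule flat_tendsto_0[OF c])
    moreover have "flat (Suc k) c h = (flat k c (0 + h) - flat k c 0) / h" for h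
      by (auto simp: flat_def field_simps)
    ultimately show ?thesis by (simp add: 3 flat_def DERIV_def)
  qed
qed

text \<open>An algebra of functions that is visibly closed under partial derivatives, so that smoothness, in the form of
  differentiability of all iterated partial derivatives, needs no calculus of higher derivatives.\<close>

inductive_set bump_algebra :: "('a::euclidean_space \<Rightarrow> complex) set" where
  const: "(\<lambda>_. c) \<in> bump_algebra"
| flat: "c > 0 \<Longrightarrow> (\<lambda>t. complex_of_real (flat k c (t \<bullet> v + a))) \<in> bump_algebra"
| add: "f \<in> bump_algebra \<Longrightarrow> g \<in> bump_algebra \<Longrightarrow> (\<lambda>t. f t + g t) \<in> bump_algebra"
| mult: "f \<in> bump_algebra \<Longrightarrow> g \<in> bump_algebra \<Longrightarrow> (\<lambda>t. f t * g t) \<in> bump_algebra"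

lemma bump_algebra_prod:
  "finite I \<Longrightarrow> (\<And>i. i \<in> I \<Longrightarrow> f i \<in> bump_algebra) \<Longrightarrow> (\<lambda>t. \<Prod>i\<in>I. f i t) \<in> bump_algebra"
  by (induction I rule: finite_induct) (auto intro: bump_algebra.intros)

lemma bump_algebra_derivative:
  assumes "f \<in> bump_algebra"
  shows "\<exists>f'. (\<forall>t. (f has_derivative f' t) (at t)) \<and> (\<forall>b. (\<lambda>t. f' t b) \<in> bump_algebra)"
  using assms
proof induction
  case (const c)
  show ?case
    by (rule exI[of _ "\<lambda>_ _. 0"]) (auto intro: bump_algebra.const)
next
  case (flat c k v a)
  let ?f' = "\<lambda>t. c * flat (k + 2) c (t \<bullet> v + a) - k * flat (k + 1) c (t \<bullet> v + a)"
  show ?case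
  proof (intro exI[of _ "\<lambda>t b. complex_of_real (?f' t * (b \<bullet> v))"] conjI allI)
    fix t :: 'a
    have "((\<lambda>t. t \<bullet> v + a) has_derivative (\<lambda>b. b \<bullet> v)) (at t)"
      by (auto intro!: derivative_eq_intros)
    from has_derivative_compose[OF this flat_has_derivative[OF flat, unfolded has_field_derivative_def]]
    have "((\<lambda>t. flat k c (t \<bullet> v + a)) has_derivative (\<lambda>b. ?f' t * (b \<bullet> v))) (at t)" .
    then show "((\<lambda>t. complex_of_real (flat k c (t \<bullet> v + a))) has_derivative
        (\<lambda>b. complex_of_real (?f' t * (b \<bullet> v)))) (at t)"
      by (rule has_derivative_of_real)
  next
    fix b :: 'a
    have "(\<lambda>t. (of_real (b \<bullet> v) * of_real c) * complex_of_real (flat (k + 2) c (t \<bullet> v + a))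
        + (- of_real (b \<bullet> v) * of_nat k) * complex_of_real (flat (k + 1) c (t \<bullet> v + a))) \<in> bump_algebra"
      by (intro bump_algebra.intros flat)
    then show "(\<lambda>t. complex_of_real (?f' t * (b \<bullet> v))) \<in> bump_algebra"
      by (simp add: algebra_simps)
  qed
next
  case (add f g)
  then obtain f' g' where
    "\<And>t. (f has_derivative f' t) (at t)" "\<And>b. (\<lambda>t. f' t b) \<in> bump_algebra"
    "\<And>t. (g has_derivative g' t) (at t)" "\<And>b. (\<lambda>t. g' t b) \<in> bump_algebra" by blast
  then show ?case
    by (intro exI[of _ "\<lambda>t b. f' t b + g' t b"]) (auto intro: bump_algebra.add has_derivative_add)
next
  case (mult f g)
  then obtain f' g' where
    "\<And>t. (f has_derivative f' t) (at t)" "\<And>b. (\<lambda>t. f' t b) \<in> bump_algebra"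
    "\<And>t. (g has_derivative g' t) (at t)" "\<And>b. (\<lambda>t. g' t b) \<in> bump_algebra" by blast
  then show ?case
    using mult
    by (intro exI[of _ "\<lambda>t b. f t * g' t b + f' t b * g t"])
      (auto intro!: bump_algebra.add bump_algebra.mult has_derivative_mult)
qed

lemma bump_algebra_differentiable: "f \<in> bump_algebra \<Longrightarrow> f differentiable (at t)"
  using bump_algebra_derivative unfolding differentiable_def by blast

lemma bump_algebra_continuous: "f \<in> bump_algebra \<Longrightarrow> continuous_on S f"
  by (intro continuous_at_imp_continuous_on ballI differentiable_imp_continuous_within
      bump_algebra_differentiable)

lemma bump_algebra_iter_partial: "f \<in> bump_algebra \<Longrightarrow> iter_partial bs f \<in> bump_algebra"
proof (induction bs)
  case (Cons b bs)
  then obtain f' where f': "\<And>t. (iter_partial bs f has_derivative f' t) (at t)"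
      "\<And>b. (\<lambda>t. f' t b) \<in> bump_algebra"
    using bump_algebra_derivative by blast
  have "frechet_derivative (iter_partial bs f) (at t) = f' t" for t
    using frechet_derivative_at[OF f'(1)] by simp
  then show ?case using f'(2) by simp
qed simp

text \<open>Derivatives do not enlarge a closed support.\<close>

lemma iter_partial_zero_outside:
  assumes "closed K" "\<And>t. t \<notin> K \<Longrightarrow> f t = 0" "t \<notin> K"
  shows "iter_partial bs f t = 0"
  using assms(3)
proof (induction bs arbitrary: t)
  case (Cons b bs)
  have "(iter_partial bs f has_derivative (\<lambda>_. 0)) (at t)"
    by (rule has_derivative_transform_within_open[where f="\<lambda>_. 0" and s="- K"])
      (use assms(1) Cons in auto)
  then have "frechet_derivative (iter_partial bs f) (at t) = (\<lambda>_. 0)"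
    by (rule frechet_derivative_at[symmetric])
  then show ?case by simp
qed (use assms(2) in simp)

definition bumps :: "('a::euclidean_space \<Rightarrow> complex) set" where
  "bumps = {f \<in> bump_algebra. \<exists>R. \<forall>t. norm t > R \<longrightarrow> f t = 0}"

lemma bumps_support:
  assumes "f \<in> bumps"
  obtains R where "R > 0" "\<And>t. norm t > R \<Longrightarrow> f t = 0"
proof -
  obtain R where R: "\<And>t. norm t > R \<Longrightarrow> f t = 0" using assms by (auto simp: bumps_def)
  show ?thesis by (rule that[of "max R 1"]) (auto intro: R)
qed

lemma bumps_add:
  assumes "f \<in> bumps" "g \<in> bumps" shows "(\<lambda>t. f t + g t) \<in> bumps"
proof -
  obtain R R' where "\<And>t. norm t > R \<Longrightarrow> f t = 0" "\<And>t. norm t > R' \<Longrightarrow> g t = 0"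
    using assms bumps_support by metis
  then have "\<forall>t. norm t > max R R' \<longrightarrow> f t + g t = 0" by auto
  then show ?thesis using assms unfolding bumps_def by (auto intro: bump_algebra.add exI[of _ "max R R'"])
qed

lemma bumps_cmult: "f \<in> bumps \<Longrightarrow> (\<lambda>t. c * f t) \<in> bumps"
  unfolding bumps_def by (auto intro: bump_algebra.mult bump_algebra.const)

lemma bumps_continuous: "f \<in> bumps \<Longrightarrow> continuous_on S f"
  by (simp add: bumps_def bump_algebra_continuous)

lemma compact_support_bounded:
  fixes f :: "'a::euclidean_space \<Rightarrow> 'b::real_normed_vector"
  assumes "continuous_on UNIV f" "\<And>t. norm t > R \<Longrightarrow> f t = 0"
  shows "bounded (range f)"
proof -
  have "compact (f ` cball 0 R)"
    by (intro compact_continuous_image continuous_on_subset[OF assms(1)]) auto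
  then have "bounded (insert 0 (f ` cball 0 R))" by (simp add: compact_imp_bounded)
  moreover have "range f \<subseteq> insert 0 (f ` cball 0 R)"
    using assms(2) by (force simp: not_le)
  ultimately show ?thesis by (rule bounded_subset)
qed

text \<open>A continuous function of bounded support is bounded, even after multiplication with powers of the norm.\<close>

lemma bumps_schwartz:
  assumes "f \<in> bumps" shows "schwartz f"
  unfolding schwartz_def
proof (intro allI impI conjI)
  fix bs :: "'a list" and t :: 'a and N :: nat
  obtain R where R: "\<And>t. norm t > R \<Longrightarrow> f t = 0" using assms bumps_support by metis
  have f: "iter_partial bs f \<in> bump_algebra"
    using assms by (auto simp: bumps_def bump_algebra_iter_partial)
  then show "iter_partial bs f differentiable at t" by (rule bump_algebra_differentiable)
  show "bounded (range (\<lambda>t. norm t ^ N *\<^sub>R iter_partial bs f t))"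
  proof (rule compact_support_bounded)
    show "continuous_on UNIV (\<lambda>t. norm t ^ N *\<^sub>R iter_partial bs f t)"
      by (intro continuous_intros bump_algebra_continuous f)
    fix t :: 'a assume "norm t > R"
    then show "norm t ^ N *\<^sub>R iter_partial bs f t = 0"
      using iter_partial_zero_outside[of "cball 0 R" f t bs] R by simp
  qed
qed

lemma bumps_bound:
  assumes "f \<in> bumps"
  obtains M R where "M > 0" "R > 0" "\<And>t. cmod (f t) \<le> M * indicator (ball 0 R) t"
proof -
  obtain R where R: "R > 0" "\<And>t. norm t > R \<Longrightarrow> f t = 0" using assms bumps_support by metis
  have "bounded (range f)" by (rule compact_support_bounded[OF bumps_continuous[OF assms] R(2)])
  then obtain M where M: "M > 0" "\<And>t. cmod (f t) \<le> M" by (auto simp: bounded_pos)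
  show ?thesis
    using R M by (intro that[of M "R + 1"]) (auto simp: indicator_def)
qed

lemma bumps_Lp:
  assumes "f \<in> bumps" "p > 0" shows "Lp p f"
proof -
  obtain M R where MR: "M > 0" "R > 0" "\<And>t. cmod (f t) \<le> M * indicator (ball 0 R) t"
    using bumps_bound[OF assms(1)] by blast
  have "Lp p (\<lambda>t. of_real M * (indicator (ball 0 R) t :: complex))"
    using assms by (intro Lp_cmult Lp_indicator_bounded) auto
  then show ?thesis
  proof (rule Lp_bound[OF Lp_integrable])
    show "f \<in> borel_measurable borel"
      by (intro borel_measurable_continuous_onI bumps_continuous assms)
    show "cmod (f x) ^ p \<le> cmod (of_real M * indicator (ball 0 R) x) ^ p" for x
      using MR(1) MR(3)[of x] by (intro power_mono) (auto simp: norm_mult indicator_def)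
  qed
qed

text \<open>The product over the coordinates of \<open>exp (-c / (t\<^sub>i - a\<^sub>i)) exp (-c / (b\<^sub>i - t\<^sub>i))\<close> is positive exactly on the
  box and increases to its indicator as \<open>c\<close> decreases to \<open>0\<close>.\<close>

lemma box_indicator_bump_limit:
  fixes a b :: "'a::euclidean_space"
  obtains s where "\<And>n :: nat. s n \<in> bumps" "\<And>x. (\<lambda>n. s n x) \<longlonglongrightarrow> indicator (box a b) x"
    "\<And>n x. cmod (s n x) \<le> cmod (indicator (box a b) x)"
proof -
  define s :: "nat \<Rightarrow> 'a \<Rightarrow> complex" where
    "s n t = (\<Prod>i\<in>Basis. complex_of_real (flat 0 (1 / Suc n) (t \<bullet> i + - (a \<bullet> i))) *
      complex_of_real (flat 0 (1 / Suc n) (t \<bullet> - i + b \<bullet> i)))" for n t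
  have zero: "s n t = 0" if out: "t \<notin> box a b" for n t
  proof -
    obtain i where "i \<in> Basis" "\<not> a \<bullet> i < t \<bullet> i \<or> \<not> t \<bullet> i < b \<bullet> i" using out unfolding mem_box by blast
    then show ?thesis
      unfolding s_def by (intro prod_zero bexI[of _ i]) (auto simp: flat_def)
  qed
  have "cmod (complex_of_real (flat 0 (1 / Suc n) x)) \<le> 1" for n x
    by (simp add: flat_def)
  then have le1: "cmod (s n t) \<le> 1" for n t
    unfolding s_def prod_norm[symmetric] norm_mult
    by (intro prod_le_1) (auto intro!: mult_le_one)
  then have C: "cmod (s n t) \<le> cmod (indicator (box a b) t)" for n t
    using zero by (cases "t \<in> box a b") auto
  have "s n \<in> bump_algebra" for n
    unfolding s_def by (intro bump_algebra_prod bump_algebra.intros) auto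
  moreover have "\<exists>R. \<forall>t. norm t > R \<longrightarrow> s n t = 0" for n
  proof -
    obtain R where "\<forall>t\<in>box a b. norm t \<le> R" using bounded_box[of a b] by (auto simp: bounded_iff)
    then show ?thesis using zero by (intro exI[of _ R]) force
  qed
  ultimately have A: "s n \<in> bumps" for n by (simp add: bumps_def)
  have B: "(\<lambda>n. s n x) \<longlonglongrightarrow> indicator (box a b) x" for x
  proof (cases "x \<in> box a b")
    case True
    have lim: "(\<lambda>n. complex_of_real (flat 0 (1 / Suc n) y)) \<longlonglongrightarrow> 1" if "y > 0" for y
    proof -
      have "(\<lambda>n. 1 / real (Suc n)) \<longlonglongrightarrow> 0" by (intro LIMSEQ_Suc lim_1_over_n)
      then have "(\<lambda>n. complex_of_real (exp (- (1 / real (Suc n)) / y))) \<longlonglongrightarrow> of_real (exp (- 0 / y))"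
        by (intro tendsto_intros) (use that in auto)
      then show ?thesis using that by (simp add: flat_def)
    qed
    have "(\<lambda>n. s n x) \<longlonglongrightarrow> (\<Prod>i\<in>(Basis :: 'a set). 1 * 1)"
      unfolding s_def using True
      by (intro tendsto_prod tendsto_mult lim) (auto simp: mem_box)
    then show ?thesis using True by simp
  qed (simp add: zero)
  show ?thesis by (rule that[OF A B C])
qed

lemma L2_closure_bumps:
  "\<phi> \<in> closure (abs_L2 ` (bumps :: ('a::euclidean_space \<Rightarrow> complex) set))"
proof (cases \<phi>)
  case (1 g)
  let ?C = "closure (abs_L2 ` (bumps :: ('a::euclidean_space \<Rightarrow> complex) set))"
  have sqb: "sq_integrable f" if "f \<in> bumps" for f :: "'a \<Rightarrow> complex"
    using bumps_Lp[OF that, of 2] by (simp add: sq_integrable_iff_Lp)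
  have "Lp 2 g" using 1 by (simp add: sq_integrable_iff_Lp)
  with zero_less_numeral have "abs_L2 g \<in> ?C"
  proof (induction g rule: Lp_box_induct)
    case (box a b)
    obtain s :: "nat \<Rightarrow> 'a \<Rightarrow> complex" where s: "\<And>n. s n \<in> bumps" "\<And>x. (\<lambda>n. s n x) \<longlonglongrightarrow> indicator (box a b) x"
      "\<And>n x. cmod (s n x) \<le> cmod (indicator (box a b) x)"
      using box_indicator_bump_limit[of a b] by blast
    have ind: "Lp 2 (indicator (box a b) :: 'a \<Rightarrow> complex)" by (intro Lp_indicator_bounded) auto
    have sm: "s n \<in> borel_measurable borel" for n
      by (intro borel_measurable_continuous_onI bumps_continuous s)
    note dct = Lp_dominated_convergence[OF sm Lp_measurable[OF ind] s(2) ind s(3) zero_less_numeral]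
    have "(\<lambda>n. abs_L2 (s n)) \<longlonglongrightarrow> abs_L2 (indicator (box a b))"
      by (rule L2_Lp_limit[OF dct])
    then show ?case
      using s(1) unfolding closure_sequential by (intro exI[of _ "\<lambda>n. abs_L2 (s n)"]) simp
  next
    case (add f g)
    then obtain u v where u: "\<And>n. u n \<in> abs_L2 ` bumps" "u \<longlonglongrightarrow> abs_L2 f"
      and v: "\<And>n. v n \<in> abs_L2 ` bumps" "v \<longlonglongrightarrow> abs_L2 g"
      unfolding closure_sequential by blast
    have "u n + v n \<in> abs_L2 ` bumps" for n
      using u(1)[of n] v(1)[of n] by (auto simp: plus_abs_L2 sqb intro!: imageI bumps_add)
    moreover have "(\<lambda>n. u n + v n) \<longlonglongrightarrow> abs_L2 (\<lambda>x. f x + g x)"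
      using tendsto_add[OF u(2) v(2)] add by (simp add: plus_abs_L2 sq_integrable_iff_Lp)
    ultimately show ?case
      unfolding closure_sequential by (intro exI[of _ "\<lambda>n. u n + v n"]) simp
  next
    case (cmult f c)
    then obtain u where u: "\<And>n. u n \<in> abs_L2 ` bumps" "u \<longlonglongrightarrow> abs_L2 f"
      unfolding closure_sequential by blast
    have "scaleC_L2 c (u n) \<in> abs_L2 ` bumps" for n
      using u(1)[of n] by (auto simp: scaleC_abs_L2 sqb intro!: imageI bumps_cmult)
    moreover have "(\<lambda>n. scaleC_L2 c (u n)) \<longlonglongrightarrow> abs_L2 (\<lambda>x. c * f x)"
      using tendsto_scaleC[OF tendsto_const u(2)] cmult by (simp add: scaleC_abs_L2 sq_integrable_iff_Lp)
    ultimately show ?case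
      unfolding closure_sequential by (intro exI[of _ "\<lambda>n. scaleC_L2 c (u n)"]) simp
  next
    case (lim s f)
    show ?case
      using closed_sequentially[OF closed_closure lim.IH L2_Lp_limit[OF lim.hyps]] .
  qed
  then show ?thesis using 1 by simp
qed

lemma L2_bump_approx:
  fixes \<phi> :: "'a::euclidean_space L2"
  assumes "e > 0"
  obtains g :: "'a \<Rightarrow> complex" where "g \<in> bumps" "norm (\<phi> - abs_L2 g) < e"
  using L2_closure_bumps[of \<phi>] assms unfolding closure_approachable
  by (auto simp: dist_norm norm_minus_commute)

section \<open>Time-frequency shifts\<close>

text \<open>The change of variables \<open>t \<mapsto> x + c t\<close>, which multiplies volumes by \<open>|c|\<^sup>d\<close>.\<close>

lemma
  fixes h :: "'a::euclidean_space \<Rightarrow> 'b::{banach, second_countable_topology}"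
  assumes c: "c \<noteq> 0" and h [measurable]: "h \<in> borel_measurable borel"
  shows integrable_affine_iff: "integrable lborel (\<lambda>t. h (x + c *\<^sub>R t)) \<longleftrightarrow> integrable lborel h"
    and integral_affine: "(\<integral>t. h (x + c *\<^sub>R t) \<partial>lborel) = (1 / \<bar>c\<bar> ^ DIM('a)) *\<^sub>R (\<integral>t. h t \<partial>lborel)"
proof -
  let ?D = "distr lborel borel (\<lambda>t. x + c *\<^sub>R t)"
  have D: "lborel = density ?D (\<lambda>_. ennreal (\<bar>c\<bar> ^ DIM('a)))"
    using lborel_affine[OF c, of x] by (simp add: ennreal_power)
  have hD: "h \<in> borel_measurable ?D" by simp
  have "integrable lborel h \<longleftrightarrow> integrable ?D (\<lambda>t. (\<bar>c\<bar> ^ DIM('a)) *\<^sub>R h t)"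
    by (subst D, subst integrable_density[OF hD]) auto
  also have "\<dots> \<longleftrightarrow> integrable ?D h"
    using integrable_scaleR_right[of "inverse (\<bar>c\<bar> ^ DIM('a))" ?D "\<lambda>t. (\<bar>c\<bar> ^ DIM('a)) *\<^sub>R h t"] c
    by auto
  also have "\<dots> \<longleftrightarrow> integrable lborel (\<lambda>t. h (x + c *\<^sub>R t))"
    by (subst integrable_distr_eq) auto
  finally show "integrable lborel (\<lambda>t. h (x + c *\<^sub>R t)) \<longleftrightarrow> integrable lborel h" ..
  have "(\<integral>t. h t \<partial>lborel) = (\<integral>t. (\<bar>c\<bar> ^ DIM('a)) *\<^sub>R h t \<partial>?D)"
    by (subst D, subst integral_density[OF hD]) auto
  also have "\<dots> = (\<bar>c\<bar> ^ DIM('a)) *\<^sub>R (\<integral>t. h (x + c *\<^sub>R t) \<partial>lborel)"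
    by (subst integral_distr) auto
  finally show "(\<integral>t. h (x + c *\<^sub>R t) \<partial>lborel) = (1 / \<bar>c\<bar> ^ DIM('a)) *\<^sub>R (\<integral>t. h t \<partial>lborel)"
    using c by simp
qed

lemma measurable_cis [measurable]:
  "f \<in> borel_measurable M \<Longrightarrow> (\<lambda>t. cis (f t)) \<in> borel_measurable M"
  by (rule measurable_compose[where N=borel]) (auto intro!: borel_measurable_continuous_onI continuous_intros)

lemma measurable_cnj [measurable]:
  "f \<in> borel_measurable M \<Longrightarrow> (\<lambda>t. cnj (f t)) \<in> borel_measurable M"
  by (rule measurable_compose[where N=borel]) (auto intro!: borel_measurable_continuous_onI continuous_intros)

lemma sq_integrable_measurable: "sq_integrable g \<Longrightarrow> g \<in> borel_measurable borel"
  by (simp add: sq_integrable_def)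

lemma sq_integrable_modulate:
  assumes "sq_integrable g" "f \<in> borel_measurable borel"
  shows "sq_integrable (\<lambda>t. cis (f t) * g t)"
proof -
  have [measurable]: "g \<in> borel_measurable borel" "f \<in> borel_measurable borel"
    using assms by (simp_all add: sq_integrable_measurable)
  show ?thesis using assms by (simp add: sq_integrable_def norm_mult)
qed

lemma sq_integrable_shift: "sq_integrable g \<Longrightarrow> sq_integrable (\<lambda>t. g (t - x))"
  using sq_integrable_affine[of 1 g "-x"] by simp

lemma sq_integrable_tf_shift:
  "sq_integrable g \<Longrightarrow> sq_integrable (\<lambda>t. cis (2 * pi * (\<omega> \<bullet> t)) * g (t - x))"
  by (intro sq_integrable_modulate sq_integrable_shift) auto

lemma tf_shift_abs_L2:
  "sq_integrable g \<Longrightarrow>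
    tf_shift (x, \<omega>) (abs_L2 g) = abs_L2 (\<lambda>t. cis (2 * pi * (\<omega> \<bullet> t)) * g (t - x))"
  by (simp add: tf_shift.abs_eq L2_rel_refl)

text \<open>The adjoint of a time-frequency shift is the opposite shift, up to the phase that comes from the failure of
  translations and modulations to commute.\<close>

definition tf_adj :: "'a::euclidean_space \<times> 'a \<Rightarrow> 'a L2 \<Rightarrow> 'a L2" where
  "tf_adj z \<psi> = scaleC_L2 (cis (- 2 * pi * (snd z \<bullet> fst z))) (tf_shift (- fst z, - snd z) \<psi>)"

lemma tf_adj_abs_L2:
  assumes g: "sq_integrable g"
  shows "tf_adj (x, \<omega>) (abs_L2 g) = abs_L2 (\<lambda>t. cis (- 2 * pi * (\<omega> \<bullet> (t + x))) * g (t + x))"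
proof -
  have "cis (- 2 * pi * (\<omega> \<bullet> x)) * (cis (2 * pi * (- \<omega> \<bullet> t)) * g (t - - x)) =
      cis (- 2 * pi * (\<omega> \<bullet> (t + x))) * g (t + x)" for t
  proof -
    have "- 2 * pi * (\<omega> \<bullet> x) + 2 * pi * (- \<omega> \<bullet> t) = - 2 * pi * (\<omega> \<bullet> (t + x))"
      by (simp add: inner_add_right algebra_simps)
    then show ?thesis by (simp only: mult.assoc[symmetric] cis_mult diff_minus_eq_add)
  qed
  then show ?thesis
    using sq_integrable_tf_shift[OF g, of "- \<omega>" "- x"]
    by (simp only: tf_adj_def fst_conv snd_conv tf_shift_abs_L2[OF g] scaleC_abs_L2)
qed

lemma cinner_tf_shift: "cinner (tf_shift z \<phi>) \<psi> = cinner \<phi> (tf_adj z \<psi>)"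
proof -
  obtain g h x \<omega> where g: "sq_integrable g" "\<phi> = abs_L2 g" and h: "sq_integrable h" "\<psi> = abs_L2 h"
    and z: "z = (x, \<omega>)"
    by (metis L2_cases surj_pair)
  have [measurable]: "g \<in> borel_measurable borel" "h \<in> borel_measurable borel"
    using g h by (simp_all add: sq_integrable_measurable)
  have h': "sq_integrable (\<lambda>t. cis (- 2 * pi * (\<omega> \<bullet> (t + x))) * h (t + x))"
    using sq_integrable_shift[OF h(1), of "-x"] by (intro sq_integrable_modulate) auto
  have "cinner (tf_shift z \<phi>) \<psi> = (\<integral>t. cis (2 * pi * (\<omega> \<bullet> t)) * g (t - x) * cnj (h t) \<partial>lborel)"
    using g h z by (simp add: tf_shift_abs_L2 cinner_abs_L2 sq_integrable_tf_shift)
  also have "\<dots> = (\<integral>t. cis (2 * pi * (\<omega> \<bullet> (t + x))) * g t * cnj (h (t + x)) \<partial>lborel)"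
    using integral_affine[of 1 "\<lambda>t. cis (2 * pi * (\<omega> \<bullet> t)) * g (t - x) * cnj (h t)" x]
    by (simp add: add.commute)
  also have "\<dots> = cinner \<phi> (tf_adj z \<psi>)"
    using g h h' z
    by (simp add: tf_adj_abs_L2 cinner_abs_L2 cis_cnj mult_ac)
  finally show ?thesis .
qed

lemma tf_adj_tf_shift [simp]: "tf_adj z (tf_shift z \<phi>) = \<phi>"
  by (cases \<phi>; cases z)
    (simp add: tf_shift_abs_L2 tf_adj_abs_L2 sq_integrable_tf_shift cis_mult mult.assoc[symmetric])

text \<open>The definite description in the adjoint picks out \<open>tf_adj z\<close>, because an adjoint is determined by
  its inner products.\<close>

lemma cadjoint_tf_shift: "cadjoint (tf_shift z) = tf_adj z"
  unfolding cadjoint_def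
proof (rule the_equality)
  fix T' assume T': "\<forall>\<phi> \<psi>. cinner (tf_shift z \<phi>) \<psi> = cinner \<phi> (T' \<psi>)"
  show "T' = tf_adj z"
  proof
    fix \<psi>
    show "T' \<psi> = tf_adj z \<psi>"
      by (rule L2_eqI, subst (1 2) cinner_commute) (simp flip: cinner_tf_shift add: T')
  qed
qed (simp add: cinner_tf_shift)

lemma cinner_tf_shift_both [simp]: "cinner (tf_shift z \<phi>) (tf_shift z \<psi>) = cinner \<phi> \<psi>"
  by (simp add: cinner_tf_shift)

lemma norm_eqI_cinner: "cinner \<phi> \<phi> = cinner \<psi> \<psi> \<Longrightarrow> norm \<phi> = norm \<psi>"
  by (simp only: cinner_self_norm of_real_eq_iff) (simp add: power2_eq_iff_nonneg)

lemma norm_tf_shift [simp]: "norm (tf_shift z \<phi>) = norm \<phi>"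
  by (rule norm_eqI_cinner) simp

lemma norm_tf_adj [simp]: "norm (tf_adj z \<phi>) = norm \<phi>"
  by (simp add: tf_adj_def norm_scaleC)

lemma tf_shift_add: "tf_shift z (\<phi> + \<psi>) = tf_shift z \<phi> + tf_shift z \<psi>"
  by (rule L2_eqI) (simp add: cinner_tf_shift cinner_add_left)

lemma tf_shift_diff: "tf_shift z (\<phi> - \<psi>) = tf_shift z \<phi> - tf_shift z \<psi>"
  by (rule L2_eqI) (simp add: cinner_tf_shift cinner_diff_left)

lemma tf_shift_scaleC: "tf_shift z (scaleC_L2 c \<phi>) = scaleC_L2 c (tf_shift z \<phi>)"
  by (rule L2_eqI) (simp add: cinner_tf_shift cinner_scaleC_left)

lemma tf_adj_add: "tf_adj z (\<phi> + \<psi>) = tf_adj z \<phi> + tf_adj z \<psi>"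
  by (simp add: tf_adj_def tf_shift_add bounded_bilinear.add_right[OF bounded_bilinear_scaleC])

lemma uniform_approx_continuous:
  fixes F :: "'b::metric_space \<Rightarrow> 'c::metric_space"
  assumes "\<And>e. e > 0 \<Longrightarrow> \<exists>G. continuous_on UNIV G \<and> (\<forall>z. dist (F z) (G z) < e)"
  shows "continuous_on UNIV F"
  unfolding continuous_on_iff
proof (intro ballI allI impI)
  fix z :: 'b and e :: real
  assume "e > 0"
  then obtain G where G: "continuous_on UNIV G" "\<And>z. dist (F z) (G z) < e / 3"
    using assms[of "e / 3"] by auto
  obtain d where d: "d > 0" "\<And>w. dist w z < d \<Longrightarrow> dist (G w) (G z) < e / 3"
    using G(1) \<open>e > 0\<close> unfolding continuous_on_iff by (metis UNIV_I zero_less_divide_iff zero_less_numeral)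
  show "\<exists>d>0. \<forall>w\<in>UNIV. dist w z < d \<longrightarrow> dist (F w) (F z) < e"
  proof (intro exI[of _ d] conjI ballI impI d)
    fix w assume "dist w z < d"
    then show "dist (F w) (F z) < e"
      using d(2)[of w] G(2)[of w] G(2)[of z] dist_triangle[of "F w" "F z" "G w"]
        dist_triangle[of "G w" "F z" "G z"] dist_commute[of "F z" "G z"] by linarith
  qed
qed

text \<open>For a continuous function of bounded support the shifted functions converge pointwise, and along a
  convergent sequence of shifts they share a bounded support, so dominated convergence applies.\<close>

lemma continuous_on_tf_shift_bumps:
  assumes g: "g \<in> bumps"
  shows "continuous_on UNIV (\<lambda>z. tf_shift z (abs_L2 g))"
  unfolding continuous_on_sequentially
proof (intro ballI allI impI, elim conjE)
  fix u :: "nat \<Rightarrow> 'a \<times> 'a" and z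
  assume lim: "u \<longlonglongrightarrow> z"
  have sqg: "sq_integrable g" using bumps_Lp[OF g, of 2] by (simp add: sq_integrable_iff_Lp)
  let ?s = "\<lambda>z t. cis (2 * pi * (snd z \<bullet> t)) * g (t - fst z)"
  have tf: "tf_shift z (abs_L2 g) = abs_L2 (?s z)" for z
    by (cases z) (simp add: tf_shift_abs_L2 sqg)
  obtain M R where MR: "M > 0" "R > 0" "\<And>t. cmod (g t) \<le> M * indicator (ball 0 R) t"
    using bumps_bound[OF g] by blast
  have "bounded (range u)" using lim by (rule convergent_imp_bounded)
  then obtain B where B: "\<And>n. norm (u n) \<le> B" by (auto simp: bounded_iff)
  let ?w = "\<lambda>t. of_real M * (indicator (ball 0 (R + B)) t :: complex)"
  have sm: "?s z \<in> borel_measurable borel" for z :: "'a \<times> 'a"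
    by (intro sq_integrable_measurable sq_integrable_tf_shift sqg)
  have lims: "(\<lambda>n. ?s (u n) t) \<longlonglongrightarrow> ?s z t" for t
    by (intro tendsto_intros tendsto_compose[OF _ tendsto_cis] lim
        continuous_on_tendsto_compose[OF bumps_continuous[OF g, of UNIV]]) auto
  have w: "Lp 2 ?w"
    by (intro Lp_cmult Lp_indicator_bounded) auto
  have dom: "cmod (?s (u n) t) \<le> cmod (?w t)" for n t
  proof -
    have "indicator (ball 0 R) (t - fst (u n)) \<le> (indicator (ball 0 (R + B)) t :: real)"
    proof -
      have "norm t \<le> norm (t - fst (u n)) + norm (fst (u n))"
        using norm_triangle_ineq[of "t - fst (u n)" "fst (u n)"] by simp
      also have "norm (fst (u n)) \<le> B" using norm_fst_le[of "fst (u n)" "snd (u n)"] B[of n] by simp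
      finally show ?thesis by (auto simp: indicator_def)
    qed
    then have "M * indicator (ball 0 R) (t - fst (u n)) \<le> M * indicator (ball 0 (R + B)) t"
      using MR(1) by (intro mult_left_mono) auto
    moreover have "cmod (?w t) = M * indicator (ball 0 (R + B)) t"
      using MR(1) by (simp add: norm_mult indicator_def)
    ultimately show ?thesis
      using MR(3)[of "t - fst (u n)"] by (simp add: norm_mult)
  qed
  note dct = Lp_dominated_convergence[OF sm sm lims w dom zero_less_numeral]
  show "((\<lambda>z. tf_shift z (abs_L2 g)) \<circ> u) \<longlonglongrightarrow> tf_shift z (abs_L2 g)"
    unfolding o_def tf by (rule L2_Lp_limit[OF dct])
qed

text \<open>Time-frequency shifts are isometries, so strong continuity spreads from a dense set to all of \<open>L\<^sup>2\<close>.\<close>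

lemma continuous_on_tf_shift: "continuous_on UNIV (\<lambda>z. tf_shift z \<phi>)"
proof (rule uniform_approx_continuous)
  fix e :: real assume "e > 0"
  then obtain g where g: "g \<in> bumps" "norm (\<phi> - abs_L2 g) < e" by (rule L2_bump_approx)
  show "\<exists>G. continuous_on UNIV G \<and> (\<forall>z. dist (tf_shift z \<phi>) (G z) < e)"
    using g by (intro exI[of _ "\<lambda>z. tf_shift z (abs_L2 g)"] conjI continuous_on_tf_shift_bumps)
      (simp_all add: dist_norm flip: tf_shift_diff)
qed

lemma tendsto_tf_shift:
  assumes "(u \<longlongrightarrow> z) F" shows "((\<lambda>n. tf_shift (u n) \<phi>) \<longlongrightarrow> tf_shift z \<phi>) F"
  by (rule continuous_on_tendsto_compose[OF continuous_on_tf_shift assms]) auto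

lemma continuous_on_tf_adj: "continuous_on UNIV (\<lambda>z. tf_adj z \<phi>)"
proof -
  have "continuous_on UNIV (\<lambda>z :: 'a \<times> 'a. tf_shift (- fst z, - snd z) \<phi>)"
    by (rule continuous_on_compose2[OF continuous_on_tf_shift]) (auto intro!: continuous_intros)
  then show ?thesis
    unfolding tf_adj_def
    by (intro bounded_bilinear.continuous_on[OF bounded_bilinear_scaleC] continuous_intros)
qed

lemma tf_shift_zero [simp]: "tf_shift (0, 0) \<phi> = \<phi>"
  by (cases \<phi>) (simp add: tf_shift_abs_L2)

text \<open>The shortest vector along which \<open>e^(-2 \<pi> i t \<cdot> \<omega>)\<close> changes its sign.\<close>

lemma half_period_shift:
  fixes \<omega> :: "'a::euclidean_space"
  defines "h \<equiv> (1 / (2 * (norm \<omega>)\<^sup>2)) *\<^sub>R \<omega>"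
  assumes "\<omega> \<noteq> 0" shows "\<omega> \<bullet> h = 1 / 2"
  using assms by (simp add: power2_norm_eq_inner)

lemma tendsto_half_period_shift:
  "((\<lambda>\<omega> :: 'a::euclidean_space. (1 / (2 * (norm \<omega>)\<^sup>2)) *\<^sub>R \<omega>) \<longlongrightarrow> 0) at_infinity"
proof (rule tendsto_norm_zero_cancel)
  have "((\<lambda>\<omega> :: 'a. inverse (norm \<omega>)) \<longlongrightarrow> 0) at_infinity"
    by (rule tendsto_inverse_0_at_top[OF filterlim_norm_at_top])
  then have "((\<lambda>\<omega> :: 'a. 1 / 2 * inverse (norm \<omega>)) \<longlongrightarrow> 0) at_infinity"
    by (rule tendsto_mult_right_zero)
  then show "((\<lambda>\<omega> :: 'a. norm ((1 / (2 * (norm \<omega>)\<^sup>2)) *\<^sub>R \<omega>)) \<longlongrightarrow> 0) at_infinity"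
    by (rule Lim_transform_eventually)
      (auto intro!: always_eventually simp: power2_eq_square field_simps)
qed

text \<open>The Riemann--Lebesgue lemma for \<open>\<phi> cnj \<psi>\<close>. Translating both functions by half a period anticommutes with
  the modulation, so twice the inner product is a sum of terms that contain \<open>\<phi> - T \<phi>\<close> or \<open>\<psi> - T \<psi>\<close>, where
  the translation \<open>T\<close> tends to the identity as the frequency grows.\<close>

lemma modulation_tendsto_0:
  fixes \<phi> \<psi> :: "'a::euclidean_space L2"
  shows "((\<lambda>\<omega>. cinner (tf_shift (0, \<omega>) \<phi>) \<psi>) \<longlongrightarrow> 0) at_infinity"
proof -
  define h where "h \<omega> = (1 / (2 * (norm \<omega>)\<^sup>2)) *\<^sub>R \<omega>" for \<omega> :: 'a
  let ?T = "\<lambda>\<omega> \<phi>. tf_shift (h \<omega>, 0) \<phi>"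
  have T: "((\<lambda>\<omega>. ?T \<omega> \<phi>) \<longlongrightarrow> \<phi>) at_infinity" for \<phi> :: "'a L2"
    using tendsto_tf_shift[OF tendsto_Pair[OF tendsto_half_period_shift tendsto_const], of 0 \<phi>]
    by (simp add: h_def)
  have comm: "?T \<omega> (tf_shift (0, \<omega>) \<phi>) = scaleC_L2 (-1) (tf_shift (0, \<omega>) (?T \<omega> \<phi>))"
    if "\<omega> \<noteq> 0" for \<omega>
  proof (cases \<phi>)
    case (1 g)
    have "cis (2 * pi * (\<omega> \<bullet> (t - h \<omega>))) = - cis (2 * pi * (\<omega> \<bullet> t))" for t
    proof -
      have "\<omega> \<bullet> h \<omega> = 1 / 2" using half_period_shift[OF that] by (simp add: h_def)
      then have "2 * pi * (\<omega> \<bullet> (t - h \<omega>)) = 2 * pi * (\<omega> \<bullet> t) - pi"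
        by (simp add: inner_diff_right right_diff_distrib)
      then show ?thesis by (simp only: cis_divide[symmetric]) simp
    qed
    then show ?thesis
      using 1 sq_integrable_tf_shift[OF 1(1), of 0 "h \<omega>"] sq_integrable_tf_shift[OF 1(1), of \<omega> 0]
        sq_integrable_tf_shift[OF sq_integrable_shift[OF 1(1), of "h \<omega>"], of \<omega> 0]
      by (simp add: tf_shift_abs_L2 scaleC_abs_L2)
  qed
  have bound: "cmod (cinner (tf_shift (0, \<omega>) \<phi>) \<psi>) \<le>
      norm (\<phi> - ?T \<omega> \<phi>) * norm \<psi> + norm \<phi> * norm (\<psi> - ?T \<omega> \<psi>)" if "\<omega> \<noteq> 0" for \<omega>
  proof -
    let ?M = "tf_shift (0, \<omega>) :: 'a L2 \<Rightarrow> 'a L2"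
    have "cinner (?M \<phi>) \<psi> = cinner (?T \<omega> (?M \<phi>)) (?T \<omega> \<psi>)" by simp
    also have "\<dots> = - cinner (?M (?T \<omega> \<phi>)) (?T \<omega> \<psi>)"
      by (simp add: comm[OF that] cinner_scaleC_left)
    finally have "2 * cinner (?M \<phi>) \<psi> = cinner (?M (\<phi> - ?T \<omega> \<phi>)) \<psi> + cinner (?M (?T \<omega> \<phi>)) (\<psi> - ?T \<omega> \<psi>)"
      by (simp add: tf_shift_diff cinner_diff_left cinner_diff_right)
    then have "2 * cmod (cinner (?M \<phi>) \<psi>) =
        cmod (cinner (?M (\<phi> - ?T \<omega> \<phi>)) \<psi> + cinner (?M (?T \<omega> \<phi>)) (\<psi> - ?T \<omega> \<psi>))"
      by (metis norm_mult norm_numeral)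
    also have "\<dots> \<le> norm (\<phi> - ?T \<omega> \<phi>) * norm \<psi> + norm \<phi> * norm (\<psi> - ?T \<omega> \<psi>)"
      using cinner_bound[of "?M (\<phi> - ?T \<omega> \<phi>)" \<psi>] cinner_bound[of "?M (?T \<omega> \<phi>)" "\<psi> - ?T \<omega> \<psi>"]
      by (intro order_trans[OF norm_triangle_ineq]) simp
    finally show ?thesis by (smt (verit) norm_ge_zero)
  qed
  have "((\<lambda>\<omega>. norm (\<phi> - ?T \<omega> \<phi>) * norm \<psi> + norm \<phi> * norm (\<psi> - ?T \<omega> \<psi>)) \<longlongrightarrow>
      norm (\<phi> - \<phi>) * norm \<psi> + norm \<phi> * norm (\<psi> - \<psi>)) at_infinity"
    by (intro tendsto_intros T)
  then have "((\<lambda>\<omega>. norm (\<phi> - ?T \<omega> \<phi>) * norm \<psi> + norm \<phi> * norm (\<psi> - ?T \<omega> \<psi>)) \<longlongrightarrow> 0) at_infinity"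
    by simp
  moreover have "\<forall>\<^sub>F \<omega> in at_infinity. cmod (cinner (tf_shift (0, \<omega>) \<phi>) \<psi>) \<le>
      norm (\<phi> - ?T \<omega> \<phi>) * norm \<psi> + norm \<phi> * norm (\<psi> - ?T \<omega> \<psi>)"
    unfolding eventually_at_infinity
  proof (intro exI[of _ 1] allI impI)
    fix \<omega> :: 'a assume "1 \<le> norm \<omega>"
    then have "\<omega> \<noteq> 0" by auto
    then show "cmod (cinner (tf_shift (0, \<omega>) \<phi>) \<psi>) \<le>
        norm (\<phi> - ?T \<omega> \<phi>) * norm \<psi> + norm \<phi> * norm (\<psi> - ?T \<omega> \<psi>)"
      by (rule bound)
  qed
  ultimately show ?thesis by (rule Lim_null_comparison[rotated])
qed

section \<open>The cross-Wigner distribution\<close>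

text \<open>The Cauchy--Schwarz inequality with the modulus inside the integral, obtained by replacing both functions by
  their moduli.\<close>

lemma L2_holder:
  assumes g: "sq_integrable g" and h: "sq_integrable h"
  shows "integrable lborel (\<lambda>t. cmod (g t) * cmod (h t))"
    and "(\<integral>t. cmod (g t) * cmod (h t) \<partial>lborel) \<le> norm (abs_L2 g) * norm (abs_L2 h)"
proof -
  let ?a = "\<lambda>g t. complex_of_real (cmod (g t))"
  have sq: "sq_integrable (?a k)" and nrm: "norm (abs_L2 (?a k)) = norm (abs_L2 k)"
    if k: "sq_integrable k" for k :: "'a \<Rightarrow> complex"
  proof -
    have [measurable]: "k \<in> borel_measurable borel" using k by (rule sq_integrable_measurable)
    show s: "sq_integrable (?a k)" using k by (simp add: sq_integrable_def)
    have "(norm (abs_L2 (?a k)))\<^sup>2 = (norm (abs_L2 k))\<^sup>2"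
      using norm_abs_L2[OF s] norm_abs_L2[OF k] by simp
    then show "norm (abs_L2 (?a k)) = norm (abs_L2 k)"
      by (simp add: power2_eq_iff_nonneg)
  qed
  have eq: "?a g t * cnj (?a h t) = complex_of_real (cmod (g t) * cmod (h t))" for t by simp
  have int: "integrable lborel (\<lambda>t. complex_of_real (cmod (g t) * cmod (h t)))"
    using integrable_mult_cnj[OF sq[OF g] sq[OF h]] by (simp only: eq)
  then show "integrable lborel (\<lambda>t. cmod (g t) * cmod (h t))"
    by (simp only: complex_of_real_integrable_eq)
  have "cinner (abs_L2 (?a g)) (abs_L2 (?a h)) = complex_of_real (\<integral>t. cmod (g t) * cmod (h t) \<partial>lborel)"
    by (subst cinner_abs_L2[OF sq[OF g] sq[OF h]]) (simp only: eq integral_complex_of_real)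
  then have "\<bar>\<integral>t. cmod (g t) * cmod (h t) \<partial>lborel\<bar> \<le> norm (abs_L2 g) * norm (abs_L2 h)"
    using cinner_bound[of "abs_L2 (?a g)" "abs_L2 (?a h)"] by (simp only: nrm[OF g] nrm[OF h] norm_of_real)
  then show "(\<integral>t. cmod (g t) * cmod (h t) \<partial>lborel) \<le> norm (abs_L2 g) * norm (abs_L2 h)"
    by linarith
qed

lemma norm_abs_L2_affine:
  fixes g :: "'a::euclidean_space \<Rightarrow> complex"
  assumes c: "c \<noteq> 0" and g: "sq_integrable g"
  shows "norm (abs_L2 (\<lambda>t. g (x + c *\<^sub>R t))) = norm (abs_L2 g) / sqrt (\<bar>c\<bar> ^ DIM('a))"
proof -
  have [measurable]: "g \<in> borel_measurable borel" using g by (rule sq_integrable_measurable)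
  have "(norm (abs_L2 (\<lambda>t. g (x + c *\<^sub>R t))))\<^sup>2 = (norm (abs_L2 g))\<^sup>2 / \<bar>c\<bar> ^ DIM('a)"
    using norm_abs_L2[OF sq_integrable_affine[OF c g, of x]] norm_abs_L2[OF g]
      integral_affine[OF c, of "\<lambda>t. (cmod (g t))\<^sup>2" x] by simp
  also have "\<dots> = (norm (abs_L2 g) / sqrt (\<bar>c\<bar> ^ DIM('a)))\<^sup>2"
    by (simp add: power_divide)
  finally show ?thesis by (simp add: power2_eq_iff_nonneg)
qed

text \<open>The constant in the Cauchy--Schwarz bound for the cross-Wigner distribution; the two factors come from the
  dilations by \<open>s\<close> and \<open>1 - s\<close>.\<close>

definition wig_const :: "'a::euclidean_space itself \<Rightarrow> real \<Rightarrow> real" where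
  "wig_const _ s = 1 / (sqrt (s ^ DIM('a)) * sqrt ((1 - s) ^ DIM('a)))"

lemma wig_const_pos: "0 < s \<Longrightarrow> s < 1 \<Longrightarrow> wig_const TYPE('a::euclidean_space) s > 0"
  by (simp add: wig_const_def)

lemma wig_integrand_bound:
  fixes g h :: "'a::euclidean_space \<Rightarrow> complex"
  assumes s: "0 < s" "s < 1" and g: "sq_integrable g" and h: "sq_integrable h"
  shows "integrable lborel (\<lambda>t. cmod (g (x + s *\<^sub>R t)) * cmod (h (x - (1 - s) *\<^sub>R t)))"
    and "(\<integral>t. cmod (g (x + s *\<^sub>R t)) * cmod (h (x - (1 - s) *\<^sub>R t)) \<partial>lborel)
      \<le> wig_const TYPE('a) s * norm (abs_L2 g) * norm (abs_L2 h)"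
proof -
  have c: "s \<noteq> 0" "- (1 - s) \<noteq> 0" using s by auto
  note g' = sq_integrable_affine[OF c(1) g, of x] and h' = sq_integrable_affine[OF c(2) h, of x]
  have eq: "x + - (1 - s) *\<^sub>R t = x - (1 - s) *\<^sub>R t" for t
    by (simp only: scaleR_minus_left add_uminus_conv_diff)
  show "integrable lborel (\<lambda>t. cmod (g (x + s *\<^sub>R t)) * cmod (h (x - (1 - s) *\<^sub>R t)))"
    using L2_holder(1)[OF g' h'] by (simp only: eq)
  have "norm (abs_L2 (\<lambda>t. g (x + s *\<^sub>R t))) * norm (abs_L2 (\<lambda>t. h (x + - (1 - s) *\<^sub>R t)))
      = wig_const TYPE('a) s * norm (abs_L2 g) * norm (abs_L2 h)"
    using s by (simp only: norm_abs_L2_affine[OF c(1) g] norm_abs_L2_affine[OF c(2) h])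
      (simp add: wig_const_def)
  then show "(\<integral>t. cmod (g (x + s *\<^sub>R t)) * cmod (h (x - (1 - s) *\<^sub>R t)) \<partial>lborel)
      \<le> wig_const TYPE('a) s * norm (abs_L2 g) * norm (abs_L2 h)"
    using L2_holder(2)[OF g' h'] by (simp only: eq)
qed

text \<open>The cross-Wigner distribution, introduced through the shifted operator; \<open>cwig_abs_L2\<close> below is its
  integral formula.\<close>

definition cwig :: "real \<Rightarrow> 'a::euclidean_space L2 \<Rightarrow> 'a L2 \<Rightarrow> 'a \<times> 'a \<Rightarrow> complex" where
  "cwig s \<phi> \<psi> z = cinner (op_shift z (S_op s) \<phi>) \<psi>"

lemma cwig_eq_cinner: "cwig s \<phi> \<psi> z = cinner (S_op s (tf_adj z \<phi>)) (tf_adj z \<psi>)"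
  by (simp add: cwig_def op_shift_def cadjoint_tf_shift cinner_tf_shift)

text \<open>Both sides come from the substitution \<open>t \<mapsto> x - (1 - s) t\<close>. The Jacobian \<open>(1 - s)\<^sup>d\<close> is exactly
  the normalization of \<open>S\<^sub>s\<close>, the dilation \<open>s / (s - 1)\<close> turns \<open>-(1 - s) t\<close> into \<open>s t\<close>, and of the two phases
  only the difference \<open>-t\<close> of their arguments survives.\<close>

lemma cwig_abs_L2:
  fixes g h :: "'a::euclidean_space \<Rightarrow> complex"
  assumes s: "0 < s" "s < 1" and g: "sq_integrable g" and h: "sq_integrable h"
  shows "cwig s (abs_L2 g) (abs_L2 h) (x, \<omega>) =
    (\<integral>t. cis (- 2 * pi * (t \<bullet> \<omega>)) * (g (x + s *\<^sub>R t) * cnj (h (x - (1 - s) *\<^sub>R t))) \<partial>lborel)"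
proof -
  define c where "c = s / (s - 1)"
  have c: "c \<noteq> 0" "- (1 - s) \<noteq> 0" using s by (auto simp: c_def)
  have [measurable]: "g \<in> borel_measurable borel" "h \<in> borel_measurable borel"
    using g h by (simp_all add: sq_integrable_measurable)
  define g1 where "g1 t = cis (- 2 * pi * (\<omega> \<bullet> (t + x))) * g (t + x)" for t
  have g1: "sq_integrable g1"
    unfolding g1_def using sq_integrable_shift[OF g, of "-x"] by (intro sq_integrable_modulate) auto
  have [measurable]: "g1 \<in> borel_measurable borel" using g1 by (rule sq_integrable_measurable)
  define k where "k = complex_of_real (1 / (1 - s) ^ DIM('a))"
  have g2: "sq_integrable (\<lambda>t. k * g1 (c *\<^sub>R t))"
    using sq_integrable_affine[OF c(1) g1, of 0] by (intro sq_integrable_cmult) simp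
  define H where "H t = cis (2 * pi * (\<omega> \<bullet> t)) * g1 (c *\<^sub>R (t - x)) * cnj (h t)" for t
  have [measurable]: "H \<in> borel_measurable borel" unfolding H_def by measurable
  have "cwig s (abs_L2 g) (abs_L2 h) (x, \<omega>) =
      cinner (tf_shift (x, \<omega>) (abs_L2 (\<lambda>t. k * g1 (c *\<^sub>R t)))) (abs_L2 h)"
  proof -
    have "tf_adj (x, \<omega>) (abs_L2 g) = abs_L2 g1"
      unfolding g1_def by (rule tf_adj_abs_L2[OF g])
    moreover have "S_op s (abs_L2 g1) = abs_L2 (\<lambda>t. k * g1 (c *\<^sub>R t))"
      unfolding k_def c_def by (rule S_op_abs_L2[OF s g1])
    ultimately show ?thesis by (simp add: cwig_def op_shift_def cadjoint_tf_shift)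
  qed
  also have "\<dots> = (\<integral>t. k * H t \<partial>lborel)"
    using sq_integrable_tf_shift[OF g2, of \<omega> x]
    by (simp add: tf_shift_abs_L2 g2 cinner_abs_L2 h H_def mult_ac)
  also have "\<dots> = k * (\<integral>t. H t \<partial>lborel)" by simp
  also have "\<dots> = (\<integral>t. H (x + (- (1 - s)) *\<^sub>R t) \<partial>lborel)"
    using s by (subst integral_affine[OF c(2)]) (simp_all add: k_def scaleR_conv_of_real)
  also have "\<dots> = (\<integral>t. cis (- 2 * pi * (t \<bullet> \<omega>)) * (g (x + s *\<^sub>R t) * cnj (h (x - (1 - s) *\<^sub>R t))) \<partial>lborel)"
  proof (intro Bochner_Integration.integral_cong refl)
    fix t
    have "c * - (1 - s) = s" using s by (simp add: c_def field_simps)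
    then have arg: "c *\<^sub>R (x + (- (1 - s)) *\<^sub>R t - x) = s *\<^sub>R t"
      by (simp only: add_diff_cancel_left' scaleR_scaleR)
    have "cis (2 * pi * (\<omega> \<bullet> (x + (- (1 - s)) *\<^sub>R t))) * cis (- 2 * pi * (\<omega> \<bullet> (s *\<^sub>R t + x)))
        = cis (- 2 * pi * (t \<bullet> \<omega>))"
      unfolding cis_mult
      by (rule arg_cong[where f=cis]) (simp add: inner_add_right inner_diff_right inner_commute algebra_simps)
    moreover have "H (x + (- (1 - s)) *\<^sub>R t) =
        (cis (2 * pi * (\<omega> \<bullet> (x + (- (1 - s)) *\<^sub>R t))) * cis (- 2 * pi * (\<omega> \<bullet> (s *\<^sub>R t + x)))) *
        (g (s *\<^sub>R t + x) * cnj (h (x + (- (1 - s)) *\<^sub>R t)))"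
      unfolding H_def arg g1_def by (simp only: mult.assoc)
    ultimately show "H (x + (- (1 - s)) *\<^sub>R t) =
        cis (- 2 * pi * (t \<bullet> \<omega>)) * (g (x + s *\<^sub>R t) * cnj (h (x - (1 - s) *\<^sub>R t)))"
      by (simp only: add.commute[of _ x] scaleR_minus_left add_uminus_conv_diff)
  qed
  finally show ?thesis .
qed

lemma wigner_eq_Q_distr:
  fixes \<psi> :: "'a::euclidean_space L2"
  assumes "0 < s" "s < 1"
  shows "wigner s \<psi> = Q_distr (S_op s) \<psi>"
proof
  fix z :: "'a \<times> 'a"
  obtain x \<omega> where z: "z = (x, \<omega>)" by force
  obtain g where "sq_integrable g" "\<psi> = abs_L2 g" by (rule L2_cases)
  then show "wigner s \<psi> z = Q_distr (S_op s) \<psi> z"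
    using assms cwig_abs_L2[of s g g x \<omega>]
    by (simp add: z wigner_abs_L2 Q_distr_def cwig_def mult.assoc)
qed

text \<open>Conjugation is the reflection \<open>t \<mapsto> -t\<close> in the integral formula. In terms of operators: the adjoint of
  \<open>S\<^sub>s\<close> is \<open>S\<^sub>1\<^sub>-\<^sub>s\<close>.\<close>

lemma cnj_cwig:
  fixes \<phi> \<psi> :: "'a::euclidean_space L2"
  assumes s: "0 < s" "s < 1"
  shows "cnj (cwig s \<phi> \<psi> z) = cwig (1 - s) \<psi> \<phi> z"
proof -
  obtain g h x \<omega> where g: "sq_integrable g" "\<phi> = abs_L2 g" and h: "sq_integrable h" "\<psi> = abs_L2 h"
    and z: "z = (x, \<omega>)"
    by (metis L2_cases surj_pair)
  have [measurable]: "g \<in> borel_measurable borel" "h \<in> borel_measurable borel"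
    using g h by (simp_all add: sq_integrable_measurable)
  let ?H = "\<lambda>t. cis (- 2 * pi * (t \<bullet> \<omega>)) * (h (x + (1 - s) *\<^sub>R t) * cnj (g (x - s *\<^sub>R t)))"
  have "cwig (1 - s) \<psi> \<phi> z = (\<integral>t. ?H t \<partial>lborel)"
    using s g h z cwig_abs_L2[of "1 - s" h g x \<omega>] by simp
  also have "\<dots> = (\<integral>t. ?H (0 + (-1) *\<^sub>R t) \<partial>lborel)"
    by (subst integral_affine) simp_all
  also have "\<dots> = (\<integral>t. cnj (cis (- 2 * pi * (t \<bullet> \<omega>)) * (g (x + s *\<^sub>R t) * cnj (h (x - (1 - s) *\<^sub>R t)))) \<partial>lborel)"
    by (simp add: cis_cnj mult_ac)
  also have "\<dots> = cnj (cwig s \<phi> \<psi> z)"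
    using s g h z by (simp only: cwig_abs_L2 Bochner_Integration.integral_cnj)
  finally show ?thesis ..
qed

lemma cwig_bound:
  fixes \<phi> \<psi> :: "'a::euclidean_space L2"
  assumes s: "0 < s" "s < 1"
  shows "cmod (cwig s \<phi> \<psi> z) \<le> wig_const TYPE('a) s * norm \<phi> * norm \<psi>"
proof -
  obtain g h x \<omega> where g: "sq_integrable g" "\<phi> = abs_L2 g" and h: "sq_integrable h" "\<psi> = abs_L2 h"
    and z: "z = (x, \<omega>)"
    by (metis L2_cases surj_pair)
  have "cmod (cwig s \<phi> \<psi> z) \<le>
      (\<integral>t. cmod (cis (- 2 * pi * (t \<bullet> \<omega>)) * (g (x + s *\<^sub>R t) * cnj (h (x - (1 - s) *\<^sub>R t)))) \<partial>lborel)"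
    using s g h z by (simp only: cwig_abs_L2 integral_norm_bound)
  also have "\<dots> = (\<integral>t. cmod (g (x + s *\<^sub>R t)) * cmod (h (x - (1 - s) *\<^sub>R t)) \<partial>lborel)"
    by (simp add: norm_mult)
  also have "\<dots> \<le> wig_const TYPE('a) s * norm \<phi> * norm \<psi>"
    unfolding g(2) h(2) by (rule wig_integrand_bound(2)[OF s g(1) h(1)])
  finally show ?thesis .
qed

lemma S_op_add:
  fixes \<phi> \<psi> :: "'a::euclidean_space L2"
  assumes s: "0 < s" "s < 1" shows "S_op s (\<phi> + \<psi>) = S_op s \<phi> + S_op s \<psi>"
proof -
  obtain g h where g: "sq_integrable g" "\<phi> = abs_L2 g" and h: "sq_integrable h" "\<psi> = abs_L2 h"
    by (metis L2_cases)
  have c: "s / (s - 1) \<noteq> 0" using s by simp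
  have "sq_integrable (\<lambda>t. complex_of_real (1 / (1 - s) ^ DIM('a)) * k ((s / (s - 1)) *\<^sub>R t))"
    if "sq_integrable k" for k :: "'a \<Rightarrow> complex"
    using sq_integrable_affine[OF c that, of 0] by (intro sq_integrable_cmult) simp
  from this[OF g(1)] this[OF h(1)] show ?thesis
    using g h s by (simp add: plus_abs_L2 S_op_abs_L2 sq_integrable_add distrib_left)
qed

lemma S_op_scaleC:
  fixes \<phi> :: "'a::euclidean_space L2"
  assumes s: "0 < s" "s < 1" shows "S_op s (scaleC_L2 c \<phi>) = scaleC_L2 c (S_op s \<phi>)"
proof -
  obtain g where g: "sq_integrable g" "\<phi> = abs_L2 g" by (metis L2_cases)
  have c: "s / (s - 1) \<noteq> 0" using s by simp
  have "sq_integrable (\<lambda>t. complex_of_real (1 / (1 - s) ^ DIM('a)) * g ((s / (s - 1)) *\<^sub>R t))"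
    using sq_integrable_affine[OF c g(1), of 0] by (intro sq_integrable_cmult) simp
  then show ?thesis
    using g s by (simp add: scaleC_abs_L2 S_op_abs_L2 sq_integrable_cmult mult_ac)
qed

lemma bounded_linear_S_op:
  assumes s: "0 < s" "s < 1" shows "bounded_linear (S_op s :: 'a::euclidean_space L2 \<Rightarrow> 'a L2)"
proof (rule bounded_linear_intro)
  show "S_op s (\<phi> + \<psi>) = S_op s \<phi> + S_op s \<psi>" for \<phi> \<psi> :: "'a L2" by (rule S_op_add[OF s])
  show "S_op s (r *\<^sub>R \<phi>) = r *\<^sub>R S_op s \<phi>" for r and \<phi> :: "'a L2"
    by (simp add: scaleR_eq_scaleC_L2 S_op_scaleC[OF s])
  show "norm (S_op s \<phi>) \<le> norm \<phi> * wig_const TYPE('a) s" for \<phi> :: "'a L2"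
  proof (rule norm_le_cinner)
    show "cmod (cinner (S_op s \<phi>) \<psi>) \<le> norm \<phi> * wig_const TYPE('a) s * norm \<psi>" for \<psi>
      using cwig_bound[OF s, of \<phi> \<psi> "(0, 0)"] tf_adj_tf_shift[of "(0, 0)" \<phi>] tf_adj_tf_shift[of "(0, 0)" \<psi>]
      by (simp add: cwig_eq_cinner mult_ac)
  qed (use less_imp_le[OF wig_const_pos[OF s, where 'a='a]] in simp)
qed

lemma cwig_add_left:
  assumes s: "0 < s" "s < 1"
  shows "cwig s (\<phi> + \<phi>') \<psi> z = cwig s \<phi> \<psi> z + cwig s \<phi>' \<psi> z"
  by (simp add: cwig_eq_cinner tf_adj_add S_op_add[OF s] cinner_add_left)

lemma cwig_scaleC_left:
  assumes s: "0 < s" "s < 1"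
  shows "cwig s (scaleC_L2 c \<phi>) \<psi> z = c * cwig s \<phi> \<psi> z"
  by (simp add: cwig_eq_cinner tf_adj_def tf_shift_scaleC S_op_scaleC[OF s] cinner_scaleC_left
      cinner_scaleC_right)

lemma cwig_diff_left:
  assumes s: "0 < s" "s < 1"
  shows "cwig s (\<phi> - \<phi>') \<psi> z = cwig s \<phi> \<psi> z - cwig s \<phi>' \<psi> z"
  by (simp add: minus_L2_def uminus_eq_scaleC cwig_add_left[OF s] cwig_scaleC_left[OF s])

lemma cwig_diff_right: "cwig s \<phi> (\<psi> - \<psi>') z = cwig s \<phi> \<psi> z - cwig s \<phi> \<psi>' z"
  by (simp add: cwig_def cinner_diff_right)

lemma continuous_on_cwig:
  assumes s: "0 < s" "s < 1"
  shows "continuous_on UNIV (cwig s \<phi> \<psi>)"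
  unfolding cwig_eq_cinner[abs_def]
  by (intro continuous_on_cinner continuous_on_tf_adj
      bounded_linear.continuous_on[OF bounded_linear_S_op[OF s]])

lemma measurable_cwig:
  assumes s: "0 < s" "s < 1"
  shows "cwig s \<phi> \<psi> \<in> borel_measurable borel"
  by (intro borel_measurable_continuous_onI continuous_on_cwig[OF s])

text \<open>Substituting \<open>t + h\<close> for \<open>t\<close>, where \<open>h\<close> is half a period, moves \<open>\<phi>\<close> and \<open>\<psi>\<close> in opposite directions.\<close>

lemma cwig_half_period:
  fixes \<phi> \<psi> :: "'a::euclidean_space L2"
  assumes s: "0 < s" "s < 1" and h: "\<omega> \<bullet> h = 1 / 2"
  shows "cwig s (tf_shift (- s *\<^sub>R h, 0) \<phi>) (tf_shift ((1 - s) *\<^sub>R h, 0) \<psi>) (x, \<omega>) = - cwig s \<phi> \<psi> (x, \<omega>)"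
proof -
  obtain f g where f: "sq_integrable f" "\<phi> = abs_L2 f" and g: "sq_integrable g" "\<psi> = abs_L2 g"
    by (metis L2_cases)
  have [measurable]: "f \<in> borel_measurable borel" "g \<in> borel_measurable borel"
    using f g by (simp_all add: sq_integrable_measurable)
  let ?H = "\<lambda>t. cis (- 2 * pi * (t \<bullet> \<omega>)) * (f (x + s *\<^sub>R t) * cnj (g (x - (1 - s) *\<^sub>R t)))"
  have "cwig s \<phi> \<psi> (x, \<omega>) = (\<integral>t. ?H t \<partial>lborel)"
    using s f g by (simp add: cwig_abs_L2)
  also have "\<dots> = (\<integral>t. ?H (h + 1 *\<^sub>R t) \<partial>lborel)"
    by (subst integral_affine) simp_all
  also have "\<dots> = (\<integral>t. - (cis (- 2 * pi * (t \<bullet> \<omega>)) *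
      (f (x + s *\<^sub>R t + s *\<^sub>R h) * cnj (g (x - (1 - s) *\<^sub>R t - (1 - s) *\<^sub>R h)))) \<partial>lborel)"
  proof (intro Bochner_Integration.integral_cong refl)
    fix t
    have "- 2 * pi * ((h + 1 *\<^sub>R t) \<bullet> \<omega>) = - 2 * pi * (t \<bullet> \<omega>) - pi"
      using h by (simp add: inner_add_left inner_commute algebra_simps)
    then have "cis (- 2 * pi * ((h + 1 *\<^sub>R t) \<bullet> \<omega>)) = - cis (- 2 * pi * (t \<bullet> \<omega>))"
      by (simp only: cis_divide[symmetric]) simp
    then show "?H (h + 1 *\<^sub>R t) = - (cis (- 2 * pi * (t \<bullet> \<omega>)) *
      (f (x + s *\<^sub>R t + s *\<^sub>R h) * cnj (g (x - (1 - s) *\<^sub>R t - (1 - s) *\<^sub>R h))))"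
      by (simp add: algebra_simps)
  qed
  also have "\<dots> = - cwig s (tf_shift (- s *\<^sub>R h, 0) \<phi>) (tf_shift ((1 - s) *\<^sub>R h, 0) \<psi>) (x, \<omega>)"
    using s f g sq_integrable_shift[OF f(1), of "- s *\<^sub>R h"] sq_integrable_shift[OF g(1), of "(1 - s) *\<^sub>R h"]
    by (simp add: tf_shift_abs_L2 cwig_abs_L2)
  finally show ?thesis by simp
qed

text \<open>As in \<open>modulation_tendsto_0\<close>; the bound involves norms only, so that one radius serves all \<open>x\<close>.\<close>

lemma cwig_frequency_decay:
  fixes \<phi> \<psi> :: "'a::euclidean_space L2"
  assumes s: "0 < s" "s < 1" and e: "e > 0"
  shows "\<exists>R. \<forall>x \<omega>. norm \<omega> \<ge> R \<longrightarrow> cmod (cwig s \<phi> \<psi> (x, \<omega>)) < e"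
proof -
  define h where "h \<omega> = (1 / (2 * (norm \<omega>)\<^sup>2)) *\<^sub>R \<omega>" for \<omega> :: 'a
  let ?K = "wig_const TYPE('a) s"
  let ?\<phi> = "\<lambda>\<omega>. tf_shift (- s *\<^sub>R h \<omega>, 0) \<phi>" and ?\<psi> = "\<lambda>\<omega>. tf_shift ((1 - s) *\<^sub>R h \<omega>, 0) \<psi>"
  let ?U = "\<lambda>\<omega>. ?K * norm (\<phi> - ?\<phi> \<omega>) * norm \<psi> + ?K * norm \<phi> * norm (\<psi> - ?\<psi> \<omega>)"
  have h: "(h \<longlongrightarrow> 0) at_infinity"
    unfolding h_def[abs_def] by (rule tendsto_half_period_shift)
  have T: "((\<lambda>\<omega>. tf_shift (c *\<^sub>R h \<omega>, 0) \<xi>) \<longlongrightarrow> \<xi>) at_infinity" for c and \<xi> :: "'a L2"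
    using tendsto_tf_shift[OF tendsto_Pair[OF tendsto_scaleR[OF tendsto_const h] tendsto_const], of c 0 \<xi>]
    by simp
  have "(?U \<longlongrightarrow> ?K * norm (\<phi> - \<phi>) * norm \<psi> + ?K * norm \<phi> * norm (\<psi> - \<psi>)) at_infinity"
    by (intro tendsto_intros T)
  then have "(?U \<longlongrightarrow> 0) at_infinity" by simp
  then have "\<forall>\<^sub>F \<omega> in at_infinity. ?U \<omega> < e"
    using e by (rule order_tendstoD(2))
  then obtain R where R: "\<And>\<omega>. norm \<omega> \<ge> R \<Longrightarrow> ?U \<omega> < e"
    unfolding eventually_at_infinity by blast
  show ?thesis
  proof (intro exI[of _ "max R 1"] allI impI)
    fix x \<omega> :: 'a assume "norm \<omega> \<ge> max R 1"
    then have \<omega>: "norm \<omega> \<ge> R" "\<omega> \<noteq> 0" by auto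
    have "2 * cwig s \<phi> \<psi> (x, \<omega>) = cwig s \<phi> \<psi> (x, \<omega>) - cwig s (?\<phi> \<omega>) (?\<psi> \<omega>) (x, \<omega>)"
      unfolding cwig_half_period[OF s half_period_shift[OF \<omega>(2)], folded h_def] by simp
    also have "\<dots> = cwig s (\<phi> - ?\<phi> \<omega>) \<psi> (x, \<omega>) + cwig s (?\<phi> \<omega>) (\<psi> - ?\<psi> \<omega>) (x, \<omega>)"
      by (simp add: cwig_diff_left[OF s] cwig_diff_right)
    finally have "2 * cmod (cwig s \<phi> \<psi> (x, \<omega>)) =
        cmod (cwig s (\<phi> - ?\<phi> \<omega>) \<psi> (x, \<omega>) + cwig s (?\<phi> \<omega>) (\<psi> - ?\<psi> \<omega>) (x, \<omega>))"
      by (metis norm_mult norm_numeral)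
    also have "\<dots> \<le> ?U \<omega>"
      using cwig_bound[OF s, of "\<phi> - ?\<phi> \<omega>" \<psi> "(x, \<omega>)"] cwig_bound[OF s, of "?\<phi> \<omega>" "\<psi> - ?\<psi> \<omega>" "(x, \<omega>)"]
      by (intro order_trans[OF norm_triangle_ineq] add_mono) simp_all
    also have "\<dots> < e" using R[OF \<omega>(1)] .
    finally show "cmod (cwig s \<phi> \<psi> (x, \<omega>)) < e" using norm_ge_zero[of "cwig s \<phi> \<psi> (x, \<omega>)"] by linarith
  qed
qed

text \<open>Since \<open>x = (1 - s) (x + s t) + s (x - (1 - s) t)\<close>, the point \<open>x\<close> lies in any ball that contains both
  arguments.\<close>

lemma cwig_bumps_support:
  fixes f g :: "'a::euclidean_space \<Rightarrow> complex"
  assumes s: "0 < s" "s < 1" and f: "f \<in> bumps" and g: "g \<in> bumps"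
  obtains R where "\<And>x \<omega>. norm x > R \<Longrightarrow> cwig s (abs_L2 f) (abs_L2 g) (x, \<omega>) = 0"
proof -
  obtain R1 R2 where R: "R1 > 0" "R2 > 0" "\<And>t. norm t > R1 \<Longrightarrow> f t = 0" "\<And>t. norm t > R2 \<Longrightarrow> g t = 0"
    using bumps_support f g by metis
  have sq: "sq_integrable f" "sq_integrable g"
    using bumps_Lp[OF f, of 2] bumps_Lp[OF g, of 2] by (simp_all add: sq_integrable_iff_Lp)
  show thesis
  proof (rule that[of "max R1 R2"])
    fix x \<omega> :: 'a assume x: "norm x > max R1 R2"
    have "f (x + s *\<^sub>R t) * cnj (g (x - (1 - s) *\<^sub>R t)) = 0" for t
    proof (rule ccontr)
      assume "\<not> ?thesis"
      then have le: "norm (x + s *\<^sub>R t) \<le> max R1 R2" "norm (x - (1 - s) *\<^sub>R t) \<le> max R1 R2"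
        using R by (force simp: not_le[symmetric])+
      have "x = (1 - s) *\<^sub>R (x + s *\<^sub>R t) + s *\<^sub>R (x - (1 - s) *\<^sub>R t)"
        by (simp add: algebra_simps)
      then have "norm x \<le> norm ((1 - s) *\<^sub>R (x + s *\<^sub>R t)) + norm (s *\<^sub>R (x - (1 - s) *\<^sub>R t))"
        by (metis norm_triangle_ineq)
      also have "\<dots> = (1 - s) * norm (x + s *\<^sub>R t) + s * norm (x - (1 - s) *\<^sub>R t)"
        using s by simp
      also have "\<dots> \<le> (1 - s) * max R1 R2 + s * max R1 R2"
        using s le by (intro add_mono mult_left_mono) auto
      also have "\<dots> = max R1 R2" by (simp add: algebra_simps)
      finally show False using x by simp
    qed
    then show "cwig s (abs_L2 f) (abs_L2 g) (x, \<omega>) = 0"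
      by (simp only: cwig_abs_L2[OF s sq] mult_zero_right Bochner_Integration.integral_zero)
  qed
qed

lemma cwig_time_decay:
  fixes \<phi> \<psi> :: "'a::euclidean_space L2"
  assumes s: "0 < s" "s < 1" and e: "e > 0"
  shows "\<exists>R. \<forall>x \<omega>. norm x > R \<longrightarrow> cmod (cwig s \<phi> \<psi> (x, \<omega>)) < e"
proof -
  let ?K = "wig_const TYPE('a) s"
  have K: "?K > 0" by (rule wig_const_pos[OF s])
  have choose: "\<exists>g \<in> bumps. ?K * norm (\<xi> - abs_L2 g) * M < e / 2" if "M \<ge> 0" for M and \<xi> :: "'a L2"
  proof -
    have "e / (2 * ?K * (M + 1)) > 0" using K e that by simp
    then obtain g where g: "g \<in> bumps" "norm (\<xi> - abs_L2 g) < e / (2 * ?K * (M + 1))"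
      by (rule L2_bump_approx)
    have "?K * norm (\<xi> - abs_L2 g) * M \<le> ?K * norm (\<xi> - abs_L2 g) * (M + 1)"
      using K by (intro mult_left_mono) auto
    also have "\<dots> < e / 2"
      using g(2) K that by (simp add: pos_less_divide_eq mult_ac)
    finally show ?thesis using g(1) by blast
  qed
  obtain f where f: "f \<in> bumps" "?K * norm (\<phi> - abs_L2 f) * norm \<psi> < e / 2"
    using choose[of "norm \<psi>" \<phi>] by auto
  \<comment> \<open>the accuracy for \<open>\<psi>\<close> depends on the approximation chosen for \<open>\<phi>\<close>\<close>
  obtain g where g: "g \<in> bumps" "?K * norm (\<psi> - abs_L2 g) * norm (abs_L2 f) < e / 2"
    using choose[of "norm (abs_L2 f)" \<psi>] by auto
  obtain R where R: "\<And>x \<omega>. norm x > R \<Longrightarrow> cwig s (abs_L2 f) (abs_L2 g) (x, \<omega>) = 0"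
    using cwig_bumps_support[OF s f(1) g(1)] by blast
  show ?thesis
  proof (intro exI[of _ R] allI impI)
    fix x \<omega> :: 'a assume x: "norm x > R"
    have "cwig s \<phi> \<psi> (x, \<omega>) = cwig s (\<phi> - abs_L2 f) \<psi> (x, \<omega>) + cwig s (abs_L2 f) (\<psi> - abs_L2 g) (x, \<omega>)"
      using R[OF x] by (simp add: cwig_diff_left[OF s] cwig_diff_right)
    then have "cmod (cwig s \<phi> \<psi> (x, \<omega>)) \<le>
        cmod (cwig s (\<phi> - abs_L2 f) \<psi> (x, \<omega>)) + cmod (cwig s (abs_L2 f) (\<psi> - abs_L2 g) (x, \<omega>))"
      by (simp only: norm_triangle_ineq)
    also have "\<dots> < e"
      using cwig_bound[OF s, of "\<phi> - abs_L2 f" \<psi> "(x, \<omega>)"]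
        cwig_bound[OF s, of "abs_L2 f" "\<psi> - abs_L2 g" "(x, \<omega>)"] f(2) g(2)
      by (simp add: mult_ac)
    finally show "cmod (cwig s \<phi> \<psi> (x, \<omega>)) < e" .
  qed
qed

lemma cwig_C0:
  fixes \<phi> \<psi> :: "'a::euclidean_space L2"
  assumes s: "0 < s" "s < 1"
  shows "cwig s \<phi> \<psi> \<in> C0"
  unfolding C0_def
proof (intro CollectI conjI continuous_on_cwig[OF s] tendstoI)
  fix e :: real assume e: "e > 0"
  obtain R1 where R1: "\<And>x \<omega>. norm x > R1 \<Longrightarrow> cmod (cwig s \<phi> \<psi> (x, \<omega>)) < e"
    using cwig_time_decay[OF s e] by blast
  obtain R2 where R2: "\<And>x \<omega>. norm \<omega> \<ge> R2 \<Longrightarrow> cmod (cwig s \<phi> \<psi> (x, \<omega>)) < e"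
    using cwig_frequency_decay[OF s e] by blast
  show "\<forall>\<^sub>F z in at_infinity. dist (cwig s \<phi> \<psi> z) 0 < e"
    unfolding eventually_at_infinity
  proof (intro exI[of _ "R1 + R2"] allI impI)
    fix z :: "'a \<times> 'a" assume z: "R1 + R2 \<le> norm z"
    obtain x \<omega> where xw: "z = (x, \<omega>)" by force
    have "norm z \<le> norm x + norm \<omega>" unfolding xw by (rule norm_Pair_le)
    then have "norm x > R1 \<or> norm \<omega> \<ge> R2" using z by linarith
    then show "dist (cwig s \<phi> \<psi> z) 0 < e" using R1 R2 by (auto simp: xw)
  qed
qed

section \<open>Sesquilinear forms of compact operators\<close>

text \<open>The sesquilinear forms of compact operators. Representability is part of the notion, so that each closure
  property constructs the operator along with its compactness.\<close>

definition compact_form :: "('a::euclidean_space L2 \<Rightarrow> 'a L2 \<Rightarrow> complex) \<Rightarrow> bool" where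
  "compact_form b \<longleftrightarrow> (\<exists>B. compact_operator B \<and> (\<forall>\<phi> \<psi>. cinner (B \<phi>) \<psi> = b \<phi> \<psi>))"

lemma bounded_clinearI:
  assumes "\<And>\<phi> \<psi>. T (\<phi> + \<psi>) = T \<phi> + T \<psi>" "\<And>c \<phi>. T (scaleC_L2 c \<phi>) = scaleC_L2 c (T \<phi>)"
    "\<And>\<phi>. norm (T \<phi>) \<le> norm \<phi> * K"
  shows "bounded_clinear T"
  unfolding bounded_clinear_def
  using assms by (auto intro!: bounded_linear_intro[of T K] simp: scaleR_eq_scaleC_L2)

lemma
  assumes "bounded_clinear T"
  shows bounded_clinear_add: "T (\<phi> + \<psi>) = T \<phi> + T \<psi>"
    and bounded_clinear_scaleC: "T (scaleC_L2 c \<phi>) = scaleC_L2 c (T \<phi>)"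
    and bounded_clinear_bound: "\<exists>K\<ge>0. \<forall>\<phi>. norm (T \<phi>) \<le> norm \<phi> * K"
  using assms bounded_linear.nonneg_bounded[of T] linear_add[OF bounded_linear.linear, of T]
  by (auto simp: bounded_clinear_def)

lemma compact_closure_subset:
  fixes S K :: "'b::t2_space set"
  assumes "S \<subseteq> K" "compact K" shows "compact (closure S)"
proof -
  have "closure S \<subseteq> K" using assms by (intro closure_minimal compact_imp_closed)
  then have "closure S = K \<inter> closure S" by auto
  then show ?thesis using compact_Int_closed[OF assms(2) closed_closure] by metis
qed

lemma compact_form_rank_one:
  fixes p q :: "'a::euclidean_space L2"
  shows "compact_form (\<lambda>\<phi> \<psi>. cinner \<phi> p * cinner q \<psi>)"
  unfolding compact_form_def
proof (intro exI conjI allI)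
  let ?B = "\<lambda>\<phi>. scaleC_L2 (cinner \<phi> p) q"
  show "cinner (?B \<phi>) \<psi> = cinner \<phi> p * cinner q \<psi>" for \<phi> \<psi>
    by (rule cinner_scaleC_left)
  have "bounded_clinear ?B"
  proof (rule bounded_clinearI)
    show "norm (?B \<phi>) \<le> norm \<phi> * (norm p * norm q)" for \<phi>
      using mult_right_mono[OF cinner_bound[of \<phi> p], of "norm q"] by (simp add: norm_scaleC mult_ac)
    show "?B (\<phi> + \<psi>) = ?B \<phi> + ?B \<psi>" for \<phi> \<psi>
      by (simp add: cinner_add_left bounded_bilinear.add_left[OF bounded_bilinear_scaleC])
    show "?B (scaleC_L2 c \<phi>) = scaleC_L2 c (?B \<phi>)" for c \<phi>
      by (rule L2_eqI) (simp add: cinner_scaleC_left)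
  qed
  moreover have "compact (closure (?B ` cball 0 1))"
  proof (rule compact_closure_subset)
    show "?B ` cball 0 1 \<subseteq> (\<lambda>c. scaleC_L2 c q) ` cball 0 (norm p)"
    proof (intro image_subsetI imageI)
      fix \<phi> :: "'a L2" assume "\<phi> \<in> cball 0 1"
      then have "cmod (cinner \<phi> p) \<le> 1 * norm p"
        by (intro order_trans[OF cinner_bound] mult_right_mono) auto
      then show "cinner \<phi> p \<in> cball 0 (norm p)" by simp
    qed
    show "compact ((\<lambda>c. scaleC_L2 c q) ` cball 0 (norm p))"
      by (intro compact_continuous_image compact_cball
          bounded_bilinear.continuous_on[OF bounded_bilinear_scaleC] continuous_intros)
  qed
  ultimately show "compact_operator ?B" by (simp add: compact_operator_def)
qed

lemma compact_form_cong:
  "compact_form b \<Longrightarrow> (\<And>\<phi> \<psi>. b' \<phi> \<psi> = b \<phi> \<psi>) \<Longrightarrow> compact_form b'"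
  by (simp add: compact_form_def)

lemma compact_form_add:
  fixes b b' :: "'a::euclidean_space L2 \<Rightarrow> 'a L2 \<Rightarrow> complex"
  assumes "compact_form b" "compact_form b'"
  shows "compact_form (\<lambda>\<phi> \<psi>. b \<phi> \<psi> + b' \<phi> \<psi>)"
proof -
  obtain A B where A: "compact_operator A" "\<And>\<phi> \<psi>. cinner (A \<phi>) \<psi> = b \<phi> \<psi>"
    and B: "compact_operator B" "\<And>\<phi> \<psi>. cinner (B \<phi>) \<psi> = b' \<phi> \<psi>"
    using assms unfolding compact_form_def by blast
  have cl: "bounded_clinear A" "bounded_clinear B" using A B by (simp_all add: compact_operator_def)
  have "bounded_clinear (\<lambda>\<phi>. A \<phi> + B \<phi>)"
    using cl by (auto simp: bounded_clinear_def bounded_linear_add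
        bounded_bilinear.add_right[OF bounded_bilinear_scaleC])
  moreover have "compact (closure ((\<lambda>\<phi>. A \<phi> + B \<phi>) ` cball 0 1))"
  proof (rule compact_closure_subset)
    let ?S = "{x + y | x y. x \<in> closure (A ` cball 0 1) \<and> y \<in> closure (B ` cball 0 1)}"
    show "(\<lambda>\<phi>. A \<phi> + B \<phi>) ` cball 0 1 \<subseteq> ?S"
      using closure_subset[of "A ` cball 0 1"] closure_subset[of "B ` cball 0 1"] by blast
    show "compact ?S" using A B by (intro compact_sums) (auto simp: compact_operator_def)
  qed
  ultimately show ?thesis
    unfolding compact_form_def
    by (intro exI[of _ "\<lambda>\<phi>. A \<phi> + B \<phi>"]) (simp add: compact_operator_def cinner_add_left A B)
qed

lemma compact_form_cmult:
  fixes b :: "'a::euclidean_space L2 \<Rightarrow> 'a L2 \<Rightarrow> complex"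
  assumes "compact_form b"
  shows "compact_form (\<lambda>\<phi> \<psi>. c * b \<phi> \<psi>)"
proof -
  obtain A where A: "compact_operator A" "\<And>\<phi> \<psi>. cinner (A \<phi>) \<psi> = b \<phi> \<psi>"
    using assms unfolding compact_form_def by blast
  have cl: "bounded_clinear A" using A by (simp add: compact_operator_def)
  have bl: "bounded_linear (scaleC_L2 c :: 'a L2 \<Rightarrow> 'a L2)"
    by (rule bounded_bilinear.bounded_linear_right[OF bounded_bilinear_scaleC])
  have "bounded_clinear (\<lambda>\<phi>. scaleC_L2 c (A \<phi>))"
    unfolding bounded_clinear_def
  proof (intro conjI allI)
    show "bounded_linear (\<lambda>\<phi>. scaleC_L2 c (A \<phi>))"
      using cl by (intro bounded_linear_compose[OF bl]) (simp add: bounded_clinear_def)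
    show "scaleC_L2 c (A (scaleC_L2 d \<phi>)) = scaleC_L2 d (scaleC_L2 c (A \<phi>))" for d \<phi>
      by (rule L2_eqI) (simp add: bounded_clinear_scaleC[OF cl] cinner_scaleC_left)
  qed
  moreover have "compact (closure ((\<lambda>\<phi>. scaleC_L2 c (A \<phi>)) ` cball 0 1))"
  proof (rule compact_closure_subset)
    show "(\<lambda>\<phi>. scaleC_L2 c (A \<phi>)) ` cball 0 1 \<subseteq> scaleC_L2 c ` closure (A ` cball 0 1)"
      using closure_subset[of "A ` cball 0 1"] by blast
    show "compact (scaleC_L2 c ` closure (A ` cball 0 1))"
      using A(1) by (intro compact_continuous_image linear_continuous_on[OF bl])
        (simp add: compact_operator_def)
  qed
  ultimately show ?thesis
    unfolding compact_form_def
    by (intro exI[of _ "\<lambda>\<phi>. scaleC_L2 c (A \<phi>)"]) (simp add: compact_operator_def cinner_scaleC_left A)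
qed

text \<open>If forms \<open>b\<^sub>n\<close> with operators \<open>B\<^sub>n\<close> approach \<open>b\<close> uniformly on bounded sets, then \<open>B\<^sub>n \<phi>\<close> is a Cauchy
  sequence, its limit defines an operator with form \<open>b\<close>, and the convergence is in operator norm. The image of
  the unit ball is then totally bounded, as it lies near the image under some \<open>B\<^sub>n\<close>.\<close>

lemma compact_form_limit:
  fixes b :: "'a::euclidean_space L2 \<Rightarrow> 'a L2 \<Rightarrow> complex"
  assumes approx: "\<And>e. e > 0 \<Longrightarrow> \<exists>b'. compact_form b' \<and>
      (\<forall>\<phi> \<psi>. cmod (b \<phi> \<psi> - b' \<phi> \<psi>) \<le> e * norm \<phi> * norm \<psi>)"
  shows "compact_form b"
proof -
  have "\<exists>B. compact_operator B \<and> (\<forall>\<phi> \<psi>. cmod (b \<phi> \<psi> - cinner (B \<phi>) \<psi>) \<le> e * norm \<phi> * norm \<psi>)"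
    if "e > 0" for e
    using approx[OF that] unfolding compact_form_def by metis
  then have "\<exists>B. compact_operator B \<and>
      (\<forall>\<phi> \<psi>. cmod (b \<phi> \<psi> - cinner (B \<phi>) \<psi>) \<le> inverse (real (Suc n)) * norm \<phi> * norm \<psi>)" for n
    by simp
  then obtain B where B: "\<And>n. compact_operator (B n)"
      "\<And>n \<phi> \<psi>. cmod (b \<phi> \<psi> - cinner (B n \<phi>) \<psi>) \<le> inverse (real (Suc n)) * norm \<phi> * norm \<psi>"
    by metis
  have cl: "bounded_clinear (B n)" for n using B(1) by (simp add: compact_operator_def)
  have inv0: "(\<lambda>n. inverse (real (Suc n)) * M) \<longlonglongrightarrow> 0" for M
    by (intro tendsto_mult_left_zero LIMSEQ_inverse_real_of_nat)
  have diff: "norm (B n \<phi> - B m \<phi>) \<le> (inverse (real (Suc n)) + inverse (real (Suc m))) * norm \<phi>" for n m \<phi>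
  proof (rule norm_le_cinner)
    fix \<psi>
    have "cinner (B n \<phi> - B m \<phi>) \<psi> = (b \<phi> \<psi> - cinner (B m \<phi>) \<psi>) - (b \<phi> \<psi> - cinner (B n \<phi>) \<psi>)"
      by (simp add: cinner_diff_left)
    also have "cmod \<dots> \<le> inverse (real (Suc m)) * norm \<phi> * norm \<psi> + inverse (real (Suc n)) * norm \<phi> * norm \<psi>"
      by (intro order_trans[OF norm_triangle_ineq4] add_mono B(2))
    finally show "cmod (cinner (B n \<phi> - B m \<phi>) \<psi>) \<le>
        (inverse (real (Suc n)) + inverse (real (Suc m))) * norm \<phi> * norm \<psi>"
      by (simp add: algebra_simps)
  qed simp
  have "Cauchy (\<lambda>n. B n \<phi>)" for \<phi>
  proof (rule metric_CauchyI)
    fix e :: real assume "e > 0"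
    then have "\<forall>\<^sub>F n in sequentially. inverse (real (Suc n)) * norm \<phi> < e / 2"
      by (intro order_tendstoD(2)[OF inv0]) simp
    then obtain M where M: "\<And>n. n \<ge> M \<Longrightarrow> inverse (real (Suc n)) * norm \<phi> < e / 2"
      unfolding eventually_sequentially by blast
    show "\<exists>M. \<forall>m\<ge>M. \<forall>n\<ge>M. dist (B m \<phi>) (B n \<phi>) < e"
    proof (intro exI[of _ M] allI impI)
      fix m n assume "m \<ge> M" "n \<ge> M"
      then show "dist (B m \<phi>) (B n \<phi>) < e"
        using M[of m] M[of n] diff[of m \<phi> n] by (simp add: dist_norm distrib_right)
    qed
  qed
  then have "\<exists>l. (\<lambda>n. B n \<phi>) \<longlonglongrightarrow> l" for \<phi>
    using Cauchy_convergent convergent_def by blast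
  then obtain L where L: "\<And>\<phi>. (\<lambda>n. B n \<phi>) \<longlonglongrightarrow> L \<phi>" by metis
  have form: "cinner (L \<phi>) \<psi> = b \<phi> \<psi>" for \<phi> \<psi>
  proof (rule LIMSEQ_unique)
    show "(\<lambda>n. cinner (B n \<phi>) \<psi>) \<longlonglongrightarrow> cinner (L \<phi>) \<psi>"
      by (intro tendsto_cinner L tendsto_const)
    have "(\<lambda>n. b \<phi> \<psi> - cinner (B n \<phi>) \<psi>) \<longlonglongrightarrow> 0"
      using B(2) by (intro Lim_null_comparison[OF _ inv0[of "norm \<phi> * norm \<psi>"]])
        (simp add: mult.assoc)
    then show "(\<lambda>n. cinner (B n \<phi>) \<psi>) \<longlonglongrightarrow> b \<phi> \<psi>"
      using tendsto_diff[OF tendsto_const[of "b \<phi> \<psi>"]] by fastforce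
  qed
  have LB: "norm (L \<phi> - B n \<phi>) \<le> inverse (real (Suc n)) * norm \<phi>" for n \<phi>
    by (rule norm_le_cinner) (simp_all add: cinner_diff_left form B(2) del: of_nat_Suc)
  obtain K where K: "K \<ge> 0" "\<And>\<phi>. norm (B 0 \<phi>) \<le> norm \<phi> * K"
    using bounded_clinear_bound[OF cl[of 0]] by blast
  have "bounded_clinear L"
  proof (rule bounded_clinearI)
    show "L (\<phi> + \<psi>) = L \<phi> + L \<psi>" for \<phi> \<psi>
      using tendsto_add[OF L[of \<phi>] L[of \<psi>]] L[of "\<phi> + \<psi>"]
      by (simp add: bounded_clinear_add[OF cl] LIMSEQ_unique)
    show "L (scaleC_L2 c \<phi>) = scaleC_L2 c (L \<phi>)" for c \<phi>
      using tendsto_scaleC[OF tendsto_const L[of \<phi>], of c] L[of "scaleC_L2 c \<phi>"]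
      by (simp add: bounded_clinear_scaleC[OF cl] LIMSEQ_unique)
    show "norm (L \<phi>) \<le> norm \<phi> * (K + 1)" for \<phi>
      using norm_triangle_ineq[of "L \<phi> - B 0 \<phi>" "B 0 \<phi>"] LB[of \<phi> 0] K(2)[of \<phi>]
      by (simp add: distrib_left)
  qed
  moreover have "compact (closure (L ` cball 0 1))"
    unfolding compact_eq_totally_bounded
  proof (intro conjI[OF complete_eq_closed[THEN iffD2, OF closed_closure]] allI impI)
    fix e :: real assume e: "e > 0"
    then obtain n where n: "inverse (real (Suc n)) < e / 3"
      using reals_Archimedean[of "e / 3"] by auto
    have "compact (closure (B n ` cball 0 1))" using B(1) by (simp add: compact_operator_def)
    then obtain k where k: "finite k" "closure (B n ` cball 0 1) \<subseteq> (\<Union>x\<in>k. ball x (e / 3))"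
      using e unfolding compact_eq_totally_bounded by (meson divide_pos_pos zero_less_numeral)
    have "L ` cball 0 1 \<subseteq> (\<Union>x\<in>k. cball x (2 * e / 3))"
    proof (rule image_subsetI)
      fix \<phi> :: "'a L2" assume \<phi>: "\<phi> \<in> cball 0 1"
      then have "B n \<phi> \<in> (\<Union>x\<in>k. ball x (e / 3))"
        using k(2) closure_subset[of "B n ` cball 0 1"] by blast
      then obtain x where x: "x \<in> k" "dist x (B n \<phi>) < e / 3" by auto
      have "inverse (real (Suc n)) * norm \<phi> \<le> inverse (real (Suc n)) * 1"
        using \<phi> by (intro mult_left_mono) auto
      then have "dist (B n \<phi>) (L \<phi>) < e / 3"
        using LB[of \<phi> n] n unfolding dist_norm norm_minus_commute[of "B n \<phi>"] by linarith
      then have "dist x (L \<phi>) \<le> 2 * e / 3" using x(2) dist_triangle[of x "L \<phi>" "B n \<phi>"] by simp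
      then show "L \<phi> \<in> (\<Union>x\<in>k. cball x (2 * e / 3))" using x(1) by auto
    qed
    then have "closure (L ` cball 0 1) \<subseteq> (\<Union>x\<in>k. cball x (2 * e / 3))"
      using k(1) by (intro closure_minimal closed_UN) auto
    also have "\<dots> \<subseteq> (\<Union>x\<in>k. ball x e)" using e by force
    finally show "\<exists>k. finite k \<and> closure (L ` cball 0 1) \<subseteq> (\<Union>x\<in>k. ball x e)"
      using k(1) by blast
  qed
  ultimately show ?thesis
    unfolding compact_form_def compact_operator_def using form by blast
qed

lemma
  fixes f :: "'a::euclidean_space \<Rightarrow> 'c::{real_normed_field, banach, second_countable_topology}"
    and g :: "'b::euclidean_space \<Rightarrow> 'c"
  assumes f: "integrable lborel f" and g: "integrable lborel g"
  shows integrable_tensor: "integrable lborel (\<lambda>z. f (fst z) * g (snd z))"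
    and integral_tensor: "(\<integral>z. f (fst z) * g (snd z) \<partial>lborel) = (\<integral>x. f x \<partial>lborel) * (\<integral>y. g y \<partial>lborel)"
proof -
  have [measurable]: "f \<in> borel_measurable lborel" "g \<in> borel_measurable lborel" using f g by auto
  have "integrable (lborel \<Otimes>\<^sub>M lborel) (\<lambda>z. f (fst z) * g (snd z))"
  proof (rule lborel_pair.Fubini_integrable)
    show "(\<lambda>z. f (fst z) * g (snd z)) \<in> borel_measurable (lborel \<Otimes>\<^sub>M lborel)" by measurable
    show "integrable lborel (\<lambda>x. \<integral>y. norm (f (fst (x, y)) * g (snd (x, y))) \<partial>lborel)"
      using f by (simp add: norm_mult)
    show "AE x in lborel. integrable lborel (\<lambda>y. f (fst (x, y)) * g (snd (x, y)))"
      using g by simp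
  qed
  then show int: "integrable lborel (\<lambda>z. f (fst z) * g (snd z))" by (simp add: lborel_prod)
  have "(\<integral>z. f (fst z) * g (snd z) \<partial>(lborel \<Otimes>\<^sub>M lborel)) = (\<integral>x. \<integral>y. f (fst (x, y)) * g (snd (x, y)) \<partial>lborel \<partial>lborel)"
    using int by (intro lborel_pair.integral_fst'[symmetric]) (simp add: lborel_prod)
  then show "(\<integral>z. f (fst z) * g (snd z) \<partial>lborel) = (\<integral>x. f x \<partial>lborel) * (\<integral>y. g y \<partial>lborel)"
    by (simp add: lborel_prod)
qed

lemma
  fixes g :: "'a::euclidean_space \<Rightarrow> complex" and h :: "'b::euclidean_space \<Rightarrow> complex"
  assumes g: "sq_integrable g" and h: "sq_integrable h"
  shows sq_integrable_tensor: "sq_integrable (\<lambda>z. g (fst z) * h (snd z))"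
    and norm_tensor: "norm (abs_L2 (\<lambda>z. g (fst z) * h (snd z))) = norm (abs_L2 g) * norm (abs_L2 h)"
proof -
  have [measurable]: "g \<in> borel_measurable borel" "h \<in> borel_measurable borel"
    using g h by (simp_all add: sq_integrable_measurable)
  have int: "integrable lborel (\<lambda>t. (cmod (g t))\<^sup>2)" "integrable lborel (\<lambda>t. (cmod (h t))\<^sup>2)"
    using g h by (simp_all add: sq_integrable_def)
  have "(\<lambda>z. g (fst z) * h (snd z)) \<in> borel_measurable (borel \<Otimes>\<^sub>M borel)" by measurable
  then show sq: "sq_integrable (\<lambda>z. g (fst z) * h (snd z))"
    using integrable_tensor[OF int]
    by (simp add: sq_integrable_def borel_prod norm_mult power_mult_distrib)
  have "(norm (abs_L2 (\<lambda>z. g (fst z) * h (snd z))))\<^sup>2 = (norm (abs_L2 g) * norm (abs_L2 h))\<^sup>2"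
    using norm_abs_L2[OF sq] norm_abs_L2[OF g] norm_abs_L2[OF h] integral_tensor[OF int]
    by (simp add: norm_mult power_mult_distrib)
  then show "norm (abs_L2 (\<lambda>z. g (fst z) * h (snd z))) = norm (abs_L2 g) * norm (abs_L2 h)"
    by (simp add: power2_eq_iff_nonneg)
qed

text \<open>Paired with a kernel, this class of \<open>(w, y) \<mapsto> \<psi>(w) cnj (\<phi>(y))\<close> gives the form of the integral
  operator.\<close>

definition tensor_cnj :: "'a::euclidean_space L2 \<Rightarrow> 'a L2 \<Rightarrow> ('a \<times> 'a) L2" where
  "tensor_cnj \<psi> \<phi> = abs_L2 (\<lambda>z. rep_L2 \<psi> (fst z) * cnj (rep_L2 \<phi> (snd z)))"

lemma sq_integrable_cnj: "sq_integrable g \<Longrightarrow> sq_integrable (\<lambda>t. cnj (g t))"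
  by (auto simp: sq_integrable_def)

lemma norm_tensor_cnj: "norm (tensor_cnj \<psi> \<phi>) = norm \<psi> * norm \<phi>"
proof -
  have "(norm (abs_L2 (\<lambda>t. cnj (rep_L2 \<phi> t))))\<^sup>2 = (norm \<phi>)\<^sup>2"
    using norm_abs_L2[OF sq_integrable_cnj[OF sq_integrable_rep_L2], of \<phi>]
      norm_abs_L2[OF sq_integrable_rep_L2, of \<phi>]
    by simp
  then have "norm (abs_L2 (\<lambda>t. cnj (rep_L2 \<phi> t))) = norm \<phi>"
    by (simp add: power2_eq_iff_nonneg)
  then show ?thesis
    unfolding tensor_cnj_def
    by (subst norm_tensor[OF sq_integrable_rep_L2 sq_integrable_cnj[OF sq_integrable_rep_L2]]) simp
qed

text \<open>The form of a kernel is its inner product with a tensor of norm \<open>\<parallel>\<phi>\<parallel> \<parallel>\<psi>\<parallel>\<close>, so the form depends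
  continuously on the kernel in \<open>L\<^sup>2\<close>; and a box in the product space is a product of boxes, whose
  indicator is the kernel of a rank-one operator.\<close>

lemma compact_form_Hilbert_Schmidt:
  fixes K :: "'a::euclidean_space \<times> 'a \<Rightarrow> complex"
  assumes "Lp 2 K"
  shows "compact_form (\<lambda>\<phi> \<psi>. cinner (abs_L2 K) (tensor_cnj \<psi> \<phi>))"
  using zero_less_numeral assms
proof (induction K rule: Lp_box_induct)
  case (box a b)
  define p where "p = (indicator (box (snd a) (snd b)) :: 'a \<Rightarrow> complex)"
  define q where "q = (indicator (box (fst a) (fst b)) :: 'a \<Rightarrow> complex)"
  have sq: "sq_integrable p" "sq_integrable q"
    unfolding sq_integrable_iff_Lp p_def q_def by (auto intro!: Lp_indicator_bounded)
  have sqK: "sq_integrable (indicator (box a b) :: 'a \<times> 'a \<Rightarrow> complex)"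
    unfolding sq_integrable_iff_Lp by (auto intro!: Lp_indicator_bounded)
  have "compact_form (\<lambda>\<phi> \<psi>. cinner \<phi> (abs_L2 p) * cinner (abs_L2 q) \<psi>)"
    by (rule compact_form_rank_one)
  then show ?case
  proof (rule compact_form_cong)
    fix \<phi> \<psi> :: "'a L2"
    define g h where "g = rep_L2 \<phi>" and "h = rep_L2 \<psi>"
    have gh: "sq_integrable g" "sq_integrable h" "\<phi> = abs_L2 g" "\<psi> = abs_L2 h"
      by (simp_all add: g_def h_def sq_integrable_rep_L2)
    have "cinner (abs_L2 (indicator (box a b))) (tensor_cnj \<psi> \<phi>) =
        (\<integral>z. indicator (box a b) z * cnj (h (fst z) * cnj (g (snd z))) \<partial>lborel)"
      unfolding tensor_cnj_def g_def[symmetric] h_def[symmetric]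
      by (intro cinner_abs_L2 sqK sq_integrable_tensor gh sq_integrable_cnj)
    also have "\<dots> = (\<integral>z. (q (fst z) * cnj (h (fst z))) * (g (snd z) * cnj (p (snd z))) \<partial>lborel)"
      by (intro Bochner_Integration.integral_cong refl)
        (auto simp: p_def q_def indicator_def box_prod mem_Times_iff)
    also have "\<dots> = cinner (abs_L2 q) \<psi> * cinner \<phi> (abs_L2 p)"
      unfolding integral_tensor[OF integrable_mult_cnj[OF sq(2) gh(2)] integrable_mult_cnj[OF gh(1) sq(1)]]
      using gh sq by (simp add: cinner_abs_L2)
    finally show "cinner (abs_L2 (indicator (box a b))) (tensor_cnj \<psi> \<phi>) =
        cinner \<phi> (abs_L2 p) * cinner (abs_L2 q) \<psi>" by simp
  qed
next
  case (add f g)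
  show ?case
    using compact_form_add[OF add.IH] add.hyps
    by (simp add: sq_integrable_iff_Lp cinner_add_left flip: plus_abs_L2)
next
  case (cmult f c)
  show ?case
    using compact_form_cmult[OF cmult.IH, of c] cmult.hyps
    by (simp add: sq_integrable_iff_Lp cinner_scaleC_left flip: scaleC_abs_L2)
next
  case (lim s f)
  show ?case
  proof (rule compact_form_limit)
    fix e :: real assume "e > 0"
    have "(\<lambda>n. abs_L2 (s n)) \<longlonglongrightarrow> abs_L2 f" by (rule L2_Lp_limit[OF lim.hyps])
    then obtain n where n: "norm (abs_L2 (s n) - abs_L2 f) < e"
      using \<open>e > 0\<close> by (metis LIMSEQ_D le_refl)
    show "\<exists>b'. compact_form b' \<and> (\<forall>\<phi> \<psi>. cmod (cinner (abs_L2 f) (tensor_cnj \<psi> \<phi>) - b' \<phi> \<psi>) \<le> e * norm \<phi> * norm \<psi>)"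
    proof (intro exI[of _ "\<lambda>\<phi> \<psi>. cinner (abs_L2 (s n)) (tensor_cnj \<psi> \<phi>)"] conjI allI lim.IH)
      fix \<phi> \<psi> :: "'a L2"
      have "cmod (cinner (abs_L2 f) (tensor_cnj \<psi> \<phi>) - cinner (abs_L2 (s n)) (tensor_cnj \<psi> \<phi>))
          \<le> norm (abs_L2 f - abs_L2 (s n)) * (norm \<psi> * norm \<phi>)"
        unfolding cinner_diff_left[symmetric] norm_tensor_cnj[of \<psi> \<phi>, symmetric] by (rule cinner_bound)
      also have "\<dots> \<le> e * (norm \<psi> * norm \<phi>)"
        using n by (intro mult_right_mono) (auto simp: norm_minus_commute)
      finally show "cmod (cinner (abs_L2 f) (tensor_cnj \<psi> \<phi>) - cinner (abs_L2 (s n)) (tensor_cnj \<psi> \<phi>))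
          \<le> e * norm \<phi> * norm \<psi>" by (simp add: mult_ac)
    qed
  qed
qed

section \<open>Quantizing integrable symbols\<close>

lemma nn_integral_lborel_translate:
  fixes f :: "'a::euclidean_space \<Rightarrow> ennreal"
  assumes [measurable]: "f \<in> borel_measurable borel"
  shows "(\<integral>\<^sup>+x. f (x + c) \<partial>lborel) = (\<integral>\<^sup>+x. f x \<partial>lborel)"
proof -
  have "(\<integral>\<^sup>+x. f x \<partial>lborel) = (\<integral>\<^sup>+x. f x \<partial>distr lborel borel ((+) c))"
    by (simp add: lborel_distr_plus)
  also have "\<dots> = (\<integral>\<^sup>+x. f (c + x) \<partial>lborel)"
    by (subst nn_integral_distr) auto
  finally show ?thesis by (simp add: add.commute)
qed

text \<open>Shears preserve volume: for each value of the fixed coordinate they are translations of the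
  other one.\<close>

lemma
  fixes k :: "'b::euclidean_space \<Rightarrow> 'a::euclidean_space"
  assumes [measurable]: "k \<in> borel_measurable borel"
  shows lborel_distr_shear_fst:
      "distr lborel borel (\<lambda>z. (fst z + k (snd z), snd z)) = (lborel :: ('a \<times> 'b) measure)" (is ?fst)
    and lborel_distr_shear_snd:
      "distr lborel borel (\<lambda>z. (fst z, snd z + k (fst z))) = (lborel :: ('b \<times> 'a) measure)" (is ?snd)
proof -
  have m1: "(\<lambda>z. (fst z + k (snd z), snd z)) \<in> borel \<rightarrow>\<^sub>M (borel :: ('a \<times> 'b) measure)"
    unfolding borel_prod[symmetric] by measurable
  have m2: "(\<lambda>z. (fst z, snd z + k (fst z))) \<in> borel \<rightarrow>\<^sub>M (borel :: ('b \<times> 'a) measure)"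
    unfolding borel_prod[symmetric] by measurable
  show ?fst
  proof (rule measure_eqI)
    fix A :: "('a \<times> 'b) set" assume "A \<in> sets (distr lborel borel (\<lambda>z. (fst z + k (snd z), snd z)))"
    then have A [measurable]: "A \<in> sets borel" by simp
    have A' [measurable]: "A \<in> sets (borel \<Otimes>\<^sub>M borel)" unfolding borel_prod by (rule A)
    have "emeasure (distr lborel borel (\<lambda>z. (fst z + k (snd z), snd z))) A =
        (\<integral>\<^sup>+z. indicator A z \<partial>distr lborel borel (\<lambda>z. (fst z + k (snd z), snd z)))"
      by simp
    also have "\<dots> = (\<integral>\<^sup>+z. indicator A (fst z + k (snd z), snd z) \<partial>(lborel \<Otimes>\<^sub>M lborel))"
      using m1 by (subst nn_integral_distr) (auto simp: lborel_prod)
    also have "\<dots> = (\<integral>\<^sup>+y. \<integral>\<^sup>+x. indicator A (x + k y, y) \<partial>lborel \<partial>lborel)"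
      by (subst lborel_pair.nn_integral_snd[symmetric]) auto
    also have "\<dots> = (\<integral>\<^sup>+y. \<integral>\<^sup>+x. indicator A (x, y) \<partial>lborel \<partial>lborel)"
      by (intro nn_integral_cong nn_integral_lborel_translate[of "\<lambda>x. indicator A (x, _)"]) measurable
    also have "\<dots> = (\<integral>\<^sup>+z. indicator A z \<partial>(lborel \<Otimes>\<^sub>M lborel))"
      by (subst lborel_pair.nn_integral_snd) auto
    also have "\<dots> = emeasure lborel A" by (simp add: lborel_prod)
    finally show "emeasure (distr lborel borel (\<lambda>z. (fst z + k (snd z), snd z))) A = emeasure lborel A" .
  qed simp
  show ?snd
  proof (rule measure_eqI)
    fix A :: "('b \<times> 'a) set" assume "A \<in> sets (distr lborel borel (\<lambda>z. (fst z, snd z + k (fst z))))"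
    then have A [measurable]: "A \<in> sets borel" by simp
    have A' [measurable]: "A \<in> sets (borel \<Otimes>\<^sub>M borel)" unfolding borel_prod by (rule A)
    have "emeasure (distr lborel borel (\<lambda>z. (fst z, snd z + k (fst z)))) A =
        (\<integral>\<^sup>+z. indicator A z \<partial>distr lborel borel (\<lambda>z. (fst z, snd z + k (fst z))))"
      by simp
    also have "\<dots> = (\<integral>\<^sup>+z. indicator A (fst z, snd z + k (fst z)) \<partial>(lborel \<Otimes>\<^sub>M lborel))"
      using m2 by (subst nn_integral_distr) (auto simp: lborel_prod)
    also have "\<dots> = (\<integral>\<^sup>+y. \<integral>\<^sup>+x. indicator A (y, x + k y) \<partial>lborel \<partial>lborel)"
      by (subst lborel.nn_integral_fst[symmetric]) auto
    also have "\<dots> = (\<integral>\<^sup>+y. \<integral>\<^sup>+x. indicator A (y, x) \<partial>lborel \<partial>lborel)"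
      by (intro nn_integral_cong nn_integral_lborel_translate[of "\<lambda>x. indicator A (_, x)"]) measurable
    also have "\<dots> = (\<integral>\<^sup>+z. indicator A z \<partial>(lborel \<Otimes>\<^sub>M lborel))"
      by (subst lborel.nn_integral_fst) auto
    also have "\<dots> = emeasure lborel A" by (simp add: lborel_prod)
    finally show "emeasure (distr lborel borel (\<lambda>z. (fst z, snd z + k (fst z)))) A = emeasure lborel A" .
  qed simp
qed

text \<open>The map \<open>(x, t) \<mapsto> (x - (1 - s) t, x + s t)\<close> is a composition of two shears. It passes from the
  variables of the Wigner distribution to those of an integral kernel.\<close>

lemma
  fixes H :: "'a::euclidean_space \<times> 'a \<Rightarrow> complex"
  assumes H: "integrable lborel H"
  shows integrable_wigner_coords: "integrable lborel (\<lambda>z. H (fst z - (1 - s) *\<^sub>R snd z, fst z + s *\<^sub>R snd z))"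
    and integral_wigner_coords:
      "(\<integral>z. H (fst z - (1 - s) *\<^sub>R snd z, fst z + s *\<^sub>R snd z) \<partial>lborel) = (\<integral>z. H z \<partial>lborel)"
proof -
  have [measurable]: "H \<in> borel_measurable borel" using H by auto
  let ?A = "\<lambda>z :: 'a \<times> 'a. (fst z + - ((1 - s) *\<^sub>R snd z), snd z)"
  let ?B = "\<lambda>z :: 'a \<times> 'a. (fst z, snd z + fst z)"
  let ?M = "\<lambda>z :: 'a \<times> 'a. (fst z - (1 - s) *\<^sub>R snd z, fst z + s *\<^sub>R snd z)"
  have BA: "?B \<circ> ?A = ?M" by (auto simp: fun_eq_iff algebra_simps)
  have mA: "?A \<in> lborel \<rightarrow>\<^sub>M borel" and mB: "?B \<in> borel \<rightarrow>\<^sub>M borel" and mM: "?M \<in> lborel \<rightarrow>\<^sub>M borel"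
    by (auto intro!: borel_measurable_continuous_onI continuous_intros)
  have A: "distr lborel borel ?A = lborel"
    using lborel_distr_shear_fst[of "\<lambda>t. - ((1 - s) *\<^sub>R t)"] by simp
  have B: "distr lborel borel ?B = lborel"
    using lborel_distr_shear_snd[of "\<lambda>t. t"] by simp
  have "distr lborel borel ?M = distr (distr lborel borel ?A) borel ?B"
    unfolding BA[symmetric] by (rule distr_distr[symmetric, OF mB mA])
  then have M: "distr lborel borel ?M = (lborel :: ('a \<times> 'a) measure)" using A B by simp
  show "integrable lborel (\<lambda>z. H (?M z))"
    using H by (subst integrable_distr_eq[OF mM, symmetric]) (simp_all add: M)
  show "(\<integral>z. H (?M z) \<partial>lborel) = (\<integral>z. H z \<partial>lborel)"
    by (subst integral_distr[OF mM, symmetric]) (simp_all add: M)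
qed

lemma wig_integrand_integrable:
  fixes g h :: "'a::euclidean_space \<Rightarrow> complex"
  assumes s: "0 < s" "s < 1" and g: "sq_integrable g" and h: "sq_integrable h"
  shows "integrable lborel (\<lambda>t. g (x + s *\<^sub>R t) * cnj (h (x - (1 - s) *\<^sub>R t)))"
proof (rule Bochner_Integration.integrable_bound[OF wig_integrand_bound(1)[OF s g h, of x]])
  have [measurable]: "g \<in> borel_measurable borel" "h \<in> borel_measurable borel"
    using g h by (simp_all add: sq_integrable_measurable)
  show "(\<lambda>t. g (x + s *\<^sub>R t) * cnj (h (x - (1 - s) *\<^sub>R t))) \<in> borel_measurable lborel"
    by measurable
qed (simp add: norm_mult)

lemma integrable_mult_cwig:
  fixes f :: "'a::euclidean_space \<times> 'a \<Rightarrow> complex"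
  assumes s: "0 < s" "s < 1" and f: "integrable lborel f"
  shows "integrable lborel (\<lambda>z. f z * cwig s \<phi> \<psi> z)"
proof (rule Bochner_Integration.integrable_bound)
  show "integrable lborel (\<lambda>z. (wig_const TYPE('a) s * norm \<phi> * norm \<psi>) *\<^sub>R f z)"
    using f by (rule integrable_scaleR_right)
  show "(\<lambda>z. f z * cwig s \<phi> \<psi> z) \<in> borel_measurable lborel"
    using f measurable_cwig[OF s, of \<phi> \<psi>] by measurable
  show "AE z in lborel. norm (f z * cwig s \<phi> \<psi> z) \<le> norm ((wig_const TYPE('a) s * norm \<phi> * norm \<psi>) *\<^sub>R f z)"
  proof (rule always_eventually, rule allI)
    fix z
    show "norm (f z * cwig s \<phi> \<psi> z) \<le> norm ((wig_const TYPE('a) s * norm \<phi> * norm \<psi>) *\<^sub>R f z)"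
      using mult_left_mono[OF cwig_bound[OF s, of \<phi> \<psi> z] norm_ge_zero[of "f z"]] wig_const_pos[OF s, where 'a='a]
      by (simp add: norm_mult mult_ac abs_mult)
  qed
qed

text \<open>The form of the operator convolution of \<open>f\<close> with \<open>S\<^sub>s\<close>.\<close>

definition symbol_form ::
    "real \<Rightarrow> ('a::euclidean_space \<times> 'a \<Rightarrow> complex) \<Rightarrow> 'a L2 \<Rightarrow> 'a L2 \<Rightarrow> complex" where
  "symbol_form s f \<phi> \<psi> = (\<integral>z. f z * cwig s \<phi> \<psi> z \<partial>lborel)"

lemma symbol_form_bound:
  fixes f :: "'a::euclidean_space \<times> 'a \<Rightarrow> complex"
  assumes s: "0 < s" "s < 1" and f: "integrable lborel f"
  shows "cmod (symbol_form s f \<phi> \<psi>) \<le> wig_const TYPE('a) s * (\<integral>z. cmod (f z) \<partial>lborel) * norm \<phi> * norm \<psi>"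
proof -
  have "cmod (symbol_form s f \<phi> \<psi>) \<le> (\<integral>z. cmod (f z * cwig s \<phi> \<psi> z) \<partial>lborel)"
    unfolding symbol_form_def by (rule integral_norm_bound)
  also have "\<dots> \<le> (\<integral>z. cmod (f z) * (wig_const TYPE('a) s * norm \<phi> * norm \<psi>) \<partial>lborel)"
    using f integrable_mult_cwig[OF s f]
    by (intro integral_mono integrable_norm integrable_mult_left)
      (auto simp: norm_mult intro!: mult_left_mono cwig_bound[OF s])
  finally show ?thesis by (simp add: mult_ac)
qed

definition ft_box :: "'a::euclidean_space \<Rightarrow> 'a \<Rightarrow> 'a \<Rightarrow> complex" where
  "ft_box a b t = (\<integral>\<omega>. indicator (box a b) \<omega> * cis (- 2 * pi * (t \<bullet> \<omega>)) \<partial>lborel)"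

text \<open>The square of an indicator is the indicator itself, so the Fourier transform is an inner product with a
  modulated vector; continuity and decay of the transform follow from those of modulations.\<close>

lemma ft_box_eq_cinner:
  fixes a b :: "'a::euclidean_space"
  defines "p \<equiv> abs_L2 (indicator (box a b))"
  shows "ft_box a b t = cinner (tf_shift (0, - t) p) p"
proof -
  have sq: "sq_integrable (indicator (box a b) :: 'a \<Rightarrow> complex)"
    unfolding sq_integrable_iff_Lp by (auto intro!: Lp_indicator_bounded)
  have "cinner (tf_shift (0, - t) p) p =
      (\<integral>\<omega>. cis (2 * pi * (- t \<bullet> \<omega>)) * indicator (box a b) (\<omega> - 0) * cnj (indicator (box a b) \<omega>) \<partial>lborel)"
    unfolding p_def tf_shift_abs_L2[OF sq] by (rule cinner_abs_L2[OF sq_integrable_tf_shift[OF sq] sq])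
  also have "\<dots> = ft_box a b t"
    unfolding ft_box_def by (intro Bochner_Integration.integral_cong refl) (auto simp: indicator_def)
  finally show ?thesis ..
qed

lemma measurable_ft_box [measurable]: "ft_box a b \<in> borel_measurable borel"
proof (intro borel_measurable_continuous_onI)
  have "continuous_on UNIV (\<lambda>t :: 'a. tf_shift (0, - t) \<phi>)" for \<phi> :: "'a L2"
    by (rule continuous_on_compose2[OF continuous_on_tf_shift]) (auto intro!: continuous_intros)
  then show "continuous_on UNIV (ft_box a b)"
    unfolding ft_box_eq_cinner[abs_def] by (intro continuous_on_cinner continuous_intros)
qed

lemma ft_box_bounded:
  obtains M where "M > 0" "\<And>t. cmod (ft_box a b t) \<le> M"
proof -
  let ?p = "abs_L2 (indicator (box a b)) :: 'a L2"
  have "cmod (ft_box a b t) \<le> norm ?p * norm ?p" for t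
    using cinner_bound[of "tf_shift (0, - t) ?p" ?p] by (simp add: ft_box_eq_cinner)
  then show ?thesis
    by (intro that[of "norm ?p * norm ?p + 1"]) (auto intro: add_nonneg_pos add_increasing2)
qed

lemma ft_box_decay:
  assumes "e > 0"
  obtains R where "R > 0" "\<And>t. norm t \<ge> R \<Longrightarrow> cmod (ft_box a b t) < e"
proof -
  let ?p = "abs_L2 (indicator (box a b)) :: 'a L2"
  have "\<forall>\<^sub>F \<omega> in at_infinity. dist (cinner (tf_shift (0, \<omega>) ?p) ?p) 0 < e"
    using modulation_tendsto_0 assms by (rule tendstoD)
  then obtain R where R: "\<And>\<omega>. norm \<omega> \<ge> R \<Longrightarrow> cmod (cinner (tf_shift (0, \<omega>) ?p) ?p) < e"
    unfolding eventually_at_infinity by (auto simp: dist_norm)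
  show ?thesis
    by (rule that[of "max R 1"]) (auto simp: ft_box_eq_cinner intro!: R)
qed

text \<open>The symbol is now the indicator of a box in phase space, which is the product of \<open>time_box\<close> with a box of
  frequencies; \<open>freq_ft\<close> is the Fourier transform of the indicator of the latter.\<close>

context
  fixes s :: real and a b :: "'a::euclidean_space \<times> 'a"
  assumes s: "0 < s" "s < 1"
begin

abbreviation (input) "time_box \<equiv> box (fst a) (fst b)"
abbreviation (input) "freq_ft \<equiv> ft_box (snd a) (snd b)"

text \<open>For each \<open>x\<close>, exchanging the integrals over \<open>\<omega>\<close> and \<open>t\<close> collects the exponentials into the Fourier
  transform of the indicator of the frequency side of the box.\<close>

lemma symbol_form_box:
  assumes g: "sq_integrable g" and h: "sq_integrable h"
  shows "symbol_form s (indicator (box a b)) (abs_L2 g) (abs_L2 h) =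
      (\<integral>x. indicator time_box x * (\<integral>t. freq_ft t * (g (x + s *\<^sub>R t) * cnj (h (x - (1 - s) *\<^sub>R t))) \<partial>lborel) \<partial>lborel)" (is ?eq)
    and "integrable lborel (\<lambda>x. indicator time_box x * (\<integral>t. freq_ft t * (g (x + s *\<^sub>R t) * cnj (h (x - (1 - s) *\<^sub>R t))) \<partial>lborel))" (is ?int)
proof -
  let ?P = "box (snd a) (snd b)"
  let ?w = "cwig s (abs_L2 g) (abs_L2 h)"
  have [measurable]: "g \<in> borel_measurable borel" "h \<in> borel_measurable borel"
    using g h by (simp_all add: sq_integrable_measurable)
  have "Lp 1 (indicator (box a b) :: 'a \<times> 'a \<Rightarrow> complex)" by (intro Lp_indicator_bounded) auto
  then have ib: "integrable lborel (indicator (box a b) :: 'a \<times> 'a \<Rightarrow> complex)"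
    unfolding integrable_iff_Lp .
  have "Lp 1 (indicator ?P :: 'a \<Rightarrow> complex)" by (intro Lp_indicator_bounded) auto
  then have iP: "integrable lborel (indicator ?P :: 'a \<Rightarrow> complex)"
    unfolding integrable_iff_Lp .
  have split: "indicator (box a b) (x, \<omega>) = (indicator time_box x * indicator ?P \<omega> :: complex)" for x \<omega>
    by (auto simp: indicator_def box_prod)
  have inner: "(\<integral>\<omega>. indicator (box a b) (x, \<omega>) * ?w (x, \<omega>) \<partial>lborel) =
      indicator time_box x * (\<integral>t. freq_ft t * (g (x + s *\<^sub>R t) * cnj (h (x - (1 - s) *\<^sub>R t))) \<partial>lborel)" for x
  proof -
    define k where "k t = g (x + s *\<^sub>R t) * cnj (h (x - (1 - s) *\<^sub>R t))" for t
    have k: "integrable lborel k"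
      unfolding k_def by (rule wig_integrand_integrable[OF s g h])
    have [measurable]: "k \<in> borel_measurable borel" unfolding k_def by measurable
    have int: "integrable (lborel \<Otimes>\<^sub>M lborel) (\<lambda>(\<omega>, t). indicator ?P \<omega> * (cis (- 2 * pi * (t \<bullet> \<omega>)) * k t))"
    proof (rule Bochner_Integration.integrable_bound)
      show "integrable (lborel \<Otimes>\<^sub>M lborel) (\<lambda>z. indicator ?P (fst z) * k (snd z))"
        using integrable_tensor[OF iP k] by (simp add: lborel_prod)
      show "(\<lambda>(\<omega>, t). indicator ?P \<omega> * (cis (- 2 * pi * (t \<bullet> \<omega>)) * k t)) \<in> borel_measurable (lborel \<Otimes>\<^sub>M lborel)"
        by measurable
    qed (auto simp: norm_mult)
    have "(\<integral>\<omega>. indicator (box a b) (x, \<omega>) * ?w (x, \<omega>) \<partial>lborel) =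
        (\<integral>\<omega>. indicator time_box x * (\<integral>t. indicator ?P \<omega> * (cis (- 2 * pi * (t \<bullet> \<omega>)) * k t) \<partial>lborel) \<partial>lborel)"
      by (simp add: split cwig_abs_L2[OF s g h] k_def mult.assoc)
    also have "\<dots> = indicator time_box x * (\<integral>\<omega>. \<integral>t. indicator ?P \<omega> * (cis (- 2 * pi * (t \<bullet> \<omega>)) * k t) \<partial>lborel \<partial>lborel)"
      by (rule integral_mult_right_zero)
    also have "(\<integral>\<omega>. \<integral>t. indicator ?P \<omega> * (cis (- 2 * pi * (t \<bullet> \<omega>)) * k t) \<partial>lborel \<partial>lborel) =
        (\<integral>t. \<integral>\<omega>. indicator ?P \<omega> * (cis (- 2 * pi * (t \<bullet> \<omega>)) * k t) \<partial>lborel \<partial>lborel)"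
      by (rule lborel_pair.Fubini_integral[OF int, symmetric])
    also have "\<dots> = (\<integral>t. freq_ft t * k t \<partial>lborel)"
      unfolding ft_box_def by (simp only: mult.assoc[symmetric] integral_mult_left_zero)
    finally show ?thesis by (simp only: k_def)
  qed
  have int: "integrable (lborel \<Otimes>\<^sub>M lborel) (\<lambda>z. indicator (box a b) z * ?w z)"
    using integrable_mult_cwig[OF s ib] by (simp add: lborel_prod)
  show ?eq
    using lborel_pair.integral_fst'[OF int] by (simp add: symbol_form_def inner lborel_prod)
  show ?int
    using lborel_pair.integrable_fst'[OF int] by (simp add: inner)
qed

text \<open>The integral kernel in the variables \<open>(w, y)\<close>, where \<open>x = s w + (1 - s) y\<close> and \<open>t = y - w\<close>; the
  Fourier transform is cut off at radius \<open>R\<close>.\<close>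

definition cut_kernel :: "real \<Rightarrow> 'a \<times> 'a \<Rightarrow> complex" where
  "cut_kernel R z = indicator time_box (s *\<^sub>R fst z + (1 - s) *\<^sub>R snd z) *
     (indicator (ball 0 R) (snd z - fst z) * freq_ft (snd z - fst z))"

text \<open>The kernel is bounded, and bounds on \<open>x\<close> and \<open>t\<close> confine \<open>w\<close> and \<open>y\<close>.\<close>

lemma Lp_cut_kernel: "Lp 2 (cut_kernel R)"
proof -
  obtain M where M: "M > 0" "\<And>t. cmod (freq_ft t) \<le> M" using ft_box_bounded by blast
  obtain B where B: "B > 0" "\<And>x. x \<in> time_box \<Longrightarrow> norm x \<le> B"
    using bounded_box[of "fst a" "fst b"] unfolding bounded_pos by blast
  let ?D = "cball 0 (2 * (B + \<bar>R\<bar>)) :: ('a \<times> 'a) set"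
  have "Lp 2 (\<lambda>z. of_real M * (indicator ?D z :: complex))"
    by (intro Lp_cmult Lp_indicator_bounded) auto
  then show ?thesis
  proof (rule Lp_bound[OF Lp_integrable])
    have [measurable]: "time_box \<in> sets borel" "ball 0 R \<in> sets (borel :: 'a measure)" by auto
    show "cut_kernel R \<in> borel_measurable borel"
      unfolding cut_kernel_def[abs_def] borel_prod[symmetric] by measurable
    fix z :: "'a \<times> 'a"
    have "cmod (cut_kernel R z) \<le> cmod (of_real M * indicator ?D z)"
    proof (cases "s *\<^sub>R fst z + (1 - s) *\<^sub>R snd z \<in> time_box \<and> snd z - fst z \<in> ball 0 R")
      case True
      define x t where "x = s *\<^sub>R fst z + (1 - s) *\<^sub>R snd z" and "t = snd z - fst z"
      have le: "norm x \<le> B" "norm t \<le> \<bar>R\<bar>" using True B(2) by (auto simp: x_def t_def)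
      have z: "z = (x - (1 - s) *\<^sub>R t, x + s *\<^sub>R t)"
        by (cases z) (simp add: x_def t_def algebra_simps)
      have "norm ((1 - s) *\<^sub>R t) \<le> 1 * \<bar>R\<bar>" "norm (s *\<^sub>R t) \<le> 1 * \<bar>R\<bar>"
        using s le unfolding norm_scaleR by (intro mult_mono; simp)+
      then have "norm (x - (1 - s) *\<^sub>R t) \<le> B + \<bar>R\<bar>" "norm (x + s *\<^sub>R t) \<le> B + \<bar>R\<bar>"
        using le norm_triangle_ineq4[of x "(1 - s) *\<^sub>R t"] norm_triangle_ineq[of x "s *\<^sub>R t"] by linarith+
      from order_trans[OF norm_Pair_le add_mono[OF this]] have "norm z \<le> 2 * (B + \<bar>R\<bar>)"
        unfolding z by (simp only: mult_2)
      then show ?thesis using True M by (simp add: cut_kernel_def norm_mult)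
    qed (auto simp: cut_kernel_def)
    then show "cmod (cut_kernel R z) ^ 2 \<le> cmod (of_real M * indicator ?D z) ^ 2"
      by (intro power_mono) auto
  qed
qed

lemma kernel_form_cut:
  assumes g: "g = rep_L2 \<phi>" and h: "h = rep_L2 \<psi>"
  shows "cinner (abs_L2 (cut_kernel R)) (tensor_cnj \<psi> \<phi>) =
      (\<integral>x. indicator time_box x * (\<integral>t. (indicator (ball 0 R) t * freq_ft t) * (g (x + s *\<^sub>R t) * cnj (h (x - (1 - s) *\<^sub>R t))) \<partial>lborel) \<partial>lborel)" (is ?eq)
    and "integrable lborel (\<lambda>x. indicator time_box x * (\<integral>t. (indicator (ball 0 R) t * freq_ft t) * (g (x + s *\<^sub>R t) * cnj (h (x - (1 - s) *\<^sub>R t))) \<partial>lborel))" (is ?int)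
proof -
  have sq: "sq_integrable g" "sq_integrable h" by (simp_all add: g h sq_integrable_rep_L2)
  have sqK: "sq_integrable (cut_kernel R)" using Lp_cut_kernel by (simp add: sq_integrable_iff_Lp)
  have sqT: "sq_integrable (\<lambda>z. h (fst z) * cnj (g (snd z)))"
    by (intro sq_integrable_tensor sq sq_integrable_cnj)
  define H where "H z = cut_kernel R z * cnj (h (fst z) * cnj (g (snd z)))" for z
  have H: "integrable lborel H" unfolding H_def by (rule integrable_mult_cnj[OF sqK sqT])
  let ?M = "\<lambda>z :: 'a \<times> 'a. (fst z - (1 - s) *\<^sub>R snd z, fst z + s *\<^sub>R snd z)"
  have HM: "H (?M (x, t)) = indicator time_box x * ((indicator (ball 0 R) t * freq_ft t) * (g (x + s *\<^sub>R t) * cnj (h (x - (1 - s) *\<^sub>R t))))" for x t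
  proof -
    have "s *\<^sub>R (x - (1 - s) *\<^sub>R t) + (1 - s) *\<^sub>R (x + s *\<^sub>R t) = x"
      "x + s *\<^sub>R t - (x - (1 - s) *\<^sub>R t) = t"
      by (simp_all add: algebra_simps)
    then show ?thesis by (simp add: H_def cut_kernel_def mult_ac)
  qed
  have int: "integrable (lborel \<Otimes>\<^sub>M lborel) (\<lambda>z. H (?M z))"
    using integrable_wigner_coords[OF H] by (simp add: lborel_prod)
  have inner: "(\<integral>t. H (?M (x, t)) \<partial>lborel) =
      indicator time_box x * (\<integral>t. (indicator (ball 0 R) t * freq_ft t) * (g (x + s *\<^sub>R t) * cnj (h (x - (1 - s) *\<^sub>R t))) \<partial>lborel)" for x
    unfolding HM by (rule integral_mult_right_zero)
  have "cinner (abs_L2 (cut_kernel R)) (tensor_cnj \<psi> \<phi>) = (\<integral>z. H z \<partial>lborel)"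
    unfolding tensor_cnj_def g[symmetric] h[symmetric] H_def by (rule cinner_abs_L2[OF sqK sqT])
  also have "\<dots> = (\<integral>z. H (?M z) \<partial>(lborel \<Otimes>\<^sub>M lborel))"
    using integral_wigner_coords[OF H] by (simp add: lborel_prod)
  also have "\<dots> = (\<integral>x. \<integral>t. H (?M (x, t)) \<partial>lborel \<partial>lborel)"
    by (rule lborel_pair.integral_fst'[OF int, symmetric])
  finally show ?eq by (simp only: inner)
  show ?int using lborel_pair.integrable_fst'[OF int] by (simp only: inner)
qed

text \<open>The cut removes only the part of the integral over \<open>t\<close> with \<open>|t| \<ge> R\<close>. For each \<open>x\<close> that part is at
  most \<open>e\<close> times the Cauchy--Schwarz bound, and \<open>x\<close> ranges over a set of finite measure.\<close>

lemma cut_kernel_approx: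
  assumes R: "\<And>t. norm t \<ge> R \<Longrightarrow> cmod (freq_ft t) \<le> e" and e: "e \<ge> 0"
  shows "cmod (symbol_form s (indicator (box a b)) \<phi> \<psi> - cinner (abs_L2 (cut_kernel R)) (tensor_cnj \<psi> \<phi>))
    \<le> measure lborel time_box * (e * (wig_const TYPE('a) s * norm \<phi> * norm \<psi>))"
proof -
  define g h where "g = rep_L2 \<phi>" and "h = rep_L2 \<psi>"
  have sq: "sq_integrable g" "sq_integrable h" by (simp_all add: g_def h_def sq_integrable_rep_L2)
  have gh: "\<phi> = abs_L2 g" "\<psi> = abs_L2 h" by (simp_all add: g_def h_def)
  define k where "k x t = g (x + s *\<^sub>R t) * cnj (h (x - (1 - s) *\<^sub>R t))" for x t
  let ?W = "wig_const TYPE('a) s * norm \<phi> * norm \<psi>"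
  obtain M where M: "M > 0" "\<And>t. cmod (freq_ft t) \<le> M" using ft_box_bounded by blast
  have [measurable]: "g \<in> borel_measurable borel" "h \<in> borel_measurable borel"
    using sq by (simp_all add: sq_integrable_measurable)
  have [measurable]: "k x \<in> borel_measurable borel" for x unfolding k_def by measurable
  have ik: "integrable lborel (\<lambda>t. cmod (k x t))" and bk: "(\<integral>t. cmod (k x t) \<partial>lborel) \<le> ?W" for x
    using wig_integrand_bound[OF s sq, of x] by (simp_all add: k_def norm_mult gh)
  have iFk: "integrable lborel (\<lambda>t. G t * k x t)"
    if [measurable]: "G \<in> borel_measurable borel" and G: "\<And>t. cmod (G t) \<le> M" for x G
  proof (rule Bochner_Integration.integrable_bound)
    show "integrable lborel (\<lambda>t. M * cmod (k x t))" using ik by (rule integrable_mult_right)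
    show "AE t in lborel. norm (G t * k x t) \<le> norm (M * cmod (k x t))"
      using G M by (auto simp: norm_mult abs_mult intro!: mult_right_mono)
  qed measurable
  have Rm: "cmod (indicator (ball 0 R) t * freq_ft t) \<le> M" for t
    using M by (auto simp: indicator_def less_imp_le)
  have FR: "(\<lambda>t. indicator (ball 0 R) t * freq_ft t) \<in> borel_measurable borel"
    by (intro borel_measurable_times borel_measurable_indicator measurable_ft_box) auto
  note A = symbol_form_box[OF sq, folded gh k_def] and B = kernel_form_cut[OF g_def h_def, of R, folded k_def]
  have diff: "(\<integral>t. freq_ft t * k x t \<partial>lborel) - (\<integral>t. (indicator (ball 0 R) t * freq_ft t) * k x t \<partial>lborel) =
      (\<integral>t. (freq_ft t - indicator (ball 0 R) t * freq_ft t) * k x t \<partial>lborel)" for x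
    using iFk[OF measurable_ft_box M(2), of x] iFk[OF FR Rm, of x]
    by (subst Bochner_Integration.integral_diff[symmetric]) (auto simp: left_diff_distrib)
  have tail: "cmod (\<integral>t. (freq_ft t - indicator (ball 0 R) t * freq_ft t) * k x t \<partial>lborel) \<le> e * ?W" for x
  proof -
    have "cmod (\<integral>t. (freq_ft t - indicator (ball 0 R) t * freq_ft t) * k x t \<partial>lborel) \<le>
        (\<integral>t. e * cmod (k x t) \<partial>lborel)"
    proof (rule Bochner_Integration.integral_norm_bound_integral)
      have "cmod (freq_ft t - indicator (ball 0 R) t * freq_ft t) \<le> e" for t
        using R[of t] e by (cases "norm t < R") auto
      then show "norm ((freq_ft t - indicator (ball 0 R) t * freq_ft t) * k x t) \<le> e * cmod (k x t)" for t
        by (simp add: norm_mult mult_right_mono)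
      have "cmod (freq_ft t - indicator (ball 0 R) t * freq_ft t) \<le> M" for t
        using M by (auto simp: indicator_def less_imp_le)
      then show "integrable lborel (\<lambda>t. (freq_ft t - indicator (ball 0 R) t * freq_ft t) * k x t)"
        by (intro iFk borel_measurable_diff FR measurable_ft_box)
    qed (use ik in simp)
    also have "\<dots> = e * (\<integral>t. cmod (k x t) \<partial>lborel)" by simp
    also have "\<dots> \<le> e * ?W" using bk e by (intro mult_left_mono)
    finally show ?thesis .
  qed
  have "symbol_form s (indicator (box a b)) \<phi> \<psi> - cinner (abs_L2 (cut_kernel R)) (tensor_cnj \<psi> \<phi>) =
      (\<integral>x. indicator time_box x * (\<integral>t. (freq_ft t - indicator (ball 0 R) t * freq_ft t) * k x t \<partial>lborel) \<partial>lborel)"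
    unfolding A(1) B(1) diff[symmetric] right_diff_distrib
    by (rule Bochner_Integration.integral_diff[OF A(2) B(2), symmetric])
  also have "cmod \<dots> \<le> (\<integral>x. indicator time_box x * (e * ?W) \<partial>lborel)"
  proof (rule Bochner_Integration.integral_norm_bound_integral)
    show "integrable lborel (\<lambda>x. indicator time_box x * (\<integral>t. (freq_ft t - indicator (ball 0 R) t * freq_ft t) * k x t \<partial>lborel))"
      unfolding diff[symmetric] right_diff_distrib
      by (rule Bochner_Integration.integrable_diff[OF A(2) B(2)])
    show "integrable lborel (\<lambda>x. indicator time_box x * (e * ?W))"
      by (intro integrable_mult_left) (auto simp: integrable_indicator_iff emeasure_lborel_box_eq)
    show "norm (indicator time_box x * (\<integral>t. (freq_ft t - indicator (ball 0 R) t * freq_ft t) * k x t \<partial>lborel)) \<le> indicator time_box x * (e * ?W)" for x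
      using tail[of x] by (auto simp: indicator_def)
  qed
  also have "\<dots> = measure lborel time_box * (e * ?W)" by simp
  finally show ?thesis .
qed

lemma compact_form_box: "compact_form (symbol_form s (indicator (box a b)))"
proof (rule compact_form_limit)
  fix e :: real assume e: "e > 0"
  define C where "C = measure lborel time_box * wig_const TYPE('a) s + 1"
  have C: "C > 0" using wig_const_pos[OF s, where 'a='a]
    unfolding C_def by (intro add_nonneg_pos mult_nonneg_nonneg) auto
  then have "e / C > 0" using e by simp
  then obtain R where R: "R > 0" "\<And>t. norm t \<ge> R \<Longrightarrow> cmod (freq_ft t) < e / C" using ft_box_decay by blast
  show "\<exists>b'. compact_form b' \<and>
      (\<forall>\<phi> \<psi>. cmod (symbol_form s (indicator (box a b)) \<phi> \<psi> - b' \<phi> \<psi>) \<le> e * norm \<phi> * norm \<psi>)"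
  proof (intro exI conjI allI)
    show "compact_form (\<lambda>\<phi> \<psi>. cinner (abs_L2 (cut_kernel R)) (tensor_cnj \<psi> \<phi>))"
      by (rule compact_form_Hilbert_Schmidt[OF Lp_cut_kernel])
    fix \<phi> \<psi> :: "'a L2"
    have "cmod (symbol_form s (indicator (box a b)) \<phi> \<psi> - cinner (abs_L2 (cut_kernel R)) (tensor_cnj \<psi> \<phi>))
        \<le> measure lborel time_box * (e / C * (wig_const TYPE('a) s * norm \<phi> * norm \<psi>))"
      using R(2) \<open>e / C > 0\<close> by (intro cut_kernel_approx) (auto intro: less_imp_le)
    also have "\<dots> = (C - 1) * (e / C * (norm \<phi> * norm \<psi>))" by (simp add: C_def)
    also have "\<dots> \<le> C * (e / C * (norm \<phi> * norm \<psi>))"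
      using \<open>e / C > 0\<close> by (intro mult_right_mono mult_nonneg_nonneg) auto
    also have "\<dots> = e * norm \<phi> * norm \<psi>" using C by simp
    finally show "cmod (symbol_form s (indicator (box a b)) \<phi> \<psi> - cinner (abs_L2 (cut_kernel R)) (tensor_cnj \<psi> \<phi>))
        \<le> e * norm \<phi> * norm \<psi>" .
  qed
qed

end

lemma symbol_form_diff:
  assumes s: "0 < s" "s < 1" and f: "integrable lborel f" and g: "integrable lborel g"
  shows "symbol_form s f \<phi> \<psi> - symbol_form s g \<phi> \<psi> = symbol_form s (\<lambda>z. f z - g z) \<phi> \<psi>"
  unfolding symbol_form_def left_diff_distrib
  by (rule Bochner_Integration.integral_diff[symmetric]) (intro integrable_mult_cwig[OF s] f g)+

theorem compact_form_symbol:
  fixes f :: "'a::euclidean_space \<times> 'a \<Rightarrow> complex"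
  assumes s: "0 < s" "s < 1" and f: "integrable lborel f"
  shows "compact_form (symbol_form s f)"
  using zero_less_one f[unfolded integrable_iff_Lp]
proof (induction f rule: Lp_box_induct)
  case (box a b)
  show ?case by (rule compact_form_box[OF s])
next
  case (add f g)
  from compact_form_add[OF add.IH] show ?case
  proof (rule compact_form_cong)
    show "symbol_form s (\<lambda>x. f x + g x) \<phi> \<psi> = symbol_form s f \<phi> \<psi> + symbol_form s g \<phi> \<psi>" for \<phi> \<psi>
      using add.hyps unfolding symbol_form_def distrib_right integrable_iff_Lp[symmetric]
      by (intro Bochner_Integration.integral_add integrable_mult_cwig[OF s])
  qed
next
  case (cmult f c)
  from compact_form_cmult[OF cmult.IH, of c] show ?case
    by (rule compact_form_cong) (simp add: symbol_form_def mult.assoc)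
next
  case (lim u f)
  note int = lim.hyps(1,2)[folded integrable_iff_Lp]
  let ?K = "wig_const TYPE('a) s"
  show ?case
  proof (rule compact_form_limit)
    fix e :: real assume e: "e > 0"
    have "(\<lambda>n. ?K * (\<integral>x. cmod (u n x - f x) ^ 1 \<partial>lborel)) \<longlonglongrightarrow> 0"
      by (rule tendsto_mult_right_zero[OF lim.hyps(3)])
    then have "\<forall>\<^sub>F n in sequentially. ?K * (\<integral>x. cmod (u n x - f x) ^ 1 \<partial>lborel) < e"
      using e by (rule order_tendstoD(2))
    then obtain n where n: "?K * (\<integral>x. cmod (u n x - f x) \<partial>lborel) < e"
      by (auto simp: eventually_sequentially)
    show "\<exists>b'. compact_form b' \<and> (\<forall>\<phi> \<psi>. cmod (symbol_form s f \<phi> \<psi> - b' \<phi> \<psi>) \<le> e * norm \<phi> * norm \<psi>)"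
    proof (intro exI[of _ "symbol_form s (u n)"] conjI allI lim.IH)
      fix \<phi> \<psi> :: "'a L2"
      have "cmod (symbol_form s f \<phi> \<psi> - symbol_form s (u n) \<phi> \<psi>) \<le>
          ?K * (\<integral>z. cmod (f z - u n z) \<partial>lborel) * norm \<phi> * norm \<psi>"
        using int unfolding symbol_form_diff[OF s int(2) int(1)]
        by (intro symbol_form_bound[OF s] Bochner_Integration.integrable_diff)
      also have "\<dots> \<le> e * norm \<phi> * norm \<psi>"
        using n by (intro mult_right_mono) (auto simp: norm_minus_commute)
      finally show "cmod (symbol_form s f \<phi> \<psi> - symbol_form s (u n) \<phi> \<psi>) \<le> e * norm \<phi> * norm \<psi>" .
    qed
  qed
qed

section \<open>The Gaussian, polarization, and the conclusion\<close>

lemma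
  fixes f :: "'a::euclidean_space \<Rightarrow> real \<Rightarrow> 'b::{real_normed_field, banach, second_countable_topology}"
  assumes f: "\<And>b. b \<in> Basis \<Longrightarrow> integrable lborel (f b)"
  shows integrable_lborel_prod: "integrable lborel (\<lambda>x. \<Prod>b\<in>Basis. f b (x \<bullet> b))"
    and integral_lborel_prod: "(\<integral>x. (\<Prod>b\<in>Basis. f b (x \<bullet> b)) \<partial>lborel) = (\<Prod>b\<in>Basis. \<integral>u. f b u \<partial>lborel)"
proof -
  interpret product_sigma_finite "\<lambda>b :: 'a. lborel :: real measure" by standard
  let ?T = "\<lambda>g. \<Sum>b\<in>(Basis :: 'a set). g b *\<^sub>R b"
  have T: "?T \<in> (\<Pi>\<^sub>M b\<in>Basis. lborel) \<rightarrow>\<^sub>M borel" by measurable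
  have [measurable]: "f b \<in> borel_measurable borel" if "b \<in> Basis" for b using f[OF that] by auto
  have m: "(\<lambda>x. \<Prod>b\<in>Basis. f b (x \<bullet> b)) \<in> borel_measurable borel"
    by (intro borel_measurable_prod) measurable
  have eq: "(\<Prod>b\<in>Basis. f b (?T g \<bullet> b)) = (\<Prod>b\<in>Basis. f b (g b))" for g
    by (intro prod.cong) simp_all
  show "integrable lborel (\<lambda>x. \<Prod>b\<in>Basis. f b (x \<bullet> b))"
    using product_integrable_prod[OF finite_Basis f]
    by (subst lborel_eq, subst integrable_distr_eq[OF T m]) (simp only: eq)
  show "(\<integral>x. (\<Prod>b\<in>Basis. f b (x \<bullet> b)) \<partial>lborel) = (\<Prod>b\<in>Basis. \<integral>u. f b u \<partial>lborel)"
    using product_integral_prod[OF finite_Basis f]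
    by (subst lborel_eq, subst integral_distr[OF T m]) (simp only: eq)
qed

lemma integrable_exp_square: "integrable lborel (\<lambda>v :: real. exp (- v\<^sup>2 / 2))"
proof -
  have "integrable lborel (\<lambda>v. sqrt (2 * pi) * std_normal_density v)"
    by (intro integrable_mult_right integrable_normal_density) simp
  then show ?thesis by (simp add: std_normal_density_def)
qed

text \<open>Up to a constant this is the characteristic function of the standard normal distribution, again a Gaussian.\<close>

lemma fourier_gaussian_nonzero:
  "(\<integral>v. complex_of_real (exp (- v\<^sup>2 / 2)) * cis (w * v) \<partial>lborel) \<noteq> 0"
proof -
  have "char std_normal_distribution w = (\<integral>v. std_normal_density v *\<^sub>R cis (w * v) \<partial>lborel)"
    unfolding char_def by (subst integral_density) (auto simp: cis_conv_exp)
  also have "\<dots> = complex_of_real (1 / sqrt (2 * pi)) *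
      (\<integral>v. complex_of_real (exp (- v\<^sup>2 / 2)) * cis (w * v) \<partial>lborel)"
    by (subst integral_mult_right_zero[symmetric])
      (simp add: std_normal_density_def scaleR_conv_of_real mult.assoc)
  finally show ?thesis by (auto simp: char_std_normal_distribution)
qed

lemma
  fixes a w :: real
  defines "G \<equiv> \<lambda>u. complex_of_real (exp (- u\<^sup>2 / 4) * exp (- (u - a)\<^sup>2 / 4)) * cis (w * u)"
  shows integrable_gaussian_overlap: "integrable lborel G"
    and integral_gaussian_overlap_nonzero: "(\<integral>u. G u \<partial>lborel) \<noteq> 0"
proof -
  let ?E = "\<lambda>v. complex_of_real (exp (- v\<^sup>2 / 2)) * cis (w * v)"
  let ?c = "complex_of_real (exp (- a\<^sup>2 / 8)) * cis (w * (a / 2))"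
  have [measurable]: "G \<in> borel_measurable borel" unfolding G_def by measurable
  \<comment> \<open>completing the square: both factors are centred at the midpoint\<close>
  have shift: "G (a / 2 + 1 *\<^sub>R v) = ?c * ?E v" for v
  proof -
    have "- (a / 2 + v)\<^sup>2 / 4 + - (a / 2 + v - a)\<^sup>2 / 4 = - a\<^sup>2 / 8 + - v\<^sup>2 / 2"
      by (simp add: power2_eq_square field_simps)
    then have "exp (- (a / 2 + v)\<^sup>2 / 4) * exp (- (a / 2 + v - a)\<^sup>2 / 4) = exp (- a\<^sup>2 / 8) * exp (- v\<^sup>2 / 2)"
      by (simp only: exp_add[symmetric])
    moreover have "cis (w * (a / 2 + v)) = cis (w * (a / 2)) * cis (w * v)"
      by (simp add: cis_mult distrib_left)
    ultimately show ?thesis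
      by (simp only: G_def real_scaleR_def mult_1_left) (simp only: of_real_mult mult_ac)
  qed
  have "integrable lborel ?E"
    by (rule Bochner_Integration.integrable_bound[OF integrable_exp_square]) (auto simp: norm_mult)
  then have "integrable lborel (\<lambda>v. G (a / 2 + 1 *\<^sub>R v))"
    unfolding shift by (rule integrable_mult_right)
  then show "integrable lborel G" by (subst (asm) integrable_affine_iff) simp_all
  have "(\<integral>u. G u \<partial>lborel) = (\<integral>v. G (a / 2 + 1 *\<^sub>R v) \<partial>lborel)"
    by (subst integral_affine) simp_all
  also have "\<dots> = ?c * (\<integral>v. ?E v \<partial>lborel)" unfolding shift by (rule integral_mult_right_zero)
  finally show "(\<integral>u. G u \<partial>lborel) \<noteq> 0" using fourier_gaussian_nonzero[of w] by simp
qed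

lemma of_real_exp_neg_inner_self:
  "complex_of_real (exp (- (t \<bullet> t) / c)) = (\<Prod>b\<in>Basis. complex_of_real (exp (- (t \<bullet> b)\<^sup>2 / c)))"
  for t :: "'a::euclidean_space"
proof -
  have "- (t \<bullet> t) / c = (\<Sum>b\<in>Basis. - (t \<bullet> b)\<^sup>2 / c)"
    by (subst euclidean_inner) (simp add: power2_eq_square sum_negf sum_divide_distrib)
  then show ?thesis by (simp only: exp_sum[OF finite_Basis] of_real_prod)
qed

lemma cis_inner: "cis (r * (\<omega> \<bullet> t)) = (\<Prod>b\<in>Basis. cis ((r * (\<omega> \<bullet> b)) * (t \<bullet> b)))"
  for t :: "'a::euclidean_space"
proof -
  have "\<i> * complex_of_real (r * (\<omega> \<bullet> t)) = (\<Sum>b\<in>Basis. \<i> * complex_of_real ((r * (\<omega> \<bullet> b)) * (t \<bullet> b)))"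
    by (subst euclidean_inner) (simp add: sum_distrib_left mult_ac)
  then show ?thesis unfolding cis_conv_exp by (simp only: exp_sum[OF finite_Basis])
qed

text \<open>The variance is chosen such that the product of two translates is a multiple of a translate of
  \<open>exp (-|v|\<^sup>2 / 2)\<close>.\<close>

definition gaussian :: "'a::euclidean_space \<Rightarrow> complex" where
  "gaussian t = complex_of_real (exp (- (t \<bullet> t) / 4))"

lemma sq_integrable_gaussian: "sq_integrable gaussian"
proof -
  have "(cmod (gaussian t))\<^sup>2 = cmod (complex_of_real (exp (- (t \<bullet> t) / 2)))" for t :: 'a
    by (simp add: gaussian_def power2_eq_square exp_add[symmetric])
  moreover have "integrable lborel (\<lambda>t :: 'a. complex_of_real (exp (- (t \<bullet> t) / 2)))"
    unfolding of_real_exp_neg_inner_self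
    by (rule integrable_lborel_prod[of "\<lambda>_ u. complex_of_real (exp (- u\<^sup>2 / 2))"])
      (intro integrable_of_real integrable_exp_square)
  moreover have "(gaussian :: 'a \<Rightarrow> complex) \<in> borel_measurable borel"
    unfolding gaussian_def[abs_def] by (intro borel_measurable_continuous_onI continuous_intros) auto
  ultimately show ?thesis by (simp only: sq_integrable_def integrable_norm) simp
qed

text \<open>The integrand is a product over the coordinates, and so the integral is a product of one-dimensional
  integrals, none of which is zero.\<close>

lemma STFT_gaussian_nonzero: "STFT (abs_L2 gaussian) (abs_L2 gaussian) z \<noteq> 0"
proof -
  obtain x \<omega> where z: "z = (x, \<omega>)" by force
  define G where "G b u = complex_of_real (exp (- u\<^sup>2 / 4) * exp (- (u - x \<bullet> b)\<^sup>2 / 4)) *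
      cis ((- 2 * pi * (\<omega> \<bullet> b)) * u)" for b u
  have "STFT (abs_L2 gaussian) (abs_L2 gaussian) z =
      (\<integral>t. gaussian t * cnj (cis (2 * pi * (\<omega> \<bullet> t)) * gaussian (t - x)) \<partial>lborel)"
    by (simp add: STFT_def z tf_shift_abs_L2 cinner_abs_L2 sq_integrable_gaussian sq_integrable_tf_shift)
  also have "\<dots> = (\<integral>t. (\<Prod>b\<in>Basis. G b (t \<bullet> b)) \<partial>lborel)"
  proof (intro Bochner_Integration.integral_cong refl)
    fix t
    have "gaussian t * cnj (cis (2 * pi * (\<omega> \<bullet> t)) * gaussian (t - x)) =
        gaussian t * gaussian (t - x) * cis (- 2 * pi * (\<omega> \<bullet> t))"
      by (simp add: gaussian_def cis_cnj mult_ac)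
    also have "\<dots> = (\<Prod>b\<in>Basis. G b (t \<bullet> b))"
      unfolding gaussian_def of_real_exp_neg_inner_self cis_inner[of "- 2 * pi" \<omega> t] prod.distrib[symmetric]
      by (simp only: G_def inner_diff_left of_real_mult)
    finally show "gaussian t * cnj (cis (2 * pi * (\<omega> \<bullet> t)) * gaussian (t - x)) = (\<Prod>b\<in>Basis. G b (t \<bullet> b))" .
  qed
  also have "\<dots> = (\<Prod>b\<in>Basis. \<integral>u. G b u \<partial>lborel)"
    unfolding G_def by (rule integral_lborel_prod) (rule integrable_gaussian_overlap)
  also have "\<dots> \<noteq> 0"
  proof -
    have "(\<integral>u. G b u \<partial>lborel) \<noteq> 0" for b
      unfolding G_def by (rule integral_gaussian_overlap_nonzero)
    then show ?thesis by simp
  qed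
  finally show ?thesis .
qed

text \<open>Polarization over the complex scalars: if \<open>\<langle>D \<phi>, \<phi>\<rangle> = 0\<close> on a complex subspace, then testing \<open>\<phi> + \<psi>\<close> and
  \<open>\<phi> + \<i> \<psi>\<close> gives \<open>\<langle>D \<phi>, \<psi>\<rangle> = 0\<close> there, and density with continuity gives \<open>D = 0\<close>.\<close>

lemma bounded_clinear_eqI:
  fixes A A' :: "'a::euclidean_space L2 \<Rightarrow> 'a L2"
  assumes A: "bounded_clinear A" "bounded_clinear A'"
    and eq: "\<And>g. g \<in> bumps \<Longrightarrow> cinner (A (abs_L2 g)) (abs_L2 g) = cinner (A' (abs_L2 g)) (abs_L2 g)"
  shows "A = A'"
proof -
  let ?V = "abs_L2 ` (bumps :: ('a \<Rightarrow> complex) set)"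
  define D where "D \<phi> = A \<phi> - A' \<phi>" for \<phi>
  have sqb: "sq_integrable g" if "g \<in> bumps" for g :: "'a \<Rightarrow> complex"
    using bumps_Lp[OF that, of 2] by (simp add: sq_integrable_iff_Lp)
  have D_add: "D (\<phi> + \<psi>) = D \<phi> + D \<psi>" for \<phi> \<psi>
    by (simp add: D_def bounded_clinear_add[OF A(1)] bounded_clinear_add[OF A(2)])
  have D_scale: "D (scaleC_L2 c \<phi>) = scaleC_L2 c (D \<phi>)" for c \<phi>
    by (simp add: D_def bounded_clinear_scaleC[OF A(1)] bounded_clinear_scaleC[OF A(2)]
        bounded_bilinear.diff_right[OF bounded_bilinear_scaleC])
  have D_cont: "continuous_on UNIV D"
    unfolding D_def[abs_def] using A
    by (intro continuous_on_diff linear_continuous_on) (auto simp: bounded_clinear_def)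
  have V_add: "\<phi> + \<psi> \<in> ?V" if "\<phi> \<in> ?V" "\<psi> \<in> ?V" for \<phi> \<psi>
    using that by (auto simp: plus_abs_L2 sqb intro!: imageI bumps_add)
  have V_scale: "scaleC_L2 c \<phi> \<in> ?V" if "\<phi> \<in> ?V" for c \<phi>
    using that by (auto simp: scaleC_abs_L2 sqb intro!: imageI bumps_cmult)
  have quad: "cinner (D \<phi>) \<phi> = 0" if "\<phi> \<in> ?V" for \<phi>
    using that eq by (auto simp: D_def cinner_diff_left)
  have skew: "cinner (D \<phi>) \<psi> + cinner (D \<psi>) \<phi> = 0" if "\<phi> \<in> ?V" "\<psi> \<in> ?V" for \<phi> \<psi>
    using quad[OF V_add[OF that]] quad[OF that(1)] quad[OF that(2)]
    by (simp add: D_add cinner_add_left cinner_add_right add.commute)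
  have V0: "cinner (D \<phi>) \<psi> = 0" if V: "\<phi> \<in> ?V" "\<psi> \<in> ?V" for \<phi> \<psi>
  proof -
    have "\<i> * (cinner (D \<psi>) \<phi> - cinner (D \<phi>) \<psi>) = 0"
      using skew[OF V(1) V_scale[OF V(2), of \<i>]]
      by (simp add: D_scale cinner_scaleC_left cinner_scaleC_right algebra_simps)
    then show ?thesis using skew[OF V] by simp
  qed
  have dense: "S = UNIV" if "closed S" "?V \<subseteq> S" for S :: "'a L2 set"
    using closure_minimal[OF that(2,1)] L2_closure_bumps by blast
  have DV: "D \<phi> = 0" if "\<phi> \<in> ?V" for \<phi>
  proof -
    have "{\<psi>. cinner (D \<phi>) \<psi> = 0} = UNIV"
    proof (rule dense)
      show "closed {\<psi>. cinner (D \<phi>) \<psi> = 0}"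
        by (intro closed_Collect_eq continuous_on_cinner continuous_intros)
    qed (use V0 that in auto)
    then have "cinner (D \<phi>) (D \<phi>) = 0" by auto
    then show ?thesis by (simp add: cinner_self_norm)
  qed
  have "{\<phi>. D \<phi> = 0} = UNIV"
    using DV by (intro dense closed_Collect_eq D_cont continuous_intros) auto
  then show "A = A'" by (auto simp: D_def fun_eq_iff)
qed

theorem proposition6p2:
  fixes \<tau> :: real
  assumes "0 < \<tau>" and "\<tau> < 1"
  shows "(\<exists>\<phi> :: (real ^ 'd) L2. (\<forall>z. STFT \<phi> \<phi> z \<noteq> 0) \<and> Q_distr (S_op \<tau>) \<phi> \<in> C0)
    \<and> (\<forall>\<psi> :: (real ^ 'd) L2. wigner \<tau> \<psi> = Q_distr (S_op \<tau>) \<psi> \<and> wigner \<tau> \<psi> \<in> C0)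
    \<and> (\<forall>f :: (real ^ 'd) \<times> (real ^ 'd) \<Rightarrow> complex. integrable lborel f \<longrightarrow>
         (\<exists>!A. is_weyl_quant \<tau> f A) \<and> (\<exists>!B. is_op_conv f (S_op (1 - \<tau>)) B) \<and>
         weyl_quant \<tau> f = op_conv f (S_op (1 - \<tau>)) \<and>
         compact_operator (weyl_quant \<tau> f))"
proof (intro conjI allI impI)
  have Q: "Q_distr (S_op \<tau>) \<psi> = cwig \<tau> \<psi> \<psi>" for \<psi> :: "(real ^ 'd) L2"
    by (simp add: fun_eq_iff Q_distr_def cwig_def)
  show "\<exists>\<phi> :: (real ^ 'd) L2. (\<forall>z. STFT \<phi> \<phi> z \<noteq> 0) \<and> Q_distr (S_op \<tau>) \<phi> \<in> C0"
    using STFT_gaussian_nonzero cwig_C0[OF assms] unfolding Q by blast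
  fix \<psi> :: "(real ^ 'd) L2"
  show W: "wigner \<tau> \<psi> = Q_distr (S_op \<tau>) \<psi>"
    by (rule wigner_eq_Q_distr[OF assms])
  show "wigner \<tau> \<psi> \<in> C0"
    unfolding W Q by (rule cwig_C0[OF assms])
next
  fix f :: "(real ^ 'd) \<times> (real ^ 'd) \<Rightarrow> complex"
  assume f: "integrable lborel f"
  have s: "0 < 1 - \<tau>" "1 - \<tau> < 1" using assms by auto
  obtain B where B: "compact_operator B" "\<And>\<phi> \<psi>. cinner (B \<phi>) \<psi> = symbol_form (1 - \<tau>) f \<phi> \<psi>"
    using compact_form_symbol[OF s f] unfolding compact_form_def by blast
  have cl: "bounded_clinear B" using B(1) by (simp add: compact_operator_def)
  have conv: "is_op_conv f (S_op (1 - \<tau>)) B"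
    using cl B(2) by (simp add: is_op_conv_def symbol_form_def cwig_def)
  have conv_unique: "B' = B" if "is_op_conv f (S_op (1 - \<tau>)) B'" for B'
  proof
    fix \<phi>
    show "B' \<phi> = B \<phi>"
      using that conv by (intro L2_eqI) (simp add: is_op_conv_def)
  qed
  have weyl: "is_weyl_quant \<tau> f B"
    unfolding is_weyl_quant_def
  proof (intro conjI allI impI cl)
    fix g :: "real ^ 'd \<Rightarrow> complex"
    have "cnj (wigner \<tau> (abs_L2 g) z) = cwig (1 - \<tau>) (abs_L2 g) (abs_L2 g) z" for z
      by (simp add: wigner_eq_Q_distr[OF assms] Q_distr_def cwig_def[symmetric] cnj_cwig[OF assms])
    then show "cinner (B (abs_L2 g)) (abs_L2 g) = (\<integral>z. f z * cnj (wigner \<tau> (abs_L2 g) z) \<partial>lborel)"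
      by (simp add: B(2) symbol_form_def)
  qed
  have weyl_unique: "A = B" if "is_weyl_quant \<tau> f A" for A
    using that weyl unfolding is_weyl_quant_def
    by (intro bounded_clinear_eqI) (auto simp: bumps_schwartz)
  show "\<exists>!A. is_weyl_quant \<tau> f A"
    using weyl weyl_unique by blast
  show "\<exists>!B. is_op_conv f (S_op (1 - \<tau>)) B"
    using conv conv_unique by blast
  have "weyl_quant \<tau> f = B"
    unfolding weyl_quant_def using weyl weyl_unique by (rule the_equality)
  moreover have "op_conv f (S_op (1 - \<tau>)) = B"
    unfolding op_conv_def using conv conv_unique by (rule the_equality)
  ultimately show "weyl_quant \<tau> f = op_conv f (S_op (1 - \<tau>))" "compact_operator (weyl_quant \<tau> f)"
    using B(1) by simp_all
qed

end
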